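(* Let $\mathbf p=(p_1,\dots,p_8)$ be eight pairwise distinct points in $\mathbb P^2_{\mathbb C}$. The following are equivalent: (1) the set $L_{\mathbf p}\cap\mathcal D$ of singular cubics through $\mathbf p$ is finite; (2) there is an irreducible cubic through $\mathbf p$; (3) no four points of $\mathbf p$ lie on a line and no seven points of $\mathbf p$ lie on a conic; (4) the residue of the scheme $Z(L_{\mathbf p})$ with respect to $\mathbf p$ is a single reduced point $p_9$.
   Context: A conic is an irreducible plane quadric. $\mathbb PS^3\mathbb C^3\cong\mathbb P^9$ is the space of plane cubics and $\mathcal D$ is the discriminant hypersurface of singular cubics. $L_{\mathbf p}\subset\mathbb PS^3\mathbb C^3$ is the linear space of cubics vanishing at $p_1,\dots,p_8$. $Z(L_{\mathbf p})\subset\mathbb P^2_{\mathbb C}$, the base locus, is the scheme defined by the ideal $(L_{\mathbf p})$ generated by the cubics in $L_{\mathbf p}$. The residue of $Z(L_{\mathbf p})$ with respect to $\mathbf p$ is the scheme defined by the ideal quotient $(L_{\mathbf p}):I(\mathbf p)$, where $I(\mathbf p)$ is the homogeneous ideal of the set $\{p_1,\dots,p_8\}$. (The point $p_9$ is called the Cayley–Bacharach point of $\mathbf p$; it may coincide with some $p_i$.) *)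

theory Defs
  imports
    "HOL-Analysis.Analysis"
    "HOL-Library.Poly_Mapping"
    "HOL-Library.Numeral_Type"
    "HOL-Computational_Algebra.Factorial_Ring"
begin

section \<open>Projectivization\<close>

text \<open>The points of the projective space of a linear subspace \<open>V\<close> are its one-dimensional subspaces.\<close>

definition projectivization ::
    "('k::field \<Rightarrow> 'v::ab_group_add \<Rightarrow> 'v) \<Rightarrow> 'v set \<Rightarrow> 'v set set"
  where "projectivization smul V = {module.span smul {v} | v. v \<in> V \<and> v \<noteq> 0}"

typedef proj_plane = "projectivization ((*s) :: complex \<Rightarrow> complex ^ 3 \<Rightarrow> complex ^ 3) UNIV"
  unfolding projectivization_def by (auto intro!: exI[of _ 1])

section \<open>Polynomials in three variables\<close>

text \<open>
  The ring \<open>\<complex>[x\<^sub>0, x\<^sub>1, x\<^sub>2]\<close>: a polynomial is a finitely supported map from exponent vectors to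
  coefficients, with the product that \<open>HOL-Library.Poly_Mapping\<close> provides (convolution). The three
  variables are indexed by the elements of the three-element type \<open>3\<close>.
\<close>

type_synonym poly3 = "(3 \<Rightarrow>\<^sub>0 nat) \<Rightarrow>\<^sub>0 complex"

definition poly_scale :: "complex \<Rightarrow> poly3 \<Rightarrow> poly3"
  where "poly_scale c f = Poly_Mapping.single 0 c * f"

definition poly_eval :: "poly3 \<Rightarrow> complex ^ 3 \<Rightarrow> complex"
  where "poly_eval f v =
    (\<Sum>m\<in>Poly_Mapping.keys f. Poly_Mapping.lookup f m * (\<Prod>i\<in>UNIV. v $ i ^ Poly_Mapping.lookup m i))"

definition partial_deriv :: "3 \<Rightarrow> poly3 \<Rightarrow> poly3"
  where "partial_deriv i f =
    (\<Sum>m\<in>Poly_Mapping.keys f. Poly_Mapping.single (m - Poly_Mapping.single i 1)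
        (of_nat (Poly_Mapping.lookup m i) * Poly_Mapping.lookup f m))"

text \<open>The zero polynomial is homogeneous of every degree.\<close>

definition homogeneous :: "nat \<Rightarrow> poly3 \<Rightarrow> bool"
  where "homogeneous d f \<longleftrightarrow> (\<forall>m\<in>Poly_Mapping.keys f. (\<Sum>i\<in>UNIV. Poly_Mapping.lookup m i) = d)"

text \<open>
  A polynomial vanishes at a point when it vanishes at all vectors of the corresponding line in
  \<open>\<complex>\<^sup>3\<close>; for a homogeneous polynomial one nonzero vector is enough.
\<close>

definition vanishes_at :: "poly3 \<Rightarrow> proj_plane \<Rightarrow> bool"
  where "vanishes_at f q \<longleftrightarrow> (\<forall>v\<in>Rep_proj_plane q. poly_eval f v = 0)"

section \<open>Plane curves\<close>

definition is_line :: "poly3 \<Rightarrow> bool"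
  where "is_line f \<longleftrightarrow> homogeneous 1 f \<and> f \<noteq> 0"

definition is_conic :: "poly3 \<Rightarrow> bool"
  where "is_conic f \<longleftrightarrow> homogeneous 2 f \<and> irreducible f"

definition singular_at :: "poly3 \<Rightarrow> proj_plane \<Rightarrow> bool"
  where "singular_at f q \<longleftrightarrow> vanishes_at f q \<and> (\<forall>i. vanishes_at (partial_deriv i f) q)"

text \<open>
  Plane cubics are points of \<open>\<P>S\<^sup>3\<complex>\<^sup>3\<close>, so proportional cubic forms give the same cubic.
\<close>

definition discriminant :: "poly3 set set"
  where "discriminant =
    {c \<in> projectivization poly_scale {f. homogeneous 3 f}. \<exists>f\<in>c. f \<noteq> 0 \<and> (\<exists>q. singular_at f q)}"

definition cubics_through :: "('i \<Rightarrow> proj_plane) \<Rightarrow> poly3 set set"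
  where "cubics_through p =
    projectivization poly_scale {f. homogeneous 3 f \<and> (\<forall>i. vanishes_at f (p i))}"

section \<open>Homogeneous ideals and closed subschemes of the plane\<close>

text \<open>An ideal of a commutative ring is a submodule of the ring.\<close>

definition ideal_generated :: "'a::comm_ring_1 set \<Rightarrow> 'a set"
  where "ideal_generated B = module.span (*) B"

definition ideal_quotient :: "'a::comm_ring_1 set \<Rightarrow> 'a set \<Rightarrow> 'a set"
  where "ideal_quotient I J = {f. \<forall>g\<in>J. f * g \<in> I}"

definition vanishing_ideal :: "proj_plane set \<Rightarrow> poly3 set"
  where "vanishing_ideal Y =
    ideal_generated {f. (\<exists>d. homogeneous d f) \<and> (\<forall>q\<in>Y. vanishes_at f q)}"

text \<open>
  Setting \<open>x\<^sub>i = 1\<close> identifies the degree-zero part of \<open>\<complex>[x\<^sub>0, x\<^sub>1, x\<^sub>2]\<close> localized at \<open>x\<^sub>i\<close> with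
  the polynomials in the two remaining variables, the coordinate ring of the affine chart
  \<open>x\<^sub>i \<noteq> 0\<close>.
\<close>

definition dehomogenize :: "3 \<Rightarrow> poly3 \<Rightarrow> poly3"
  where "dehomogenize i f =
    (\<Sum>m\<in>Poly_Mapping.keys f. Poly_Mapping.single (Poly_Mapping.update i 0 m) (Poly_Mapping.lookup f m))"

text \<open>
  A closed subscheme of the plane is determined by its ideals on the three standard affine charts,
  and is represented by this family of ideals. For a homogeneous ideal \<open>I\<close>, the closed subscheme
  that \<open>I\<close> defines has the ideal of all \<open>f / x\<^sub>i\<^sup>d\<close>, with \<open>f \<in> I\<close> homogeneous of degree \<open>d\<close>, on the
  \<open>i\<close>-th chart; this is the image of \<open>I\<close> under \<open>x\<^sub>i = 1\<close>. In particular, ideals which differ only in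
  an irrelevant component define the same subscheme.
\<close>

definition subscheme :: "poly3 set \<Rightarrow> 3 \<Rightarrow> poly3 set"
  where "subscheme I = (\<lambda>i. dehomogenize i ` I)"

text \<open>The one-point closed subscheme supported at \<open>q\<close> with its reduced structure.\<close>

definition reduced_point :: "proj_plane \<Rightarrow> 3 \<Rightarrow> poly3 set"
  where "reduced_point q = subscheme (vanishing_ideal {q})"

text \<open>
  The union of a set of cubics is the set of all cubic forms representing one of them (together with
  zero), so that \<open>ideal_generated (\<Union>(cubics_through p))\<close> is the ideal defining the base locus.
\<close>

definition residue :: "('i \<Rightarrow> proj_plane) \<Rightarrow> 3 \<Rightarrow> poly3 set"
  where "residue p =
    subscheme (ideal_quotient (ideal_generated (\<Union>(cubics_through p))) (vanishing_ideal (range p)))"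

end

theory Submission
  imports
    Defs
    "HOL-Computational_Algebra.Polynomial_Factorial"
    "HOL-Computational_Algebra.Field_as_Ring"
    "HOL-Computational_Algebra.Fundamental_Theorem_Algebra"
begin

text \<open>
  A reducible cubic through the eight points is a line times a conic, and in general position (no four
  points on a line, no seven on a conic) it is determined by which of the points lie on which factor.
  Hence only finitely many cubics through the points are reducible, and as these cubics form a space of
  dimension at least 2, one of them is irreducible; the same counting shows that they form a pencil.
  Conversely, if four points lie on a line or seven on a conic, then by Bezout this curve is a component
  of every cubic through the points; so none is irreducible, and the residue contains a curve. Reducible
  cubics are singular, so if no cubic is irreducible, then infinitely many are singular.

  That a pencil with an irreducible member has finitely many singular members is seen by projecting from
  a base point: the members become quadratic polynomials over the line of directions, and a singular
  member is a critical point of their discriminant. For the residue, let \<open>J\<close> be the ideal of the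
  points and \<open>I\<close> that of the pencil. In large degrees \<open>J / I\<close> is one-dimensional, and
  a general linear form is a nonzerodivisor modulo \<open>I\<close>; so the annihilator of \<open>J / I\<close> is the
  ideal of a point.
\<close>

abbreviation "lookup \<equiv> Poly_Mapping.lookup"
abbreviation "keys \<equiv> Poly_Mapping.keys"
abbreviation "single \<equiv> Poly_Mapping.single"

locale vec_space = vector_space scale for scale :: "'a::field \<Rightarrow> 'b::ab_group_add \<Rightarrow> 'b"
begin

definition fin_dim :: "'b set \<Rightarrow> bool"
  where "fin_dim S \<longleftrightarrow> (\<exists>B. finite B \<and> S \<subseteq> span B)"

lemma fin_dim_mono: "fin_dim T \<Longrightarrow> S \<subseteq> T \<Longrightarrow> fin_dim S"
  unfolding fin_dim_def by blast

lemma fin_dim_finite_independent: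
  assumes "fin_dim S" "B \<subseteq> S" "independent B"
  shows "finite B"
  using assms independent_span_bound unfolding fin_dim_def by (meson subset_trans)

lemma fin_dim_basisE:
  assumes "fin_dim S" "subspace S"
  obtains B where "finite B" "B \<subseteq> S" "independent B" "span B = S" "card B = dim S"
proof -
  obtain B where B: "B \<subseteq> S" "independent B" "S \<subseteq> span B" "card B = dim S"
    using basis_exists by blast
  moreover have "span B \<subseteq> S"
    using B(1) assms(2) span_minimal by blast
  ultimately show thesis
    using that fin_dim_finite_independent[OF assms(1)] by blast
qed

lemma fin_dim_basis_extendE:
  assumes "fin_dim S" "subspace S" "B0 \<subseteq> S" "independent B0"
  obtains B where "B0 \<subseteq> B" "finite B" "independent B" "span B = S" "card B = dim S"
proof -
  obtain B where B: "B0 \<subseteq> B" "B \<subseteq> S" "independent B" "S \<subseteq> span B"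
    using maximal_independent_subset_extend[OF assms(3,4)] by blast
  moreover have "span B \<subseteq> S"
    using B(2) assms(2) span_minimal by blast
  ultimately show thesis
    using that fin_dim_finite_independent[OF assms(1) B(2,3)] basis_card_eq_dim[of B S] by blast
qed

lemma card_le_dim_fin_dim:
  assumes "fin_dim S" "B \<subseteq> S" "independent B"
  shows "card B \<le> dim S"
proof -
  obtain C where "C \<subseteq> S" "independent C" "S \<subseteq> span C" "card C = dim S"
    using basis_exists by blast
  moreover from this have "finite C"
    using fin_dim_finite_independent assms(1) by blast
  ultimately show ?thesis
    using independent_span_bound[of C B] assms by (metis subset_trans)
qed

lemma dim_mono_fin_dim:
  assumes "fin_dim T" "S \<subseteq> T"
  shows "dim S \<le> dim T"
proof -
  obtain B where "B \<subseteq> S" "independent B" "card B = dim S"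
    using basis_exists by metis
  then show ?thesis
    using card_le_dim_fin_dim[OF assms(1), of B] assms(2) by auto
qed

lemma subspace_eqI_dim:
  assumes "subspace S" "S \<subseteq> T" "fin_dim T" "dim T \<le> dim S"
  shows "S = T"
proof (rule ccontr)
  assume "S \<noteq> T"
  then obtain x where x: "x \<in> T" "x \<notin> S"
    using assms(2) by blast
  obtain B where B: "finite B" "B \<subseteq> S" "independent B" "span B = S" "card B = dim S"
    using fin_dim_basisE[OF fin_dim_mono[OF assms(3,2)] assms(1)] .
  have "independent (insert x B)"
    using B x independent_insertI by blast
  then have "card (insert x B) \<le> dim T"
    using card_le_dim_fin_dim[OF assms(3)] x B assms(2) by blast
  moreover have "x \<notin> B"
    using x B by blast
  ultimately show False
    using B assms(4) by simp
qed

lemma dim_sums_Int_fin_dim: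
  assumes S: "subspace S" "fin_dim S" and T: "subspace T" "fin_dim T"
  shows "dim {x + y |x y. x \<in> S \<and> y \<in> T} + dim (S \<inter> T) = dim S + dim T"
proof -
  have ST: "subspace (S \<inter> T)" "fin_dim (S \<inter> T)"
    using assms subspace_inter fin_dim_mono[OF S(2)] by auto
  obtain B0 where B0: "finite B0" "B0 \<subseteq> S \<inter> T" "independent B0" "span B0 = S \<inter> T" "card B0 = dim (S \<inter> T)"
    using fin_dim_basisE[OF ST(2,1)] .
  obtain B1 where B1: "B0 \<subseteq> B1" "finite B1" "independent B1" "span B1 = S" "card B1 = dim S"
    using fin_dim_basis_extendE[OF S(2,1) _ B0(3)] B0(2) by blast
  obtain B2 where B2: "B0 \<subseteq> B2" "finite B2" "independent B2" "span B2 = T" "card B2 = dim T"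
    using fin_dim_basis_extendE[OF T(2,1) _ B0(3)] B0(2) by blast
  have fC: "finite (B2 - B0)"
    using B2 by blast
  have *: "independent (B1 \<union> D) \<and> B1 \<inter> D = {}" if "finite D" "D \<subseteq> B2 - B0" for D
    using that
  proof (induction D)
    case empty
    show ?case using B1 by simp
  next
    case (insert c D)
    have c: "c \<notin> span (B1 \<union> D)"
    proof
      assume "c \<in> span (B1 \<union> D)"
      then obtain s t where st: "c = s + t" "s \<in> span B1" "t \<in> span D"
        by (auto simp: span_Un)
      have "span D \<subseteq> T"
        using insert.prems B2(4) span_mono[of D B2] by blast
      moreover have "c \<in> T"
        using insert.prems B2(4) span_base[of c B2] by blast
      ultimately have "s \<in> T"
        using st subspace_diff[OF T(1), of c t] by auto
      then have "s \<in> span B0"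
        using st B1 B0 by blast
      then have "c \<in> span (B0 \<union> D)"
        using st by (auto simp: span_Un)
      moreover have "B0 \<union> D \<subseteq> B2 - {c}"
        using insert.hyps insert.prems B2(1) by blast
      ultimately have "c \<in> span (B2 - {c})"
        using span_mono by blast
      then show False
        using B2(3) insert.prems dependent_def by blast
    qed
    then have "c \<notin> B1"
      by (meson UnI1 span_base)
    then show ?case
      using insert c independent_insertI[OF c] by auto
  qed
  have ind: "independent (B1 \<union> (B2 - B0))" "B1 \<inter> (B2 - B0) = {}"
    using *[OF fC] by auto
  have "span (B1 \<union> (B2 - B0)) = {x + y |x y. x \<in> S \<and> y \<in> T}"
  proof -
    have "B1 \<union> (B2 - B0) = B1 \<union> B2"
      using B1 by blast
    then show ?thesis
      using B1(4) B2(4) by (simp add: span_Un)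
  qed
  then have "dim {x + y |x y. x \<in> S \<and> y \<in> T} = card (B1 \<union> (B2 - B0))"
    using dim_span_eq_card_independent[OF ind(1)] by simp
  also have "\<dots> = card B1 + (card B2 - card B0)"
    using card_Un_disjoint[OF B1(2) fC ind(2)] card_Diff_subset[OF B0(1) B2(1)] by simp
  finally show ?thesis
    using B0 B1 B2 card_mono[OF B2(2,1)] by simp
qed

lemma dim_kernel_functional:
  assumes S: "subspace S" "fin_dim S"
    and add: "\<And>x y. x \<in> S \<Longrightarrow> y \<in> S \<Longrightarrow> \<phi> (x + y) = \<phi> x + \<phi> y"
    and scl: "\<And>c x. x \<in> S \<Longrightarrow> \<phi> (scale c x) = c * \<phi> x"
    and x: "x \<in> S" "\<phi> x \<noteq> 0"
  shows "dim S = dim {y \<in> S. \<phi> y = 0} + 1"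
proof -
  let ?K = "{y \<in> S. \<phi> y = 0}"
  have "\<phi> 0 = 0"
    using scl[of x 0] x by simp
  then have K: "subspace ?K" "fin_dim ?K"
    using S add scl fin_dim_mono[OF S(2), of ?K] by (auto simp: subspace_def)
  have L: "subspace (span {x})" "fin_dim (span {x})"
    by (auto simp: fin_dim_def intro: exI[of _ "{x}"])
  have sx: "span {x} = range (\<lambda>c. scale c x)"
    by (rule span_singleton)
  have x0: "x \<noteq> 0"
    using x \<open>\<phi> 0 = 0\<close> by auto
  have "?K \<inter> span {x} = {0}"
    using x scl \<open>\<phi> 0 = 0\<close> S(1) by (auto simp: sx subspace_0 intro: range_eqI[of _ _ 0])
  moreover have "dim {0} = 0"
    using dim_le_card[of "{0}" "{}"] by simp
  moreover have "dim (span {x}) = 1"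
    using dim_span_eq_card_independent[of "{x}"] x0 by simp
  moreover have "{a + b |a b. a \<in> ?K \<and> b \<in> span {x}} = S"
  proof (intro equalityI subsetI)
    fix y assume "y \<in> {a + b |a b. a \<in> ?K \<and> b \<in> span {x}}"
    then show "y \<in> S"
      using S(1) x by (auto simp: sx subspace_add subspace_scale)
  next
    fix y assume y: "y \<in> S"
    define c where "c = \<phi> y / \<phi> x"
    have e: "y - scale c x = y + scale (- c) x"
      by simp
    have "\<phi> (y - scale c x) = \<phi> y + \<phi> (scale (- c) x)"
      unfolding e using add x y subspace_scale[OF S(1)] by blast
    then have "\<phi> (y - scale c x) = 0"
      using scl[of x "- c"] x by (simp add: c_def del: scale_minus_left)
    then have "y - scale c x \<in> ?K"
      using S(1) x y by (simp add: subspace_diff subspace_scale)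
    then show "y \<in> {a + b |a b. a \<in> ?K \<and> b \<in> span {x}}"
      by (intro CollectI exI[of _ "y - scale c x"] exI[of _ "scale c x"]) (auto simp: sx)
  qed
  ultimately show ?thesis
    using dim_sums_Int_fin_dim[OF K L] by simp
qed

lemma dim_kernel_functional_le:
  assumes S: "subspace S" "fin_dim S"
    and add: "\<And>x y. x \<in> S \<Longrightarrow> y \<in> S \<Longrightarrow> \<phi> (x + y) = \<phi> x + \<phi> y"
    and scl: "\<And>c x. x \<in> S \<Longrightarrow> \<phi> (scale c x) = c * \<phi> x"
  shows "dim S \<le> dim {y \<in> S. \<phi> y = 0} + 1"
proof (cases "\<exists>x\<in>S. \<phi> x \<noteq> 0")
  case True
  then show ?thesis
    using dim_kernel_functional[of S \<phi>] assms by force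
next
  case False
  then have "{y \<in> S. \<phi> y = 0} = S"
    by auto
  then show ?thesis
    by simp
qed

lemma dim_inj_image:
  assumes S: "subspace S" "fin_dim S"
    and lin: "Vector_Spaces.linear scale scale f" and inj: "inj_on f S"
  shows "dim (f ` S) = dim S" and "subspace (f ` S)" and "fin_dim (f ` S)"
proof -
  interpret f: Vector_Spaces.linear scale scale f
    by (rule lin)
  interpret p: vector_space_pair scale scale ..
  obtain B where B: "finite B" "B \<subseteq> S" "independent B" "span B = S" "card B = dim S"
    using fin_dim_basisE[OF S(2,1)] .
  have "independent (f ` B)"
    using p.linear_independent_injective_image[OF lin B(3)] B(4) inj by simp
  moreover have sp: "span (f ` B) = f ` S"
    using f.span_image[of B] B by simp
  moreover have "card (f ` B) = card B"
    using B inj by (meson card_image inj_on_subset)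
  ultimately show "dim (f ` S) = dim S"
    using dim_span_eq_card_independent B(5) by metis
  show "subspace (f ` S)"
    using sp subspace_span by metis
  show "fin_dim (f ` S)"
    unfolding fin_dim_def using sp B(1) by blast
qed

lemma dim_ge_2E:
  assumes "2 \<le> dim S" "subspace S" "fin_dim S" 
  obtains x y where "x \<in> S" "y \<in> S" "x \<noteq> 0" "y \<notin> span {x}"
proof -
  obtain B where B: "finite B" "B \<subseteq> S" "independent B" "span B = S" "card B = dim S"
    using fin_dim_basisE[OF assms(3,2)] .
  then obtain x where x: "x \<in> B"
    using assms(1) by fastforce
  have "\<not> S \<subseteq> span {x}"
    using dim_le_card[of S "{x}"] assms(1) by auto
  moreover have "x \<noteq> 0"
    using x B(3) dependent_zero by blast
  ultimately show thesis
    using that x B(2) by blast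
qed

lemma span_pair_eqI_dim:
  assumes "subspace S" "fin_dim S" "dim S \<le> 2" "x \<in> S" "y \<in> S" "x \<noteq> 0" "y \<notin> span {x}"
  shows "span {x, y} = S"
proof (rule subspace_eqI_dim)
  have "independent {x, y}"
    using independent_insertI[of y "{x}"] assms by (simp add: insert_commute)
  moreover have "x \<noteq> y"
    using assms span_base by blast
  ultimately show "dim S \<le> dim (span {x, y})"
    using dim_span_eq_card_independent[of "{x, y}"] assms(3) by simp
  show "span {x, y} \<subseteq> S"
    using assms by (simp add: span_minimal)
qed (use assms in simp_all)

lemma codim_one_coset:
  assumes S: "subspace S" and T: "subspace T" "fin_dim T" and "S \<subseteq> T" "dim T \<le> dim S + 1"
    and x: "x \<in> T" "x \<notin> S" and y: "y \<in> T"
  obtains c where "y - scale c x \<in> S"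
proof -
  obtain B where B: "finite B" "B \<subseteq> S" "independent B" "span B = S" "card B = dim S"
    using fin_dim_basisE[OF fin_dim_mono[OF T(2) assms(4)] S] .
  have "independent (insert x B)" "x \<notin> B"
    using B x independent_insertI by auto
  then have "dim (span (insert x B)) = dim S + 1"
    using B dim_span_eq_card_independent[of "insert x B"] by simp
  moreover have "span (insert x B) \<subseteq> T"
    using B assms(4) x T(1) by (intro span_minimal) auto
  ultimately have "span (insert x B) = T"
    using subspace_eqI_dim[OF subspace_span _ T(2)] assms(5) by simp
  then show thesis
    using y B(4) that by (auto simp: span_insert)
qed

end

definition Const :: "complex \<Rightarrow> poly3"
  where "Const c = single 0 c"

definition Var :: "3 \<Rightarrow> poly3"
  where "Var i = single (single i 1) 1"

lemma Const_simps [simp]: "Const 0 = 0" "Const 1 = 1"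
  by (simp_all add: Const_def)

lemma Const_add: "Const (a + b) = Const a + Const b"
  by (simp add: Const_def single_add)

lemma Const_mult: "Const (a * b) = Const a * Const b"
  by (simp add: Const_def mult_single)

lemma poly_scale_eq: "poly_scale c f = Const c * f"
  by (simp add: poly_scale_def Const_def)

lemma prod_UNIV_3: "prod f (UNIV :: 3 set) = f 1 * f 2 * f 3"
proof -
  have "(1 :: 3) \<noteq> 2" "(1 :: 3) \<noteq> 3" "(2 :: 3) \<noteq> 3" by auto
  then have "prod f {1, 2, 3 :: 3} = f 1 * (f 2 * f 3)" by simp
  then show ?thesis unfolding UNIV_3 by (simp only: mult.assoc)
qed

lemma lookup_eq_0I: "k \<notin> keys f \<Longrightarrow> lookup f k = 0"
  by (meson in_keys_iff)

lemma poly_mapping_eq_sum_single: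
  "f = (\<Sum>m\<in>keys f. single m (lookup f m))"
proof (rule poly_mapping_eqI)
  fix k
  have "(\<Sum>m\<in>keys f. lookup (single m (lookup f m)) k)
    = (\<Sum>m\<in>keys f. if m = k then lookup f m else 0)"
    by (rule sum.cong) (auto simp: lookup_single_not_eq)
  then show "lookup f k = lookup
      (\<Sum>m\<in>keys f. single m (lookup f m)) k"
    by (auto simp: lookup_sum lookup_eq_0I)
qed

lemma poly_mapping_add_induct [case_names zero single add]:
  assumes "P 0" "\<And>m c. P (single m c)" "\<And>f g. P f \<Longrightarrow> P g \<Longrightarrow> P (f + g)"
  shows "P (f :: 'a \<Rightarrow>\<^sub>0 'b::comm_monoid_add)"
proof -
  have "P (\<Sum>m\<in>A. single m (lookup f m))" if "finite A" for A
    using that by induction (auto intro: assms)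
  from this[OF finite_keys[of f]] show ?thesis
    unfolding poly_mapping_eq_sum_single[of f, symmetric] .
qed

lemma single_eq_Const_mult_Var:
  "single m a = Const a * (\<Prod>i\<in>UNIV. Var i ^ lookup m i)"
proof -
  have pow: "Var i ^ n = single (single i n) 1" for i n
  proof (induction n)
    case 0
    show ?case by simp
  next
    case (Suc n)
    have "single i (Suc n) = single i 1 + single i n"
      by (metis plus_1_eq_Suc single_add)
    then show ?case
      unfolding power_Suc Suc.IH by (simp add: Var_def mult_single)
  qed
  have m: "m = single 1 (lookup m 1) + (single 2 (lookup m 2)
      + single 3 (lookup m 3))" (is "_ = ?m")
  proof (rule poly_mapping_eqI)
    fix k :: 3
    show "lookup m k = lookup ?m k"
      using exhaust_3[of k] by (auto simp: lookup_add lookup_single)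
  qed
  show ?thesis
    unfolding pow Const_def by (subst (1) m) (simp add: prod_UNIV_3 mult_single add.assoc)
qed

lemma poly3_induct [case_names const var add mult]:
  assumes "\<And>c. P (Const c)" "\<And>i. P (Var i)" "\<And>f g. P f \<Longrightarrow> P g \<Longrightarrow> P (f + g)"
    and "\<And>f g. P f \<Longrightarrow> P g \<Longrightarrow> P (f * g)"
  shows "P (f :: poly3)"
proof (induction f rule: poly_mapping_add_induct)
  case zero
  show ?case using assms(1)[of 0] by simp
next
  case (single m c)
  have one: "P 1" using assms(1)[of 1] by simp
  have "P (Var i ^ n)" for i n
  proof (induction n)
    case (Suc n)
    then show ?case
      unfolding power_Suc by (rule assms(4)[OF assms(2)])
  qed (simp add: one)
  then show ?case
    by (subst single_eq_Const_mult_Var, subst prod_UNIV_3) (intro assms(1,4))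
next
  case (add f g)
  then show ?case by (rule assms(3))
qed

subsection \<open>Evaluation homomorphisms\<close>

locale const_hom =
  fixes \<kappa> :: "complex \<Rightarrow> 'a::comm_ring_1"
  assumes zero: "\<kappa> 0 = 0" and one: "\<kappa> 1 = 1"
    and add: "\<kappa> (a + b) = \<kappa> a + \<kappa> b" and mult: "\<kappa> (a * b) = \<kappa> a * \<kappa> b"

definition ring_eval :: "(complex \<Rightarrow> 'a) \<Rightarrow> (3 \<Rightarrow> 'a) \<Rightarrow> poly3 \<Rightarrow> 'a::comm_ring_1"
  where "ring_eval \<kappa> x f =
    (\<Sum>m\<in>keys f. \<kappa> (lookup f m) * (\<Prod>i\<in>UNIV. x i ^ lookup m i))"

context const_hom
begin

lemma ring_eval_zero [simp]: "ring_eval \<kappa> x 0 = 0"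
  by (simp add: ring_eval_def)

lemma ring_eval_single: "ring_eval \<kappa> x (single m a) = \<kappa> a * (\<Prod>i\<in>UNIV. x i ^ lookup m i)"
  by (auto simp: ring_eval_def zero)

lemma ring_eval_Const [simp]: "ring_eval \<kappa> x (Const a) = \<kappa> a"
  by (simp add: Const_def ring_eval_single)

lemma ring_eval_one [simp]: "ring_eval \<kappa> x 1 = 1"
  using ring_eval_Const[of x 1] by (simp add: one)

lemma ring_eval_Var [simp]: "ring_eval \<kappa> x (Var i) = x i"
  using exhaust_3[of i] by (auto simp: Var_def ring_eval_single prod_UNIV_3 lookup_single when_def one)

lemma ring_eval_add: "ring_eval \<kappa> x (f + g) = ring_eval \<kappa> x f + ring_eval \<kappa> x g"
  unfolding ring_eval_def by (rule setsum_keys_plus_distrib) (simp_all add: zero add algebra_simps)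

lemma ring_eval_mult: "ring_eval \<kappa> x (f * g) = ring_eval \<kappa> x f * ring_eval \<kappa> x g"
proof (induction f rule: poly_mapping_add_induct)
  case (single m a)
  show ?case
  proof (induction g rule: poly_mapping_add_induct)
    case (single n b)
    then show ?case
      by (simp add: mult_single ring_eval_single lookup_add power_add prod.distrib mult algebra_simps)
  qed (simp_all add: ring_eval_add algebra_simps)
qed (simp_all add: ring_eval_add algebra_simps)

lemma ring_eval_uminus: "ring_eval \<kappa> x (- f) = - ring_eval \<kappa> x f"
  using ring_eval_add[of x f "- f"] by (simp add: add_eq_0_iff2)

lemma ring_eval_diff: "ring_eval \<kappa> x (f - g) = ring_eval \<kappa> x f - ring_eval \<kappa> x g"
  using ring_eval_add[of x f "- g"] by (simp add: ring_eval_uminus)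

lemma ring_eval_sum: "ring_eval \<kappa> x (sum f A) = (\<Sum>a\<in>A. ring_eval \<kappa> x (f a))"
  by (induction A rule: infinite_finite_induct) (simp_all add: ring_eval_add)

lemma ring_eval_prod: "ring_eval \<kappa> x (prod f A) = (\<Prod>a\<in>A. ring_eval \<kappa> x (f a))"
  by (induction A rule: infinite_finite_induct) (simp_all add: ring_eval_mult)

lemma ring_eval_power: "ring_eval \<kappa> x (f ^ n) = ring_eval \<kappa> x f ^ n"
  by (induction n) (simp_all add: ring_eval_mult)

lemmas ring_eval_simps = ring_eval_add ring_eval_mult ring_eval_uminus ring_eval_diff
  ring_eval_sum ring_eval_prod ring_eval_power

end

interpretation poly_eval_hom: const_hom "\<lambda>a. a"
  by unfold_locales auto

lemma poly_eval_eq_ring_eval: "poly_eval f v = ring_eval (\<lambda>a. a) (\<lambda>i. v $ i) f"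
  by (simp add: poly_eval_def ring_eval_def)

lemma poly_eval_simps [simp]:
  "poly_eval 0 v = 0" "poly_eval 1 v = 1"
  "poly_eval (Const c) v = c" "poly_eval (Var i) v = v $ i"
  "poly_eval (f + g) v = poly_eval f v + poly_eval g v"
  "poly_eval (f - g) v = poly_eval f v - poly_eval g v"
  "poly_eval (- f) v = - poly_eval f v"
  "poly_eval (f * g) v = poly_eval f v * poly_eval g v"
  "poly_eval (f ^ n) v = poly_eval f v ^ n"
  "poly_eval (sum h A) v = (\<Sum>a\<in>A. poly_eval (h a) v)"
  "poly_eval (prod h A) v = (\<Prod>a\<in>A. poly_eval (h a) v)"
  unfolding poly_eval_eq_ring_eval
  by (rule poly_eval_hom.ring_eval_zero poly_eval_hom.ring_eval_one poly_eval_hom.ring_eval_Const poly_eval_hom.ring_eval_Var poly_eval_hom.ring_eval_simps)+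

lemma poly_eval_scale [simp]: "poly_eval (poly_scale c f) v = c * poly_eval f v"
  by (simp add: poly_scale_eq)

interpretation poly3: vec_space poly_scale
proof
  fix a b :: complex and f g :: poly3
  show "poly_scale a (f + g) = poly_scale a f + poly_scale a g"
    by (simp add: poly_scale_eq distrib_left)
  show "poly_scale (a + b) f = poly_scale a f + poly_scale b f"
    by (simp add: poly_scale_eq Const_add distrib_right)
  show "poly_scale a (poly_scale b f) = poly_scale (a * b) f"
    by (simp add: poly_scale_eq Const_mult mult.assoc)
  show "poly_scale 1 f = f"
    by (simp add: poly_scale_eq)
qed

subsection \<open>The ring of polynomials is factorial\<close>

interpretation tower: const_hom "\<lambda>a. [:[:[:a:]:]:]"
  by unfold_locales (simp_all add: one_pCons)

text \<open>The type \<open>poly3\<close> has no instance of unique factorization; it is transported from iterated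
  univariate polynomials.\<close>

definition tower :: "poly3 \<Rightarrow> complex poly poly poly"
  where "tower = ring_eval (\<lambda>a. [:[:[:a:]:]:])
    (\<lambda>i. if i = 1 then [:[:[:0, 1:]:]:] else if i = 2 then [:[:0, 1:]:] else [:0, 1:])"

lemma tower_simps:
  "tower (f + g) = tower f + tower g" "tower (f * g) = tower f * tower g" "tower 1 = 1" "tower 0 = 0"
  "tower (f - g) = tower f - tower g" "tower (Const c) = [:[:[:c:]:]:]"
  "tower (Var 1) = [:[:[:0, 1:]:]:]" "tower (Var 2) = [:[:0, 1:]:]" "tower (Var 3) = [:0, 1:]"
  by (simp_all add: tower_def tower.ring_eval_simps)

lemma poly_tower: "poly (poly (poly (tower f) [:[:z:]:]) [:y:]) x = poly_eval f (vector [x, y, z])"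
proof (induction f rule: poly3_induct)
  case (var i)
  then show ?case
    using exhaust_3[of i] by (auto simp: tower_simps)
qed (simp_all add: tower_simps)

lemma tower_eq_monom: "tower f = (\<Sum>m\<in>keys f. monom (monom (monom (lookup f m)
    (lookup m 1)) (lookup m 2)) (lookup m 3))"
  unfolding tower_def ring_eval_def
proof (rule sum.cong[OF refl])
  fix m
  have pow: "[:0, 1:] ^ n = (monom 1 n :: 'a::comm_semiring_1 poly)" for n
    using monom_altdef[of "1 :: 'a" n] by simp
  have const: "[:a:] ^ n = [:a ^ n:]" for n and a :: "'a::comm_semiring_1"
    by (induction n) (simp_all add: one_pCons mult.commute)
  show "[:[:[:lookup f m:]:]:] * (\<Prod>i\<in>UNIV. (if i = 1 then [:[:[:0, 1:]:]:] else if i = 2 then [:[:0, 1:]:]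
       else [:0, 1:]) ^ lookup m i) = monom (monom (monom (lookup f m)
    (lookup m 1)) (lookup m 2)) (lookup m 3)"
    by (simp add: prod_UNIV_3 const pow smult_monom)
qed

lemma coeff_tower: "coeff (coeff (coeff (tower f) (lookup m 3)) (lookup m 2)) (lookup m 1)
    = lookup f m"
proof -
  have eq: "n = m \<longleftrightarrow> lookup n 1 = lookup m 1 \<and>
      lookup n 2 = lookup m 2 \<and> lookup n 3 = lookup m 3"
    for n :: "3 \<Rightarrow>\<^sub>0 nat"
    by (auto simp: poly_mapping_eq_iff fun_eq_iff forall_3)
  have "coeff (coeff (coeff (tower f) (lookup m 3)) (lookup m 2)) (lookup m 1)
     = (\<Sum>n\<in>keys f. if n = m then lookup f n else 0)"
    unfolding tower_eq_monom coeff_sum by (rule sum.cong[OF refl]) (auto simp: eq)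
  then show ?thesis
    by (auto simp: lookup_eq_0I)
qed

lemma inj_tower: "inj tower"
  by (rule injI) (metis coeff_tower poly_mapping_eqI)

lemma surj_tower: "surj tower"
proof -
  have 1: "[:[:p:]:] \<in> range tower" for p :: "complex poly"
  proof (induction p)
    case 0
    show ?case by (rule range_eqI[of _ _ 0]) (simp add: tower_simps)
  next
    case (pCons a p)
    then obtain f where "tower f = [:[:p:]:]" by auto
    then have "tower (Const a + Var 1 * f) = [:[:pCons a p:]:]"
      by (simp add: tower_simps)
    then show ?case by (metis rangeI)
  qed
  have 2: "[:p:] \<in> range tower" for p :: "complex poly poly"
  proof (induction p)
    case 0
    show ?case by (rule range_eqI[of _ _ 0]) (simp add: tower_simps)
  next
    case (pCons a p)
    then obtain f where "tower f = [:p:]" by auto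
    moreover obtain g where "tower g = [:[:a:]:]" using 1[of a] by auto
    ultimately have "tower (g + Var 2 * f) = [:pCons a p:]"
      by (simp add: tower_simps)
    then show ?case by (metis rangeI)
  qed
  have "p \<in> range tower" for p
  proof (induction p)
    case 0
    show ?case by (rule range_eqI[of _ _ 0]) (simp add: tower_simps)
  next
    case (pCons a p)
    then obtain f where "tower f = p" by auto
    moreover obtain g where "tower g = [:a:]" using 2[of a] by auto
    ultimately have "tower (g + Var 3 * f) = pCons a p"
      by (simp add: tower_simps)
    then show ?case by (metis rangeI)
  qed
  then show ?thesis by blast
qed

lemma tower_dvd_iff: "tower f dvd tower g \<longleftrightarrow> f dvd g"
proof
  assume "tower f dvd tower g"
  then obtain h where "tower g = tower f * tower h"
    using surj_tower by (metis dvdE surjD)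
  then show "f dvd g"
    using inj_tower by (metis dvdI injD tower_simps(2))
qed (auto simp: tower_simps)

lemma irreducible_poly3_imp_prime_elem:
  assumes "irreducible (f :: poly3)"
  shows "prime_elem f"
proof -
  have unit: "tower g dvd 1 \<longleftrightarrow> g dvd 1" for g
    using tower_dvd_iff[of g 1] by (simp add: tower_simps)
  have zero: "tower g = 0 \<longleftrightarrow> g = 0" for g
    using inj_tower by (metis injD tower_simps(4))
  have "irreducible (tower f)"
  proof (rule irreducibleI)
    fix a b assume ab: "tower f = a * b"
    obtain a' b' where "a = tower a'" "b = tower b'"
      using surj_tower by (metis surjD)
    moreover from this ab have "f = a' * b'"
      using inj_tower by (metis injD tower_simps(2))
    ultimately show "a dvd 1 \<or> b dvd 1"
      using assms irreducibleD unit by blast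
  qed (use assms unit zero in \<open>auto simp: irreducible_def\<close>)
  then have "prime_elem (tower f)"
    by (rule irreducible_imp_prime_elem)
  then show ?thesis
    unfolding prime_elem_def by (metis tower_dvd_iff tower_simps(2) unit zero)
qed

lemma poly_eval_eq_0_imp_eq_0:
  assumes "\<And>v. poly_eval f v = 0"
  shows "f = 0"
proof -
  have inf_roots: "p = 0" if "\<And>z. poly p (k z) = 0" "inj k" for p :: "'b::idom poly" and k :: "complex \<Rightarrow> 'b"
  proof (rule ccontr)
    assume "p \<noteq> 0"
    then have "finite {x. poly p x = 0}"
      by (rule poly_roots_finite)
    moreover have "range k \<subseteq> {x. poly p x = 0}"
      using that by auto
    ultimately show False
      using finite_subset finite_imageD[OF _ that(2)] infinite_UNIV_char_0 by metis
  qed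
  have "poly (poly (poly (tower f) [:[:z:]:]) [:y:]) x = 0" for x y z
    by (simp add: poly_tower assms)
  then have "poly (poly (tower f) [:[:z:]:]) [:y:] = 0" for y z
    by (rule inf_roots[of _ "\<lambda>x. x"]) (simp add: inj_def)
  then have "poly (tower f) [:[:z:]:] = 0" for z
    by (rule inf_roots[of _ "\<lambda>y. [:y:]"]) (simp add: inj_def)
  then have "tower f = 0"
    by (rule inf_roots[of _ "\<lambda>z. [:[:z:]:]"]) (simp add: inj_def)
  then show ?thesis
    using inj_tower by (metis injD tower_simps(4))
qed

subsection \<open>Homogeneous polynomials\<close>

abbreviation mdeg :: "(3 \<Rightarrow>\<^sub>0 nat) \<Rightarrow> nat"
  where "mdeg m \<equiv> (\<Sum>i\<in>UNIV. lookup m i)"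

abbreviation forms :: "nat \<Rightarrow> poly3 set"
  where "forms d \<equiv> {f. homogeneous d f}"

lemma mdeg_add: "mdeg (m + n) = mdeg m + mdeg n"
  by (simp add: lookup_add sum.distrib)

lemma homogeneous_iff_lookup: "homogeneous d f \<longleftrightarrow> (\<forall>m. lookup f m \<noteq> 0 \<longrightarrow> mdeg m = d)"
  unfolding homogeneous_def by (meson in_keys_iff)

lemma homogeneous_0 [simp]: "homogeneous d 0"
  by (simp add: homogeneous_def)

lemma homogeneous_add: "homogeneous d f \<Longrightarrow> homogeneous d g \<Longrightarrow> homogeneous d (f + g)"
  by (auto simp: homogeneous_iff_lookup lookup_add) (metis add_0)

lemma homogeneous_uminus: "homogeneous d f \<Longrightarrow> homogeneous d (- f)"
  by (auto simp: homogeneous_iff_lookup)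

lemma homogeneous_diff: "homogeneous d f \<Longrightarrow> homogeneous d g \<Longrightarrow> homogeneous d (f - g)"
  using homogeneous_add[of d f "- g"] homogeneous_uminus[of d g] by simp

lemma homogeneous_sum: "(\<And>a. a \<in> A \<Longrightarrow> homogeneous d (f a)) \<Longrightarrow> homogeneous d (sum f A)"
  by (induction A rule: infinite_finite_induct) (auto intro: homogeneous_add)

lemma homogeneous_single: "mdeg m = d \<Longrightarrow> homogeneous d (single m c)"
  by (auto simp: homogeneous_def)

lemma homogeneous_Const [simp]: "homogeneous 0 (Const c)"
  by (auto simp: Const_def intro: homogeneous_single)

lemma homogeneous_Var [simp]: "homogeneous 1 (Var i)" "homogeneous (Suc 0) (Var i)"
proof -
  have "mdeg (single i 1) = 1"
    using exhaust_3[of i] by (auto simp: sum_3 lookup_single when_def)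
  then show "homogeneous 1 (Var i)"
    unfolding Var_def by (rule homogeneous_single)
  then show "homogeneous (Suc 0) (Var i)"
    by simp
qed

lemma homogeneous_mult:
  assumes "homogeneous d f" "homogeneous e g"
  shows "homogeneous (d + e) (f * g)"
  unfolding homogeneous_def
proof
  fix m assume "m \<in> keys (f * g)"
  then obtain a b where "m = a + b" "a \<in> keys f" "b \<in> keys g"
    using keys_mult by blast
  then show "mdeg m = d + e"
    using assms mdeg_add unfolding homogeneous_def by metis
qed

lemma homogeneous_Const_mult: "homogeneous d f \<Longrightarrow> homogeneous d (Const c * f)"
  using homogeneous_mult[of 0 "Const c" d f] by simp

lemma homogeneous_scale: "homogeneous d f \<Longrightarrow> homogeneous d (poly_scale c f)"
  by (simp add: poly_scale_eq homogeneous_Const_mult)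

lemma homogeneous_power: "homogeneous d f \<Longrightarrow> homogeneous (n * d) (f ^ n)"
proof (induction n)
  case 0
  show ?case using homogeneous_Const[of 1] by simp
next
  case (Suc n)
  then show ?case using homogeneous_mult[of d f "n * d" "f ^ n"] by simp
qed

lemma homogeneous_unique: "homogeneous d f \<Longrightarrow> homogeneous e f \<Longrightarrow> f \<noteq> 0 \<Longrightarrow> d = e"
  unfolding homogeneous_iff_lookup by (metis lookup_zero poly_mapping_eqI)

lemma poly_eval_homogeneous:
  assumes "homogeneous d f"
  shows "poly_eval f (c *s v) = c ^ d * poly_eval f v"
  unfolding poly_eval_def sum_distrib_left
proof (rule sum.cong[OF refl])
  fix m assume "m \<in> keys f"
  then have "mdeg m = d"
    using assms unfolding homogeneous_def by blast
  then have "c ^ d = (\<Prod>i\<in>UNIV. c ^ lookup m i)"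
    using power_sum[of c "lookup m" UNIV] by metis
  then show "lookup f m * (\<Prod>i\<in>UNIV. (c *s v) $ i ^ lookup m i) =
      c ^ d * (lookup f m * (\<Prod>i\<in>UNIV. v $ i ^ lookup m i))"
    by (simp add: power_mult_distrib prod.distrib)
qed

definition hcomp :: "nat \<Rightarrow> poly3 \<Rightarrow> poly3"
  where "hcomp d f = (\<Sum>m\<in>{m \<in> keys f. mdeg m = d}. single m (lookup f m))"

lemma lookup_hcomp: "lookup (hcomp d f) m = (if mdeg m = d then lookup f m else 0)"
proof -
  have "lookup (hcomp d f) m
     = (\<Sum>n\<in>{m \<in> keys f. mdeg m = d}. if n = m then lookup f n else 0)"
    unfolding hcomp_def lookup_sum by (rule sum.cong) (auto simp: lookup_single_not_eq)
  then show ?thesis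
    by (auto simp: lookup_eq_0I)
qed

lemma homogeneous_hcomp [simp]: "homogeneous d (hcomp d f)"
  by (auto simp: homogeneous_iff_lookup lookup_hcomp)

lemma hcomp_0 [simp]: "hcomp d 0 = 0"
  by (rule poly_mapping_eqI) (simp add: lookup_hcomp)

lemma hcomp_add: "hcomp d (f + g) = hcomp d f + hcomp d g"
  by (rule poly_mapping_eqI) (simp add: lookup_hcomp lookup_add)

lemma hcomp_sum: "hcomp d (sum f A) = (\<Sum>a\<in>A. hcomp d (f a))"
  by (induction A rule: infinite_finite_induct) (simp_all add: hcomp_add)

lemma hcomp_homogeneous: "homogeneous e f \<Longrightarrow> hcomp d f = (if d = e then f else 0)"
  by (rule poly_mapping_eqI) (auto simp: lookup_hcomp homogeneous_iff_lookup)

lemma sum_hcomp_superset: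
  assumes "finite D" "mdeg ` keys f \<subseteq> D"
  shows "(\<Sum>d\<in>D. hcomp d f) = f"
  using assms by (intro poly_mapping_eqI) (auto simp: lookup_sum lookup_hcomp image_subset_iff lookup_eq_0I)

lemma sum_hcomp: "(\<Sum>d\<in>mdeg ` keys f. hcomp d f) = f"
  by (rule sum_hcomp_superset) auto

lemma hcomp_eq_0I: "d \<notin> mdeg ` keys f \<Longrightarrow> hcomp d f = 0"
  unfolding hcomp_def by (rule sum.neutral) auto

lemma hcomp_mult_homogeneous:
  assumes "homogeneous n g"
  shows "hcomp d (f * g) = (if n \<le> d then hcomp (d - n) f * g else 0)"
proof -
  let ?D = "mdeg ` keys f"
  have "hcomp d (f * g) = hcomp d (\<Sum>e\<in>?D. hcomp e f * g)"
    by (simp add: sum_hcomp flip: sum_distrib_right)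
  also have "\<dots> = (\<Sum>e\<in>?D. if d = e + n then hcomp e f * g else 0)"
    unfolding hcomp_sum
    by (intro sum.cong refl) (simp add: hcomp_homogeneous[OF homogeneous_mult[OF homogeneous_hcomp assms]])
  also have "\<dots> = (\<Sum>e\<in>?D. if e = d - n then (if n \<le> d then hcomp (d - n) f * g else 0) else 0)"
    by (intro sum.cong refl) auto
  also have "\<dots> = (if n \<le> d then hcomp (d - n) f * g else 0)"
    by (auto simp: hcomp_eq_0I)
  finally show ?thesis .
qed

lemma hcomp_mult:
  "hcomp d (f * g) = (\<Sum>e\<in>mdeg ` keys f. if e \<le> d then hcomp e f * hcomp (d - e) g else 0)"
proof -
  have "hcomp d (f * g) = hcomp d (\<Sum>e\<in>mdeg ` keys f. hcomp e f * g)"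
    by (simp add: sum_hcomp flip: sum_distrib_right)
  moreover have "hcomp d (hcomp e f * g) = (if e \<le> d then hcomp e f * hcomp (d - e) g else 0)" for e
    using hcomp_mult_homogeneous[OF homogeneous_hcomp[of e f], of d g] by (simp only: mult.commute)
  ultimately show ?thesis
    by (simp only: hcomp_sum)
qed

lemma homogeneous_factors:
  assumes "homogeneous d (f * g)" "f * g \<noteq> 0"
  obtains a b where "homogeneous a f" "homogeneous b g" "a + b = d"
proof -
  let ?F = "mdeg ` keys f" and ?G = "mdeg ` keys g"
  have ne: "?F \<noteq> {}" "?G \<noteq> {}"
    using assms(2) by auto
  have fin: "finite ?F" "finite ?G"
    by auto
  have nz: "hcomp e h \<noteq> 0" if "e \<in> mdeg ` keys h" for e h
  proof
    assume "hcomp e h = 0"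
    then have "lookup h m = 0" if "mdeg m = e" for m
      using lookup_hcomp[of e h m] that by simp
    then show False
      using that by (auto simp: in_keys_iff)
  qed
  have lo: "hcomp (Min ?F + Min ?G) (f * g) = hcomp (Min ?F) f * hcomp (Min ?G) g"
  proof -
    have "(if e \<le> Min ?F + Min ?G then hcomp e f * hcomp (Min ?F + Min ?G - e) g else 0) =
        (if e = Min ?F then hcomp (Min ?F) f * hcomp (Min ?G) g else 0)" if "e \<in> ?F" for e
    proof (cases "e = Min ?F")
      case False
      moreover have "Min ?F \<le> e"
        using that fin Min_le by blast
      ultimately have "Min ?F + Min ?G - e < Min ?G \<or> Min ?F + Min ?G < e"
        by linarith
      moreover have "n \<notin> ?G" if "n < Min ?G" for n
        proof
        assume "n \<in> ?G"
        from Min_le[OF fin(2) this] that show False by linarith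
      qed
      ultimately show ?thesis
        using False by (auto simp: hcomp_eq_0I)
    qed simp
    then show ?thesis
      unfolding hcomp_mult using Min_in[OF fin(1) ne(1)] fin by simp
  qed
  have hi: "hcomp (Max ?F + Max ?G) (f * g) = hcomp (Max ?F) f * hcomp (Max ?G) g"
  proof -
    have "(if e \<le> Max ?F + Max ?G then hcomp e f * hcomp (Max ?F + Max ?G - e) g else 0) =
        (if e = Max ?F then hcomp (Max ?F) f * hcomp (Max ?G) g else 0)" if "e \<in> ?F" for e
    proof (cases "e = Max ?F")
      case False
      moreover have "e \<le> Max ?F"
        using that fin Max_ge by blast
      ultimately have "Max ?G < Max ?F + Max ?G - e"
        by linarith
      moreover have "n \<notin> ?G" if "Max ?G < n" for n
        proof
        assume "n \<in> ?G"
        from Max_ge[OF fin(2) this] that show False by linarith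
      qed
      ultimately show ?thesis
        using False by (auto simp: hcomp_eq_0I)
    qed simp
    then show ?thesis
      unfolding hcomp_mult using Max_in[OF fin(1) ne(1)] fin by simp
  qed
  have lo_d: "Min ?F + Min ?G = d"
    using lo nz[OF Min_in[OF fin(1) ne(1)]] nz[OF Min_in[OF fin(2) ne(2)]]
    by (auto simp: hcomp_homogeneous[OF assms(1)] split: if_splits)
  have hi_d: "Max ?F + Max ?G = d"
    using hi nz[OF Max_in[OF fin(1) ne(1)]] nz[OF Max_in[OF fin(2) ne(2)]]
    by (auto simp: hcomp_homogeneous[OF assms(1)] split: if_splits)
  have F: "Min ?F \<le> e \<and> e \<le> Max ?F" if "e \<in> ?F" for e
    using Min_le[OF fin(1) that] Max_ge[OF fin(1) that] by (rule conjI)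
  have G: "Min ?G \<le> e \<and> e \<le> Max ?G" if "e \<in> ?G" for e
    using Min_le[OF fin(2) that] Max_ge[OF fin(2) that] by (rule conjI)
  have "Min ?F = Max ?F" and minmax: "Min ?G = Max ?G"
    using lo_d hi_d F[OF Min_in[OF fin(1) ne(1)]] G[OF Min_in[OF fin(2) ne(2)]] by linarith+
  then have "e = Min ?F" if "e \<in> ?F" for e
    using F[OF that] by linarith
  then have f: "homogeneous (Min ?F) f"
    unfolding homogeneous_def by blast
  have "e = Min ?G" if "e \<in> ?G" for e
    using G[OF that] minmax by linarith
  then have g: "homogeneous (Min ?G) g"
    unfolding homogeneous_def by blast
  show thesis
    by (rule that[OF f g lo_d])
qed

lemma homogeneous_0_eq_Const:
  assumes "homogeneous 0 f"
  shows "f = Const (lookup f 0)"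
proof (rule poly_mapping_eqI)
  fix m
  have "m = 0" if "mdeg m = 0"
    using that by (intro poly_mapping_eqI) auto
  then show "lookup f m = lookup (Const (lookup f 0)) m"
    using assms unfolding homogeneous_iff_lookup Const_def by (metis lookup_single_eq lookup_single_not_eq)
qed

lemma homogeneous_0_dvd_1: "homogeneous 0 f \<Longrightarrow> f \<noteq> 0 \<Longrightarrow> f dvd 1"
proof -
  assume "homogeneous 0 f" "f \<noteq> 0"
  then obtain c where c: "f = Const c"
    using homogeneous_0_eq_Const by blast
  with \<open>f \<noteq> 0\<close> have "c \<noteq> 0"
    by auto
  then have "f * Const (inverse c) = 1"
    by (simp add: c flip: Const_mult)
  then show "f dvd 1"
    by (metis dvdI)
qed

lemma dvd_1_imp_homogeneous_0: "f dvd 1 \<Longrightarrow> homogeneous 0 f" for f :: poly3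
proof -
  assume "f dvd 1"
  then obtain g where g: "f * g = 1"
    by (metis dvdE)
  have "homogeneous 0 (1 :: poly3)"
    using homogeneous_Const[of 1] by simp
  then show ?thesis
    using homogeneous_factors[of 0 f g] g by auto
qed

lemma poly3_dvd_1_iff: "f dvd 1 \<longleftrightarrow> homogeneous 0 f \<and> f \<noteq> 0" for f :: poly3
  using homogeneous_0_dvd_1 dvd_1_imp_homogeneous_0 by auto

lemma homogeneous_dvd_cases:
  assumes "homogeneous d f" "homogeneous e g" "g \<noteq> 0" "f dvd g"
  obtains h where "g = f * h" "homogeneous (e - d) h" "d \<le> e"
proof -
  obtain h where h: "g = f * h"
    using assms(4) by blast
  obtain a b where ab: "homogeneous a f" "homogeneous b h" "a + b = e"
    using homogeneous_factors[of e f h] assms h by metis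
  have "a = d"
    using homogeneous_unique[OF ab(1) assms(1)] h assms(3) by auto
  then show thesis
    using that[OF h] ab by auto
qed

lemma homogeneous_dvd_same_degree:
  assumes "homogeneous d f" "homogeneous d g" "f dvd g"
  obtains c where "g = poly_scale c f"
proof (cases "g = 0")
  case True
  then show thesis
    using that[of 0] by simp
next
  case False
  then obtain h where h: "g = f * h" "homogeneous 0 h"
    using homogeneous_dvd_cases[OF assms(1,2) _ assms(3)] by auto
  then have "h = Const (lookup h 0)"
    using homogeneous_0_eq_Const by blast
  then show thesis
    using that h(1) by (metis poly_scale_eq mult.commute)
qed

lemma reducible_homogeneous_factors:
  assumes "homogeneous d f" "f \<noteq> 0" "0 < d" "\<not> irreducible f"
  obtains a b g h where "f = g * h" "homogeneous a g" "homogeneous b h" "a + b = d" "0 < a" "0 < b"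
proof -
  have "\<not> f dvd 1"
    using assms dvd_1_imp_homogeneous_0 homogeneous_unique by blast
  then obtain g h where gh: "f = g * h" "\<not> g dvd 1" "\<not> h dvd 1"
    using assms irreducibleI by metis
  moreover obtain a b where ab: "homogeneous a g" "homogeneous b h" "a + b = d"
    using homogeneous_factors[of d g h] assms gh by metis
  moreover have "g \<noteq> 0" "h \<noteq> 0"
    using gh assms by auto
  ultimately have "0 < a" "0 < b"
    using poly3_dvd_1_iff by (metis gr0I)+
  then show thesis
    using that gh ab by blast
qed

lemma irreducible_linear:
  assumes "homogeneous 1 f" "f \<noteq> 0"
  shows "irreducible f"
proof (rule ccontr)
  assume "\<not> irreducible f"
  then show False
    using reducible_homogeneous_factors[OF assms] by (metis add_gr_0 less_add_eq_less less_one nat_neq_iff zero_less_one add_cancel_right_right add_le_same_cancel1 linorder_not_less Suc_eq_plus1 One_nat_def Suc_leI add_mono)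
qed

subsection \<open>Dimensions of spaces of forms\<close>

lemma subspace_forms: "poly3.subspace (forms d)"
  by (simp add: poly3.subspace_def homogeneous_add homogeneous_scale)

lemma finite_monomials: "finite {m :: 3 \<Rightarrow>\<^sub>0 nat. mdeg m = d}"
  and card_monomials: "2 * card {m :: 3 \<Rightarrow>\<^sub>0 nat. mdeg m = d} = (d + 1) * (d + 2)"
proof -
  let ?M = "{m :: 3 \<Rightarrow>\<^sub>0 nat. mdeg m = d}" and ?S = "SIGMA a:{..d}. {..d - a}"
  let ?f = "\<lambda>(a, b). single 1 a + single 2 b + single 3 (d - a - b) :: 3 \<Rightarrow>\<^sub>0 nat"
  have bij: "bij_betw ?f ?S ?M"
  proof (rule bij_betw_byWitness[where f' = "\<lambda>m. (lookup m 1, lookup m 2)"])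
    show "\<forall>m\<in>?M. ?f (lookup m 1, lookup m 2) = m"
      by (auto simp: sum_3 poly_mapping_eq_iff fun_eq_iff forall_3 lookup_add lookup_single)
  qed (auto simp: sum_3 lookup_add lookup_single)
  then show "finite ?M"
    using bij_betw_finite[OF bij] by simp
  have "card ?M = (\<Sum>a\<le>d. d - a + 1)"
    using bij_betw_same_card[OF bij] by simp
  also have "\<dots> = (\<Sum>a\<le>d. a + 1)"
    by (rule sum.reindex_bij_witness[of _ "\<lambda>a. d - a" "\<lambda>a. d - a"]) auto
  finally have c: "card ?M = (\<Sum>a\<le>d. a + 1)" .
  have "2 * (\<Sum>a\<le>d. a + 1) = (d + 1) * (d + 2)"
    by (induction d) auto
  then show "2 * card ?M = (d + 1) * (d + 2)"
    using c by simp
qed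

lemma fin_dim_forms: "poly3.fin_dim (forms d)"
  and dim_forms: "2 * poly3.dim (forms d) = (d + 1) * (d + 2)"
proof -
  let ?M = "{m :: 3 \<Rightarrow>\<^sub>0 nat. mdeg m = d}" and ?x = "\<lambda>m. single m 1 :: poly3"
  have inj: "inj_on ?x ?M"
    by (rule inj_onI) (metis keys_single singleton_inject zero_neq_one)
  have scale: "poly_scale c (?x m) = single m c" for c m
    by (simp add: poly_scale_eq Const_def mult_single)
  have sub: "?x ` ?M \<subseteq> forms d"
    by (auto intro: homogeneous_single)
  have span: "forms d \<subseteq> poly3.span (?x ` ?M)"
  proof
    fix f assume f: "f \<in> forms d"
    have "f = (\<Sum>m\<in>keys f. poly_scale (lookup f m) (?x m))"
      unfolding scale by (rule poly_mapping_eq_sum_single)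
    moreover have "keys f \<subseteq> ?M"
      using f by (auto simp: homogeneous_def)
    then have "(\<Sum>m\<in>keys f. poly_scale (lookup f m) (?x m)) \<in> poly3.span (?x ` ?M)"
      by (intro poly3.span_sum poly3.span_scale poly3.span_base) auto
    ultimately show "f \<in> poly3.span (?x ` ?M)"
      by metis
  qed
  have ind: "poly3.independent (?x ` ?M)"
  proof (rule poly3.independent_if_scalars_zero)
    show "finite (?x ` ?M)"
      using finite_monomials by blast
    fix k x assume "(\<Sum>x\<in>?x ` ?M. poly_scale (k x) x) = 0" "x \<in> ?x ` ?M"
    then obtain m where m: "(\<Sum>m\<in>?M. single m (k (?x m))) = 0" "x = ?x m" "m \<in> ?M"
      by (auto simp: sum.reindex[OF inj] scale)
    have "0 = (\<Sum>n\<in>?M. lookup (single n (k (?x n))) m)"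
      using arg_cong[OF m(1), of "\<lambda>f. lookup f m"] by (simp add: lookup_sum)
    also have "\<dots> = (\<Sum>n\<in>?M. if n = m then k (?x n) else 0)"
      by (rule sum.cong) (auto simp: lookup_single_not_eq)
    also have "\<dots> = k (?x m)"
      using m(3) finite_monomials by simp
    finally show "k x = 0"
      using m(2) by simp
  qed
  show "poly3.fin_dim (forms d)"
    unfolding poly3.fin_dim_def using span finite_monomials by blast
  show "2 * poly3.dim (forms d) = (d + 1) * (d + 2)"
    using poly3.basis_card_eq_dim[OF sub span ind] card_image[OF inj] card_monomials[of d] by simp
qed

lemma linear_mult: "Vector_Spaces.linear poly_scale poly_scale (\<lambda>u. g * u)"
proof -
  have "vector_space poly_scale" ..
  then show ?thesis
    unfolding Vector_Spaces.linear_iff by (simp add: poly_scale_eq distrib_left mult.left_commute)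
qed

subsection \<open>Points of the plane\<close>

definition rep :: "proj_plane \<Rightarrow> complex ^ 3"
  where "rep q = (SOME v. v \<noteq> 0 \<and> Rep_proj_plane q = vec.span {v})"

definition pt :: "complex ^ 3 \<Rightarrow> proj_plane"
  where "pt v = Abs_proj_plane (vec.span {v})"

lemma rep: "rep q \<noteq> 0" "Rep_proj_plane q = vec.span {rep q}"
proof -
  have "\<exists>v. v \<noteq> 0 \<and> Rep_proj_plane q = vec.span {v}"
    using Rep_proj_plane[of q] by (auto simp: projectivization_def)
  then have "rep q \<noteq> 0 \<and> Rep_proj_plane q = vec.span {rep q}"
    unfolding rep_def by (rule someI_ex)
  then show "rep q \<noteq> 0" "Rep_proj_plane q = vec.span {rep q}"
    by blast+
qed

lemma Rep_pt: "v \<noteq> 0 \<Longrightarrow> Rep_proj_plane (pt v) = vec.span {v}"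
  unfolding pt_def by (rule Abs_proj_plane_inverse) (auto simp: projectivization_def)

lemma vec_span_singleton: "vec.span {v :: complex ^ 3} = range (\<lambda>c. c *s v)"
  by (rule vec.span_singleton)

lemma pt_rep [simp]: "pt (rep q) = q"
  using rep(2)[of q] by (simp add: pt_def Rep_proj_plane_inverse flip: rep(2))

lemma pt_eqD:
  assumes "pt v = pt w" "v \<noteq> 0" "w \<noteq> 0"
  obtains c where "v = c *s w"
proof -
  have "v \<in> vec.span {v}"
    by (simp add: vec.span_base)
  then have "v \<in> vec.span {w}"
    using Rep_pt assms by metis
  then show thesis
    using that by (auto simp: vec_span_singleton)
qed

lemma rep_eq_smult_imp_eq:
  assumes "rep q = c *s rep r"
  shows "q = r"
proof -
  have "c \<noteq> 0"
    using assms rep(1)[of q] by auto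
  have "range (\<lambda>a. a *s rep q) = range (\<lambda>a. a *s rep r)"
  proof (intro equalityI image_subsetI)
    fix a
    show "a *s rep q \<in> range (\<lambda>a. a *s rep r)"
      by (rule range_eqI[of _ _ "a * c"]) (simp add: assms vector_smult_assoc)
    show "a *s rep r \<in> range (\<lambda>a. a *s rep q)"
      by (rule range_eqI[of _ _ "a / c"]) (simp add: assms vector_smult_assoc \<open>c \<noteq> 0\<close>)
  qed
  then have "Rep_proj_plane q = Rep_proj_plane r"
    by (simp add: rep(2) vec_span_singleton)
  then show ?thesis
    by (simp add: Rep_proj_plane_inject)
qed

lemma vanishes_at_pt:
  assumes "homogeneous d f" "v \<noteq> 0"
  shows "vanishes_at f (pt v) \<longleftrightarrow> poly_eval f v = 0"
proof
  assume "vanishes_at f (pt v)"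
  then show "poly_eval f v = 0"
    by (simp add: vanishes_at_def Rep_pt assms(2) vec.span_base)
qed (auto simp: vanishes_at_def Rep_pt assms(2) vec_span_singleton poly_eval_homogeneous[OF assms(1)])

lemma vanishes_at_rep: "homogeneous d f \<Longrightarrow> vanishes_at f q \<longleftrightarrow> poly_eval f (rep q) = 0"
  using vanishes_at_pt[OF _ rep(1), of d f q] by simp

lemma vanishes_at_imp_eval: "vanishes_at f q \<Longrightarrow> poly_eval f (rep q) = 0"
  by (simp add: vanishes_at_def rep(2) vec.span_base)

lemma vanishes_at_0 [simp]: "vanishes_at 0 q"
  by (simp add: vanishes_at_def)

lemma vanishes_at_add: "vanishes_at f q \<Longrightarrow> vanishes_at g q \<Longrightarrow> vanishes_at (f + g) q"
  by (simp add: vanishes_at_def)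

lemma vanishes_at_mult_left: "vanishes_at g q \<Longrightarrow> vanishes_at (f * g) q"
  by (simp add: vanishes_at_def)

lemma vanishes_at_mult_iff:
  assumes "homogeneous d f" "homogeneous e g"
  shows "vanishes_at (f * g) q \<longleftrightarrow> vanishes_at f q \<or> vanishes_at g q"
  using assms by (simp add: vanishes_at_rep[OF homogeneous_mult[OF assms]] vanishes_at_rep)

lemma vanishes_at_prod_iff:
  assumes "finite A" "\<And>a. a \<in> A \<Longrightarrow> homogeneous (d a) (f a)"
  shows "vanishes_at (prod f A) q \<longleftrightarrow> (\<exists>a\<in>A. vanishes_at (f a) q)"
    and "homogeneous (sum d A) (prod f A)"
proof -
  have "(vanishes_at (prod f A) q \<longleftrightarrow> (\<exists>a\<in>A. vanishes_at (f a) q)) \<and> homogeneous (sum d A) (prod f A)"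
    using assms
  proof (induction A)
    case empty
    show ?case
      using homogeneous_Const[of 1] by (simp add: vanishes_at_rep[of 0])
  next
    case (insert a A)
    then show ?case
      using homogeneous_mult[of "d a" "f a" "sum d A" "prod f A"]
      by (simp add: vanishes_at_mult_iff[of "d a" "f a" "sum d A" "prod f A"])
  qed
  then show "vanishes_at (prod f A) q \<longleftrightarrow> (\<exists>a\<in>A. vanishes_at (f a) q)" "homogeneous (sum d A) (prod f A)"
    by blast+
qed

lemma separating_linear_vec:
  assumes "w \<noteq> 0" "\<And>c. v \<noteq> c *s w"
  obtains l where "homogeneous 1 l" "poly_eval l w = 0" "poly_eval l v \<noteq> 0"
proof -
  obtain k where k: "w $ k \<noteq> 0"
    using assms(1) by (auto simp: vec_eq_iff)
  obtain i where i: "v $ i \<noteq> (v $ k / w $ k) * w $ i"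
    using assms(2)[of "v $ k / w $ k"] by (auto simp: vec_eq_iff)
  let ?l = "Const (w $ k) * Var i - Const (w $ i) * Var k"
  have "homogeneous 1 ?l"
    by (intro homogeneous_diff homogeneous_Const_mult homogeneous_Var)
  moreover have "poly_eval ?l w = 0" "poly_eval ?l v \<noteq> 0"
    using k i by (auto simp: field_simps)
  ultimately show thesis
    by (rule that)
qed

lemma separating_linear:
  assumes "q \<noteq> r"
  obtains l where "homogeneous 1 l" "vanishes_at l r" "\<not> vanishes_at l q"
proof -
  have "rep q \<noteq> c *s rep r" for c
    using assms rep_eq_smult_imp_eq by blast
  then obtain l where "homogeneous 1 l" "poly_eval l (rep r) = 0" "poly_eval l (rep q) \<noteq> 0"
    using separating_linear_vec[OF rep(1)] by metis
  then show thesis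
    using that by (simp add: vanishes_at_rep)
qed

lemma nonvanishing_linear:
  obtains l where "homogeneous 1 l" "\<not> vanishes_at l q"
proof -
  obtain i where "rep q $ i \<noteq> 0"
    using rep(1)[of q] by (auto simp: vec_eq_iff)
  then show thesis
    using that[of "Var i"] vanishes_at_rep[OF homogeneous_Var(1), of i q] by simp
qed

lemma separating_form:
  assumes "finite T" "q \<notin> T" "card T \<le> d"
  obtains f where "homogeneous d f" "\<not> vanishes_at f q" "\<And>r. r \<in> T \<Longrightarrow> vanishes_at f r"
proof -
  have "\<exists>l. homogeneous 1 l \<and> vanishes_at l r \<and> \<not> vanishes_at l q" if "r \<in> T" for r
    using separating_linear[of q r] assms(2) that by metis
  then obtain l where l: "\<And>r. r \<in> T \<Longrightarrow> homogeneous 1 (l r) \<and> vanishes_at (l r) r \<and> \<not> vanishes_at (l r) q"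
    by metis
  obtain k where k: "homogeneous 1 k" "\<not> vanishes_at k q"
    using nonvanishing_linear .
  let ?f = "k ^ (d - card T) * prod l T"
  have P: "homogeneous (sum (\<lambda>_. 1) T) (prod l T)"
    and V: "vanishes_at (prod l T) s \<longleftrightarrow> (\<exists>r\<in>T. vanishes_at (l r) s)" for s
    using vanishes_at_prod_iff[OF assms(1), of "\<lambda>_. 1" l] l by blast+
  have K: "homogeneous (d - card T) (k ^ (d - card T))"
    using homogeneous_power[OF k(1), of "d - card T"] by simp
  have "homogeneous d ?f"
    using homogeneous_mult[OF K P] assms(3) by simp
  moreover have "\<not> vanishes_at (k ^ (d - card T)) q"
    using k by (simp add: vanishes_at_rep[OF K] vanishes_at_rep)
  then have "\<not> vanishes_at ?f q"
    using l by (auto simp: vanishes_at_mult_iff[OF K P] V)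
  moreover have "vanishes_at ?f r" if "r \<in> T" for r
    using l that V by (auto intro: vanishes_at_mult_left)
  ultimately show thesis
    by (rule that)
qed

lemma subspace_forms_vanishing: "poly3.subspace {f \<in> forms d. \<forall>q\<in>T. vanishes_at f q}"
  using subspace_forms[of d] by (auto simp: poly3.subspace_def vanishes_at_def)

lemma fin_dim_subset_forms: "S \<subseteq> forms d \<Longrightarrow> poly3.fin_dim S"
  using poly3.fin_dim_mono[OF fin_dim_forms] .

lemma forms_vanishing_insert:
  "{f \<in> forms d. \<forall>q\<in>insert r T. vanishes_at f q} = {f \<in> {f \<in> forms d. \<forall>q\<in>T. vanishes_at f q}. poly_eval f (rep r) = 0}"
  by (auto simp: vanishes_at_rep)

lemma dim_forms_vanishing_ge:
  assumes "finite T"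
  shows "poly3.dim (forms d) \<le> poly3.dim {f \<in> forms d. \<forall>q\<in>T. vanishes_at f q} + card T"
  using assms
proof (induction T)
  case (insert r T)
  have "poly3.dim {f \<in> forms d. \<forall>q\<in>T. vanishes_at f q} \<le> poly3.dim {f \<in> forms d. \<forall>q\<in>insert r T. vanishes_at f q} + 1"
    unfolding forms_vanishing_insert
    by (rule poly3.dim_kernel_functional_le[OF subspace_forms_vanishing fin_dim_subset_forms]) auto
  then show ?case
    using insert by simp
qed simp

lemma dim_forms_vanishing:
  assumes "finite T" "card T \<le> Suc d"
  shows "poly3.dim (forms d) = poly3.dim {f \<in> forms d. \<forall>q\<in>T. vanishes_at f q} + card T"
  using assms
proof (induction T)
  case (insert r T)
  then obtain f where f: "homogeneous d f" "\<not> vanishes_at f r" "\<And>q. q \<in> T \<Longrightarrow> vanishes_at f q"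
    using separating_form[of T r d] by auto
  have "poly3.dim {f \<in> forms d. \<forall>q\<in>T. vanishes_at f q} = poly3.dim {f \<in> forms d. \<forall>q\<in>insert r T. vanishes_at f q} + 1"
    unfolding forms_vanishing_insert
    by (rule poly3.dim_kernel_functional[OF subspace_forms_vanishing fin_dim_subset_forms, where x = f])
      (use f in \<open>auto simp: vanishes_at_rep\<close>)
  then show ?case
    using insert by simp
qed simp

subsection \<open>The Bezout bound\<close>

text \<open>The Koszul complex of two coprime forms is exact, which gives the dimension of the graded
  pieces of the ideal that they generate.\<close>

lemma dim_ideal_two_forms:
  assumes f: "irreducible f" "homogeneous m f" and g: "homogeneous n g" "\<not> f dvd g" and d: "m + n \<le> d"
  defines "I \<equiv> {u * f + v * g |u v. homogeneous (d - m) u \<and> homogeneous (d - n) v}"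
  shows "poly3.dim I + m * n = poly3.dim (forms d)" and "poly3.subspace I" and "I \<subseteq> forms d"
proof -
  have nz: "f \<noteq> 0" "g \<noteq> 0"
    using f g by auto
  have prime: "prime_elem f"
    by (rule irreducible_poly3_imp_prime_elem) fact
  let ?F = "(\<lambda>u. f * u) ` forms (d - m)" and ?G = "(\<lambda>u. g * u) ` forms (d - n)"
    and ?H = "(\<lambda>u. (f * g) * u) ` forms (d - m - n)"
  have inj: "inj_on (\<lambda>u. h * u) S" if "h \<noteq> 0" for h :: poly3 and S
    using that by (simp add: inj_on_def)
  note img = poly3.dim_inj_image[OF subspace_forms fin_dim_forms linear_mult inj]
  have I: "I = {x + y |x y. x \<in> ?F \<and> y \<in> ?G}"
    unfolding I_def by (auto simp: mult.commute)
  have "?F \<inter> ?G = ?H"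
  proof (intro equalityI subsetI)
    fix x assume "x \<in> ?F \<inter> ?G"
    then obtain u v where uv: "x = f * u" "x = g * v" "homogeneous (d - m) u" "homogeneous (d - n) v"
      by blast
    then have "f dvd v"
      using prime g(2) by (metis dvd_triv_left prime_elem_dvd_mult_iff)
    show "x \<in> ?H"
    proof (cases "v = 0")
      case True
      then show ?thesis
        using uv by (auto intro: image_eqI[of _ _ 0])
    next
      case False
      then obtain w where "v = f * w" "homogeneous (d - n - m) w"
        using homogeneous_dvd_cases[OF f(2) uv(4) _ \<open>f dvd v\<close>] by metis
      then show ?thesis
        using uv by (intro image_eqI[of _ _ w]) (auto simp: algebra_simps)
    qed
  next
    fix x assume "x \<in> ?H"
    then obtain w where w: "x = f * g * w" "homogeneous (d - m - n) w"
      by blast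
    have "homogeneous (n + (d - m - n)) (g * w)" "homogeneous (m + (d - m - n)) (f * w)"
      using homogeneous_mult f g w by blast+
    moreover have "n + (d - m - n) = d - m" "m + (d - m - n) = d - n"
      using d by auto
    ultimately show "x \<in> ?F \<inter> ?G"
      using w by (auto intro: image_eqI[of _ _ "g * w"] image_eqI[of _ _ "f * w"] simp: mult.assoc mult.left_commute)
  qed
  then have "poly3.dim I + poly3.dim (forms (d - m - n)) = poly3.dim (forms (d - m)) + poly3.dim (forms (d - n))"
    using poly3.dim_sums_Int_fin_dim[OF img(2,3) img(2,3), OF nz(1) nz(1) nz(2) nz(2), of "d - m" "d - n"] nz
    by (simp add: I img(1))
  moreover obtain k where k: "d = m + n + k"
    using d le_Suc_ex by blast
  ultimately have "2 * poly3.dim I + 2 * poly3.dim (forms k) = 2 * poly3.dim (forms (n + k)) + 2 * poly3.dim (forms (m + k))"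
    by simp
  then have "2 * (poly3.dim I + m * n) = 2 * poly3.dim (forms d)"
    unfolding dim_forms k by (simp add: algebra_simps)
  then show "poly3.dim I + m * n = poly3.dim (forms d)"
    by simp
  show "poly3.subspace I"
    unfolding I using poly3.subspace_sums[OF img(2) img(2)] nz by blast
  show "I \<subseteq> forms d"
    using homogeneous_mult[OF _ f(2), of "d - m"] homogeneous_mult[OF _ g(1), of "d - n"] d
    by (auto simp: I_def intro!: homogeneous_add)
qed

theorem bezout_bound:
  assumes f: "irreducible f" "homogeneous m f" and g: "homogeneous n g" "\<not> f dvd g"
    and T: "finite T" "\<And>q. q \<in> T \<Longrightarrow> vanishes_at f q \<and> vanishes_at g q"
  shows "card T \<le> m * n"
proof -
  define d where "d = m + n + card T"
  let ?I = "{u * f + v * g |u v. homogeneous (d - m) u \<and> homogeneous (d - n) v}"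
  let ?K = "{f \<in> forms d. \<forall>q\<in>T. vanishes_at f q}"
  have I: "poly3.dim ?I + m * n = poly3.dim (forms d)" "?I \<subseteq> forms d"
    using dim_ideal_two_forms[OF f g, of d] by (auto simp: d_def)
  have "?I \<subseteq> ?K"
    using I(2) T(2) by (auto intro!: vanishes_at_add vanishes_at_mult_left)
  then have "poly3.dim ?I \<le> poly3.dim ?K"
    by (rule poly3.dim_mono_fin_dim[OF fin_dim_subset_forms, rotated]) auto
  moreover have "poly3.dim (forms d) = poly3.dim ?K + card T"
    by (rule dim_forms_vanishing[OF T(1)]) (simp add: d_def)
  ultimately show ?thesis
    using I(1) by linarith
qed

subsection \<open>Restriction to lines\<close>

interpretation line: const_hom "\<lambda>a. [:a:]"
  by unfold_locales simp_all

definition line_poly :: "complex ^ 3 \<Rightarrow> complex ^ 3 \<Rightarrow> poly3 \<Rightarrow> complex poly"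
  where "line_poly u w = ring_eval (\<lambda>a. [:a:]) (\<lambda>i. [:u $ i, w $ i:])"

lemma line_poly_simps [simp]:
  "line_poly u w 0 = 0" "line_poly u w (Const c) = [:c:]" "line_poly u w (Var i) = [:u $ i, w $ i:]"
  "line_poly u w (f + g) = line_poly u w f + line_poly u w g"
  "line_poly u w (f - g) = line_poly u w f - line_poly u w g"
  "line_poly u w (f * g) = line_poly u w f * line_poly u w g"
  "line_poly u w (f ^ n) = line_poly u w f ^ n"
  "line_poly u w (sum h A) = (\<Sum>a\<in>A. line_poly u w (h a))"
  unfolding line_poly_def
  by (rule line.ring_eval_zero line.ring_eval_Const line.ring_eval_Var line.ring_eval_simps)+

lemma poly_line_poly: "poly (line_poly u w f) t = poly_eval f (u + t *s w)"
  by (induction f rule: poly3_induct) simp_all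

lemma coeff_mult_upper:
  assumes "degree p \<le> m" "degree q \<le> n"
  shows "coeff (p * q) (m + n) = coeff p m * coeff q n"
proof (cases "degree p = m \<and> degree q = n")
  case True
  then show ?thesis
    using coeff_mult_degree_sum[of p q] by simp
next
  case False
  then have "degree p < m \<or> degree q < n"
    using assms by linarith
  moreover from this have "degree (p * q) < m + n"
    using degree_mult_le[of p q] assms by linarith
  ultimately show ?thesis
    by (auto simp: coeff_eq_0)
qed

lemma degree_coeff_power_upper:
  assumes "degree p \<le> 1"
  shows "degree (p ^ n) \<le> n \<and> coeff (p ^ n) n = coeff p 1 ^ n"
proof (induction n)
  case (Suc n)
  then show ?case
    using degree_mult_le[of p "p ^ n"] coeff_mult_upper[OF assms, of "p ^ n" n] assms by simp
qed simp

lemma line_poly_homogeneous: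
  assumes "homogeneous d f"
  shows "degree (line_poly u w f) \<le> d" and "coeff (line_poly u w f) d = poly_eval f w"
proof -
  define x where "x i = [:u $ i, w $ i:]" for i
  define M where "M m = (\<Prod>i\<in>UNIV. x i ^ lookup m i)" for m
  have M: "degree (M m) \<le> mdeg m \<and> coeff (M m) (mdeg m) = (\<Prod>i\<in>UNIV. w $ i ^ lookup m i)" for m
  proof -
    have x: "degree (x i ^ n) \<le> n" "coeff (x i ^ n) n = w $ i ^ n" for i n
      using degree_coeff_power_upper[of "x i" n] by (auto simp: x_def)
    let ?a = "lookup m 1" and ?b = "lookup m 2" and ?c = "lookup m 3"
    have 12: "degree (x 1 ^ ?a * x 2 ^ ?b) \<le> ?a + ?b"
      using degree_mult_le[of "x 1 ^ ?a" "x 2 ^ ?b"] x(1)[of 1 ?a] x(1)[of 2 ?b] by linarith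
    have "degree (x 1 ^ ?a * x 2 ^ ?b * x 3 ^ ?c) \<le> ?a + ?b + ?c"
      using degree_mult_le[of "x 1 ^ ?a * x 2 ^ ?b" "x 3 ^ ?c"] 12 x(1)[of 3 ?c] by linarith
    then show ?thesis
      by (simp add: M_def prod_UNIV_3 sum_3 coeff_mult_upper[OF 12 x(1)] coeff_mult_upper[OF x(1) x(1)] x(2))
  qed
  have L: "line_poly u w f = (\<Sum>m\<in>keys f. smult (lookup f m) (M m))"
    by (simp add: line_poly_def ring_eval_def M_def x_def)
  have d: "mdeg m = d" if "m \<in> keys f" for m
    using assms that unfolding homogeneous_def by blast
  show "degree (line_poly u w f) \<le> d"
    unfolding L
  proof (rule degree_sum_le)
    fix m assume "m \<in> keys f"
    then show "degree (smult (lookup f m) (M m)) \<le> d"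
      using M[of m] d[of m] degree_smult_le[of "lookup f m" "M m"] by linarith
  qed simp
  show "coeff (line_poly u w f) d = poly_eval f w"
    unfolding L poly_eval_def coeff_sum
  proof (rule sum.cong[OF refl])
    fix m assume "m \<in> keys f"
    then show "coeff (smult (lookup f m) (M m)) d
       = lookup f m * (\<Prod>i\<in>UNIV. w $ i ^ lookup m i)"
      using M[of m] d[of m] by simp
  qed
qed

lemma partial_deriv_single:
  "partial_deriv i (single m c) =
    single (m - single i 1) (of_nat (lookup m i) * c)"
  by (cases "c = 0") (simp_all add: partial_deriv_def)

lemma partial_deriv_0 [simp]: "partial_deriv i 0 = 0"
  by (simp add: partial_deriv_def)

lemma partial_deriv_add: "partial_deriv i (f + g) = partial_deriv i f + partial_deriv i g"
  unfolding partial_deriv_def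
  by (rule setsum_keys_plus_distrib) (simp_all add: single_add distrib_left)

lemma pderiv_line_poly:
  "pderiv (line_poly u w f) = (\<Sum>i\<in>UNIV. smult (w $ i) (line_poly u w (partial_deriv i f)))"
proof (induction f rule: poly_mapping_add_induct)
  case zero
  show ?case by simp
next
  case (add f g)
  then show ?case
    by (simp add: pderiv_add partial_deriv_add smult_add_right sum.distrib)
next
  case (single m c)
  have e: "line_poly u w (single n a) = smult a ([:u $ 1, w $ 1:] ^ lookup n 1 *
      [:u $ 2, w $ 2:] ^ lookup n 2 * [:u $ 3, w $ 3:] ^ lookup n 3)" for n a
    by (simp add: line_poly_def line.ring_eval_single prod_UNIV_3)
  have pow: "pderiv ([:a, b:] ^ n) = smult (of_nat n * b) ([:a, b:] ^ (n - 1))" for a b :: complex and n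
    by (simp add: pderiv_power pderiv_pCons mult.commute)
  show ?case
    unfolding partial_deriv_single e pderiv_smult pderiv_mult pow sum_3
    by (simp add: lookup_minus lookup_single smult_add_right distrib_left distrib_right mult_ac)
qed

subsection \<open>Bases of the ambient space\<close>

definition is_basis :: "complex ^ 3 \<Rightarrow> complex ^ 3 \<Rightarrow> complex ^ 3 \<Rightarrow> bool"
  where "is_basis a b c \<longleftrightarrow> (\<forall>\<alpha> \<beta> \<gamma>. \<alpha> *s a + \<beta> *s b + \<gamma> *s c = 0 \<longrightarrow> \<alpha> = 0 \<and> \<beta> = 0 \<and> \<gamma> = 0)"

lemma is_basisD: "is_basis a b c \<Longrightarrow> \<alpha> *s a + \<beta> *s b + \<gamma> *s c = 0 \<Longrightarrow> \<alpha> = 0 \<and> \<beta> = 0 \<and> \<gamma> = 0"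
  unfolding is_basis_def by blast

lemma basis_extendE:
  assumes "c \<noteq> 0"
  obtains a b where "is_basis a b c"
proof -
  obtain k where k: "c $ k \<noteq> 0"
    using assms by (auto simp: vec_eq_iff)
  consider "k = 1" | "k = 2" | "k = 3"
    using exhaust_3 by blast
  then show thesis
  proof cases
    case 1
    with k show thesis
      by (intro that[of "axis 2 1" "axis 3 1"]) (auto simp: is_basis_def vec_eq_iff forall_3 axis_def)
  next
    case 2
    with k show thesis
      by (intro that[of "axis 1 1" "axis 3 1"]) (auto simp: is_basis_def vec_eq_iff forall_3 axis_def)
  next
    case 3
    with k show thesis
      by (intro that[of "axis 1 1" "axis 2 1"]) (auto simp: is_basis_def vec_eq_iff forall_3 axis_def)
  qed
qed

lemma is_basis_spanE:
  assumes "is_basis a b c"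
  obtains \<alpha> \<beta> \<gamma> where "v = \<alpha> *s a + \<beta> *s b + \<gamma> *s c"
proof -
  have ne: "a \<noteq> b" "a \<noteq> c" "b \<noteq> c"
    using is_basisD[OF assms, of 1 "-1" 0] is_basisD[OF assms, of 1 0 "-1"] is_basisD[OF assms, of 0 1 "-1"] by auto
  have ind: "vec.independent {a, b, c}"
  proof (rule vec.independent_if_scalars_zero)
    fix k x assume "(\<Sum>x\<in>{a, b, c}. k x *s x) = 0" "x \<in> {a, b, c}"
    then show "k x = 0"
      using is_basisD[OF assms, of "k a" "k b" "k c"] ne by (auto simp: add.assoc)
  qed simp
  have "UNIV \<subseteq> vec.span {a, b, c}"
    by (rule vec.card_ge_dim_independent) (use ind ne in \<open>auto simp: vec.dim_UNIV card_cart_basis\<close>)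
  then have "v \<in> vec.span {a, b, c}"
    by blast
  then obtain \<alpha> \<beta> \<gamma> where "v - \<alpha> *s a - \<beta> *s b = \<gamma> *s c"
    by (auto simp: vec.span_insert)
  then show thesis
    using that[of \<alpha> \<beta> \<gamma>] by (simp add: algebra_simps)
qed

lemma is_basis_pencil_nonzero: "is_basis a b c \<Longrightarrow> a + s *s b + z *s c \<noteq> 0"
  using is_basisD[of a b c 1 s z] by auto

lemma is_basis_pencil_inj:
  assumes "is_basis a b c" "a + s *s b + z *s c = k *s (a + s' *s b + z' *s c)"
  shows "k = 1" "s = s'" "z = z'"
proof -
  have "(1 - k) *s a + (s - k * s') *s b + (z - k * z') *s c
      = (a + s *s b + z *s c) - k *s (a + s' *s b + z' *s c)"
    by (simp add: vec_eq_iff algebra_simps)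
  also have "\<dots> = 0"
    using assms(2) by (simp only: diff_self)
  finally have "1 - k = 0 \<and> s - k * s' = 0 \<and> z - k * z' = 0"
    by (rule is_basisD[OF assms(1)])
  then show "k = 1" "s = s'" "z = z'"
    by auto
qed

lemma ex_root_of_leading:
  assumes "homogeneous d f" "0 < d" "poly_eval f c \<noteq> 0"
  obtains z where "poly_eval f (u + z *s c) = 0"
proof -
  have "coeff (line_poly u c f) d \<noteq> 0"
    using line_poly_homogeneous[OF assms(1)] assms(3) by simp
  then have "degree (line_poly u c f) \<noteq> 0"
    using le_degree[of "line_poly u c f" d] assms(2) by linarith
  then have "\<exists>z. poly (line_poly u c f) z = 0"
    by (intro fundamental_theorem_of_algebra) (simp add: constant_degree)
  then obtain z where "poly (line_poly u c f) z = 0"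
    by blast
  then show thesis
    using that by (simp add: poly_line_poly)
qed

lemma infinite_zeros:
  assumes "homogeneous d f" "0 < d"
  shows "infinite {q. vanishes_at f q}"
proof -
  obtain c where c: "c \<noteq> 0" "f = 0 \<or> poly_eval f c \<noteq> 0"
  proof (cases "f = 0")
    case True
    then show thesis
      using that[of "axis 1 1"] by (simp add: axis_eq_0_iff)
  next
    case False
    then obtain c where c: "poly_eval f c \<noteq> 0"
      using poly_eval_eq_0_imp_eq_0 by blast
    then have "c \<noteq> 0"
      using poly_eval_homogeneous[OF assms(1), of 0 c] assms(2) by (auto simp: zero_power)
    then show thesis
      using that c by blast
  qed
  obtain a b where ab: "is_basis a b c"
    using basis_extendE[OF c(1)] .
  have "\<exists>z. poly_eval f (a + s *s b + z *s c) = 0" for s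
  proof (cases "f = 0")
    case False
    with c(2) have "poly_eval f c \<noteq> 0"
      by blast
    then show ?thesis
      by (rule ex_root_of_leading[OF assms, of c "a + s *s b"]) (rule exI)
  qed simp
  then obtain z where z: "\<And>s. poly_eval f (a + s *s b + z s *s c) = 0"
    by metis
  have "inj (\<lambda>s. pt (a + s *s b + z s *s c))"
  proof (rule injI)
    fix s t assume "pt (a + s *s b + z s *s c) = pt (a + t *s b + z t *s c)"
    then obtain k where "a + s *s b + z s *s c = k *s (a + t *s b + z t *s c)"
      using pt_eqD is_basis_pencil_nonzero[OF ab] by metis
    then show "s = t"
      by (rule is_basis_pencil_inj(2)[OF ab])
  qed
  moreover have "range (\<lambda>s. pt (a + s *s b + z s *s c)) \<subseteq> {q. vanishes_at f q}"
    using vanishes_at_pt[OF assms(1) is_basis_pencil_nonzero[OF ab]] z by auto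
  ultimately show ?thesis
    using infinite_UNIV_char_0[where 'a = complex] by (meson finite_imageD finite_subset)
qed

lemma bezout_dvd:
  assumes "irreducible f" "homogeneous m f" "homogeneous n g"
    and "\<And>q. q \<in> T \<Longrightarrow> vanishes_at f q \<and> vanishes_at g q" "infinite T \<or> m * n < card T"
  shows "f dvd g"
proof (rule ccontr)
  assume nd: "\<not> f dvd g"
  obtain T' where T': "T' \<subseteq> T" "finite T'" "m * n < card T'"
  proof (cases "finite T")
    case True
    then show thesis
      using that[of T] assms(5) by blast
  next
    case False
    then obtain T' where "finite T'" "card T' = Suc (m * n)" "T' \<subseteq> T"
      using infinite_arbitrarily_large by blast
    then show thesis
      using that[of T'] by simp
  qed
  have "card T' \<le> m * n"
    by (rule bezout_bound[OF assms(1-3) nd T'(2)]) (use T'(1) assms(4) in blast)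
  then show False
    using T'(3) by simp
qed

lemma poly_eval_linear:
  assumes "homogeneous 1 l"
  shows "poly_eval l (u + z *s w) = poly_eval l u + z * poly_eval l w"
proof -
  have "degree (line_poly u w l) \<le> 1" "coeff (line_poly u w l) 1 = poly_eval l w"
    using line_poly_homogeneous[OF assms] by blast+
  moreover have "coeff (line_poly u w l) 0 = poly_eval l u"
    using poly_line_poly[of u w l 0] by (simp add: poly_0_coeff_0)
  ultimately have "line_poly u w l = [:poly_eval l u, poly_eval l w:]"
    by (intro poly_eqI) (auto simp: coeff_pCons coeff_eq_0 split: nat.split)
  then show ?thesis
    using poly_line_poly[of u w l z] by simp
qed

lemma poly_eval_partial_deriv:
  "poly_eval (partial_deriv i f) v = poly (pderiv (line_poly v (axis i 1) f)) 0"
proof -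
  have "poly (pderiv (line_poly v (axis i 1) f)) 0 = (\<Sum>j\<in>UNIV. if j = i then poly_eval (partial_deriv j f) v else 0)"
    unfolding pderiv_line_poly poly_sum
    by (rule sum.cong) (auto simp: poly_line_poly axis_def)
  then show ?thesis
    by simp
qed

lemma singular_at_mult:
  assumes "vanishes_at f q" "vanishes_at g q"
  shows "singular_at (f * g) q"
proof -
  have "poly_eval (partial_deriv i (f * g)) v = 0" if "v \<in> Rep_proj_plane q" for i v
    using that assms poly_line_poly[of v "axis i 1" f 0] poly_line_poly[of v "axis i 1" g 0]
    by (simp add: poly_eval_partial_deriv pderiv_mult vanishes_at_def)
  then show ?thesis
    using vanishes_at_mult_left[OF assms(2)] by (simp add: singular_at_def vanishes_at_def)
qed

lemma line_meets_curve:
  assumes "homogeneous 1 l" "homogeneous d g" "0 < d"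
  obtains q where "vanishes_at l q" "vanishes_at g q"
proof -
  obtain T where "finite T" "card T = 2" "T \<subseteq> {q. vanishes_at l q}"
    using infinite_arbitrarily_large[OF infinite_zeros[OF assms(1)]] by auto
  then obtain r s where rs: "r \<noteq> s" "vanishes_at l r" "vanishes_at l s"
    by (auto simp: card_2_iff)
  show thesis
  proof (cases "poly_eval g (rep s) = 0")
    case True
    then show thesis
      using that[of s] rs vanishes_at_rep[OF assms(2)] by simp
  next
    case False
    then obtain z where z: "poly_eval g (rep r + z *s rep s) = 0"
      using ex_root_of_leading[OF assms(2,3)] by metis
    have nz: "rep r + z *s rep s \<noteq> 0"
    proof
      assume "rep r + z *s rep s = 0"
      then have "rep r = (- z) *s rep s"
        by (simp add: add_eq_0_iff2)
      then show False
        using rep_eq_smult_imp_eq rs(1) by blast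
    qed
    have "poly_eval l (rep r + z *s rep s) = 0"
      using rs by (simp add: poly_eval_linear[OF assms(1)] vanishes_at_imp_eval)
    then show thesis
      using that[of "pt (rep r + z *s rep s)"] z
      by (simp add: vanishes_at_pt[OF assms(1) nz] vanishes_at_pt[OF assms(2) nz])
  qed
qed

lemma poly_eval_dehomogenize:
  assumes "v $ i = 1"
  shows "poly_eval (dehomogenize i f) v = poly_eval f v"
proof -
  have "(\<Prod>j\<in>UNIV. v $ j ^ lookup (Poly_Mapping.update i 0 m) j) = (\<Prod>j\<in>UNIV. v $ j ^ lookup m j)" for m
    by (rule prod.cong) (auto simp: lookup_update assms)
  moreover have "poly_eval (single m a) v = a * (\<Prod>j\<in>UNIV. v $ j ^ lookup m j)" for m a
    by (simp add: poly_eval_eq_ring_eval poly_eval_hom.ring_eval_single)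
  ultimately have "poly_eval (dehomogenize i f) v =
      (\<Sum>m\<in>keys f. lookup f m * (\<Prod>j\<in>UNIV. v $ j ^ lookup m j))"
    by (simp add: dehomogenize_def)
  then show ?thesis
    by (simp add: poly_eval_def)
qed

interpretation mult: module "(*) :: poly3 \<Rightarrow> poly3 \<Rightarrow> poly3"
  by unfold_locales (simp_all add: algebra_simps)

lemma irreducible_homogeneous_not_dvd:
  assumes "irreducible f" "homogeneous d f" "homogeneous e g" "0 < e" "e < d"
  shows "\<not> g dvd f"
proof
  assume "g dvd f"
  have nz: "f \<noteq> 0"
    using assms(1) by auto
  obtain h where h: "f = g * h" "homogeneous (d - e) h"
    using homogeneous_dvd_cases[OF assms(3,2) nz \<open>g dvd f\<close>] by metis
  then have "g dvd 1 \<or> h dvd 1"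
    using assms(1) irreducibleD by blast
  then have "homogeneous 0 g \<or> homogeneous 0 h"
    using dvd_1_imp_homogeneous_0 by blast
  moreover have "g \<noteq> 0" "h \<noteq> 0"
    using h nz by auto
  ultimately show False
    using homogeneous_unique[of 0 g e] homogeneous_unique[of 0 h "d - e"] h assms by auto
qed

lemma pencil_inj:
  assumes "f \<noteq> 0" "g \<notin> poly3.span {f}" "g + poly_scale t f = poly_scale c (g + poly_scale t' f)"
  shows "t = t'"
proof -
  have e: "poly_scale (1 - c) g = poly_scale (c * t' - t) f"
    using assms(3) by (simp add: poly3.scale_left_diff_distrib poly3.scale_right_distrib algebra_simps)
  have "c = 1"
  proof (rule ccontr)
    assume "c \<noteq> 1"
    then have "g = poly_scale (inverse (1 - c)) (poly_scale (1 - c) g)"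
      by simp
    also have "\<dots> = poly_scale (inverse (1 - c) * (c * t' - t)) f"
      by (simp only: e poly3.scale_scale)
    finally have "g \<in> poly3.span {f}"
      by (simp add: poly3.span_base poly3.span_scale)
    then show False
      using assms(2) by blast
  qed
  then show ?thesis
    using e assms(1) by simp
qed

lemma pencil_nonzero:
  assumes "g \<notin> poly3.span {f}"
  shows "g + poly_scale t f \<noteq> 0"
proof
  assume "g + poly_scale t f = 0"
  then have "g = poly_scale (- t) f"
    by (simp add: add_eq_0_iff2)
  then show False
    using assms poly3.span_base poly3.span_scale by blast
qed

lemma poly3_span_singleton: "poly3.span {f} = range (\<lambda>c. poly_scale c f)"
  by (rule poly3.span_singleton)

lemma ex_nonzero_of_dim_pos:
  assumes "0 < poly3.dim S"
  obtains f where "f \<in> S" "f \<noteq> 0"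
proof -
  have "\<not> S \<subseteq> poly3.span {}"
    using poly3.dim_le_card[of S "{}"] assms by auto
  then show thesis
    using that by auto
qed

lemma forms_vanishing_insert_dim:
  "poly3.dim {f \<in> forms d. \<forall>q\<in>T. vanishes_at f q} \<le> poly3.dim {f \<in> forms d. \<forall>q\<in>insert r T. vanishes_at f q} + 1"
  unfolding forms_vanishing_insert
  by (rule poly3.dim_kernel_functional_le[OF subspace_forms_vanishing fin_dim_subset_forms]) auto

lemma line_through:
  obtains l where "homogeneous 1 l" "l \<noteq> 0" "vanishes_at l q" "vanishes_at l r"
proof -
  have "poly3.dim (forms 1) \<le> poly3.dim {f \<in> forms 1. \<forall>s\<in>{q, r}. vanishes_at f s} + card {q, r}"
    by (rule dim_forms_vanishing_ge) simp
  moreover have "card {q, r} \<le> 2"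
    by (simp add: card_insert_if)
  moreover have "poly3.dim (forms 1) = 3"
    using dim_forms[of 1] by simp
  ultimately have "0 < poly3.dim {f \<in> forms 1. \<forall>s\<in>{q, r}. vanishes_at f s}"
    by linarith
  then obtain l where "l \<in> {f \<in> forms 1. \<forall>s\<in>{q, r}. vanishes_at f s}" "l \<noteq> 0"
    by (rule ex_nonzero_of_dim_pos)
  then show thesis
    using that[of l] by simp
qed

lemma extra_point_on_line:
  assumes "homogeneous 1 l" "finite T"
  obtains r where "r \<notin> T" "vanishes_at l r"
proof -
  have "\<not> {q. vanishes_at l q} \<subseteq> T"
    using infinite_zeros[OF assms(1)] assms(2) finite_subset by auto
  then show thesis
    using that by blast
qed

subsection \<open>Cubics through eight points\<close>

locale eight_points =
  fixes p :: "8 \<Rightarrow> proj_plane"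
  assumes inj: "inj p"
begin

definition N :: "poly3 \<Rightarrow> 8 set"
  where "N f = {i. vanishes_at f (p i)}"

definition V :: "poly3 set"
  where "V = {f. homogeneous 3 f \<and> (\<forall>i. vanishes_at f (p i))}"

definition general_position :: bool
  where "general_position \<longleftrightarrow> (\<forall>l. is_line l \<longrightarrow> card (N l) \<le> 3) \<and> (\<forall>q. is_conic q \<longrightarrow> card (N q) \<le> 6)"

lemma ex_subset_card_iff: "(\<exists>S. card S = Suc n \<and> (\<forall>i\<in>S. vanishes_at f (p i))) \<longleftrightarrow> \<not> card (N f) \<le> n"
proof
  assume "\<exists>S. card S = Suc n \<and> (\<forall>i\<in>S. vanishes_at f (p i))"
  then obtain S where "card S = Suc n" "S \<subseteq> N f"
    by (auto simp: N_def)
  then show "\<not> card (N f) \<le> n"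
    using card_mono[of "N f" S] by auto
next
  assume "\<not> card (N f) \<le> n"
  then obtain S where "S \<subseteq> N f" "card S = Suc n"
    using obtain_subset_with_card_n[of "Suc n" "N f"] by (metis not_less_eq_eq)
  then show "\<exists>S. card S = Suc n \<and> (\<forall>i\<in>S. vanishes_at f (p i))"
    by (auto simp: N_def)
qed

lemma general_position_iff:
  "general_position \<longleftrightarrow>
    \<not> (\<exists>S l. card S = 4 \<and> is_line l \<and> (\<forall>i\<in>S. vanishes_at l (p i)))
  \<and> \<not> (\<exists>S q. card S = 7 \<and> is_conic q \<and> (\<forall>i\<in>S. vanishes_at q (p i)))"
proof -
  have *: "card (N l) \<le> 3 \<longleftrightarrow> \<not> (\<exists>S. card S = 4 \<and> (\<forall>i\<in>S. vanishes_at l (p i)))"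
    "card (N l) \<le> 6 \<longleftrightarrow> \<not> (\<exists>S. card S = 7 \<and> (\<forall>i\<in>S. vanishes_at l (p i)))" for l
    using ex_subset_card_iff[of 3 l] ex_subset_card_iff[of 6 l] by simp_all
  show ?thesis
    unfolding general_position_def * by blast
qed

lemma card_image_p: "card (p ` S) = card S"
  using inj by (meson card_image inj_on_subset subset_UNIV)

lemma V_eq: "V = {f \<in> forms 3. \<forall>q\<in>range p. vanishes_at f q}"
  by (auto simp: V_def)

lemma subspace_V: "poly3.subspace V" and fin_dim_V: "poly3.fin_dim V"
  unfolding V_eq by (rule subspace_forms_vanishing, rule fin_dim_subset_forms) auto

lemma dim_V_ge: "2 \<le> poly3.dim V"
  using dim_forms_vanishing_ge[of "range p" 3] dim_forms[of 3] card_image_p[of UNIV] by (simp add: V_eq)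

lemma V_pencilE:
  obtains f g where "f \<in> V" "g \<in> V" "f \<noteq> 0" "g \<notin> poly3.span {f}"
  using poly3.dim_ge_2E[OF dim_V_ge subspace_V fin_dim_V] .

lemma pencil_in_V: "f \<in> V \<Longrightarrow> g \<in> V \<Longrightarrow> g + poly_scale t f \<in> V"
  using subspace_V poly3.subspace_add poly3.subspace_scale by blast

lemma N_mult: "homogeneous a f \<Longrightarrow> homogeneous b g \<Longrightarrow> N (f * g) = N f \<union> N g"
  by (auto simp: N_def vanishes_at_mult_iff)

lemma N_V: "f \<in> V \<Longrightarrow> N f = UNIV"
  by (auto simp: V_def N_def)

lemma bezout_dvd_N:
  assumes "irreducible f" "homogeneous m f" "homogeneous n g" "m * n < card (N f \<inter> N g)"
  shows "f dvd g"
proof (rule bezout_dvd[OF assms(1-3), of "p ` (N f \<inter> N g)"])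
  show "infinite (p ` (N f \<inter> N g)) \<or> m * n < card (p ` (N f \<inter> N g))"
    using assms(4) card_image_p by simp
qed (auto simp: N_def)

lemma common_component:
  assumes "\<not> general_position"
  obtains C d where "homogeneous d C" "0 < d" "d < 3" "\<And>f. f \<in> V \<Longrightarrow> C dvd f"
proof -
  obtain C d where C: "irreducible C" "homogeneous d C" "0 < d" "d < 3" "d * 3 < card (N C)"
  proof -
    from assms consider l where "is_line l" "\<not> card (N l) \<le> 3" | q where "is_conic q" "\<not> card (N q) \<le> 6"
      unfolding general_position_def by blast
    then show thesis
    proof cases
      case 1
      then show thesis
        using that[of l 1] irreducible_linear by (auto simp: is_line_def)
    next
      case 2
      then show thesis
        using that[of q 2] by (auto simp: is_conic_def)
    qed
  qed
  have "C dvd f" if "f \<in> V" for f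
    using bezout_dvd_N[OF C(1,2), of 3 f] C(5) that N_V[OF that] by (simp add: V_def)
  then show thesis
    using that C by blast
qed

lemma general_position_of_irreducible:
  assumes "f \<in> V" "irreducible f"
  shows general_position
proof (rule ccontr)
  assume "\<not> general_position"
  then obtain C d where C: "homogeneous d C" "0 < d" "d < 3" "C dvd f"
    using common_component assms(1) by metis
  have "homogeneous 3 f"
    using assms(1) by (simp add: V_def)
  then show False
    using irreducible_homogeneous_not_dvd[OF assms(2) _ C(1-3)] C(4) by blast
qed

lemma reducible_cubicE:
  assumes "homogeneous 3 f" "f \<noteq> 0" "\<not> irreducible f"
  obtains l q where "f = l * q" "homogeneous 1 l" "homogeneous 2 q" "l \<noteq> 0" "q \<noteq> 0"
proof -
  obtain a b g h where gh: "f = g * h" "homogeneous a g" "homogeneous b h" "a + b = 3" "0 < a" "0 < b"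
    by (rule reducible_homogeneous_factors[OF assms(1,2) zero_less_numeral assms(3)])
  then consider "a = 1" "b = 2" | "a = 2" "b = 1"
    by linarith
  then show thesis
    using that[of g h] that[of h g] gh assms(2) by cases (auto simp: mult.commute)
qed

lemma finite_discriminant_imp_irreducible:
  assumes "finite (cubics_through p \<inter> discriminant)"
  obtains f where "f \<in> V" "irreducible f"
proof (rule ccontr)
  assume nt: "\<not> thesis"
  have red: "\<not> irreducible f" if "f \<in> V" for f
    using nt that \<open>\<And>f. f \<in> V \<Longrightarrow> irreducible f \<Longrightarrow> thesis\<close> by blast
  obtain f g where fg: "f \<in> V" "g \<in> V" "f \<noteq> 0" "g \<notin> poly3.span {f}"
    using V_pencilE .
  define h where "h t = g + poly_scale t f" for t
  have h: "h t \<in> V" "h t \<noteq> 0" for t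
    using pencil_in_V fg pencil_nonzero by (auto simp: h_def)
  have "poly3.span {h t} \<in> cubics_through p \<inter> discriminant" for t
  proof -
    have hom: "homogeneous 3 (h t)"
      using h(1)[of t] by (simp add: V_def)
    obtain l q where lq: "h t = l * q" "homogeneous 1 l" "homogeneous 2 q"
      using reducible_cubicE[OF hom h(2) red[OF h(1)]] by metis
    obtain r where "vanishes_at l r" "vanishes_at q r"
      using line_meets_curve[OF lq(2,3)] by auto
    then have "singular_at (h t) r"
      using singular_at_mult lq(1) by metis
    moreover have "h t \<in> poly3.span {h t}"
      by (simp add: poly3.span_base)
    ultimately show ?thesis
      using h[of t] unfolding cubics_through_def discriminant_def projectivization_def V_def by blast
  qed
  then have "range (\<lambda>t. poly3.span {h t}) \<subseteq> cubics_through p \<inter> discriminant"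
    by blast
  then have "finite (range (\<lambda>t. poly3.span {h t}))"
    using assms finite_subset by blast
  moreover have "inj (\<lambda>t. poly3.span {h t})"
  proof (rule injI)
    fix t t' assume "poly3.span {h t} = poly3.span {h t'}"
    then have "h t \<in> poly3.span {h t'}"
      using poly3.span_base by blast
    then obtain c where "h t = poly_scale c (h t')"
      by (auto simp: poly3_span_singleton)
    then show "t = t'"
      unfolding h_def by (rule pencil_inj[OF fg(3,4)])
  qed
  ultimately show False
    using finite_imageD infinite_UNIV_char_0 by blast
qed

subsection \<open>Eight points in general position\<close>

context
  assumes gp: general_position
begin

lemma card_N_linear: "homogeneous 1 l \<Longrightarrow> l \<noteq> 0 \<Longrightarrow> card (N l) \<le> 3"
  using gp by (simp add: general_position_def is_line_def)

lemma card_N_quadratic: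
  assumes "homogeneous 2 q" "q \<noteq> 0"
  shows "card (N q) \<le> 6"
proof (cases "irreducible q")
  case True
  then show ?thesis
    using gp assms by (simp add: general_position_def is_conic_def)
next
  case False
  obtain a b g h where gh: "q = g * h" "homogeneous a g" "homogeneous b h" "a + b = 2" "0 < a" "0 < b"
    by (rule reducible_homogeneous_factors[OF assms zero_less_numeral False])
  have "a = 1" "b = 1"
    using gh(4-6) by linarith+
  then have "card (N g) \<le> 3" "card (N h) \<le> 3"
    using gh(1-3) assms(2) card_N_linear by fastforce+
  then show ?thesis
    using card_Un_le[of "N g" "N h"] gh N_mult[OF gh(2,3)] by simp
qed

lemma linear_unique:
  assumes "homogeneous 1 l" "l \<noteq> 0" "homogeneous 1 l'" "2 \<le> card (N l \<inter> N l')"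
  obtains c where "l' = poly_scale c l"
proof -
  have "l dvd l'"
    using bezout_dvd_N[OF irreducible_linear[OF assms(1,2)] assms(1,3)] assms(4) by simp
  then show thesis
    using homogeneous_dvd_same_degree[OF assms(1,3)] that by blast
qed

lemma reducible_quadratic_unique:
  assumes q: "homogeneous 1 l" "homogeneous 1 m" "l \<noteq> 0" "m \<noteq> 0" "homogeneous 2 q'"
    and A: "A \<subseteq> N (l * m) \<inter> N q'" "5 \<le> card A" "3 \<le> card (A \<inter> N l)"
  obtains c where "q' = poly_scale c (l * m)"
proof (cases "q' = 0")
  case True
  then show thesis
    using that[of 0] by simp
next
  case False
  have "card (A \<inter> N l) \<le> card (N l \<inter> N q')"
    by (rule card_mono) (use A in auto)
  then have "l dvd q'"
    using bezout_dvd_N[OF irreducible_linear[OF q(1,3)] q(1,5)] A(3) by simp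
  then obtain m' where m': "q' = l * m'" "homogeneous 1 m'"
    using homogeneous_dvd_cases[OF q(1,5) False] by auto
  have "A - N l \<subseteq> N m \<inter> N m'"
    using A(1) N_mult[OF q(1,2)] N_mult[OF q(1) m'(2)] m'(1) by auto
  then have "card (A - N l) \<le> card (N m \<inter> N m')"
    by (intro card_mono) auto
  moreover have "card A - card (N l) \<le> card (A - N l)"
    by (rule diff_card_le_card_Diff) simp
  ultimately have "2 \<le> card (N m \<inter> N m')"
    using A(2) card_N_linear[OF q(1,3)] by linarith
  then obtain c where "m' = poly_scale c m"
    using linear_unique[OF q(2,4) m'(2)] by blast
  then have "q' = poly_scale c (l * m)"
    using m'(1) by (simp add: poly_scale_eq mult.left_commute)
  then show thesis
    by (rule that)
qed

lemma quadratic_unique: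
  assumes q: "homogeneous 2 q" "q \<noteq> 0" "homogeneous 2 q'" and card: "5 \<le> card (N q \<inter> N q')"
  obtains c where "q' = poly_scale c q"
proof (cases "irreducible q")
  case True
  then have "q dvd q'"
    using bezout_dvd_N[OF True q(1,3)] card by simp
  then show thesis
    using homogeneous_dvd_same_degree[OF q(1,3)] that by blast
next
  case False
  obtain a b l m where lm: "q = l * m" "homogeneous a l" "homogeneous b m" "a + b = 2" "0 < a" "0 < b"
    by (rule reducible_homogeneous_factors[OF q(1,2) zero_less_numeral False])
  have "a = 1" "b = 1"
    using lm(4-6) by linarith+
  then have lm': "homogeneous 1 l" "homogeneous 1 m" "l \<noteq> 0" "m \<noteq> 0"
    using lm(1-3) q(2) by fastforce+
  let ?A = "N q \<inter> N q'"
  have "?A = ?A \<inter> N l \<union> ?A \<inter> N m"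
    using lm N_mult by auto
  then have "card ?A \<le> card (?A \<inter> N l) + card (?A \<inter> N m)"
    using card_Un_le by metis
  then consider "3 \<le> card (?A \<inter> N l)" | "3 \<le> card (?A \<inter> N m)"
    using card by linarith
  then show thesis
  proof cases
    case 1
    obtain c where "q' = poly_scale c (l * m)"
      using reducible_quadratic_unique[OF lm' q(3) _ card 1] lm(1) by blast
    then show thesis
      using that lm(1) by blast
  next
    case 2
    have "?A \<subseteq> N (m * l) \<inter> N q'"
      using lm(1) by (simp add: mult.commute)
    then obtain c where c: "q' = poly_scale c (m * l)"
      using reducible_quadratic_unique[OF lm'(2,1,4,3) q(3) _ card 2] by blast
    show thesis
      by (rule that[of c]) (simp only: c lm(1) mult.commute)
  qed
qed

lemma reducible_cubic_N:
  assumes "l * q \<in> V" "homogeneous 1 l" "homogeneous 2 q" "l \<noteq> 0" "q \<noteq> 0"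
  shows "2 \<le> card (N l)" "5 \<le> card (N q)"
proof -
  have "N l \<union> N q = UNIV"
    using N_V[OF assms(1)] N_mult[OF assms(2,3)] by simp
  then have "8 \<le> card (N l) + card (N q)"
    using card_Un_le[of "N l" "N q"] by simp
  then show "2 \<le> card (N l)" "5 \<le> card (N q)"
    using card_N_linear[OF assms(2,4)] card_N_quadratic[OF assms(3,5)] by linarith+
qed

text \<open>A reducible cubic through the points is determined by which of them lie on the linear and
  which on the quadratic factor, so there are only finitely many.\<close>

lemma ex_irreducible_cubic:
  obtains f where "f \<in> V" "irreducible f"
proof (rule ccontr)
  assume nt: "\<not> thesis"
  have red: "\<not> irreducible f" if "f \<in> V" for f
    using nt that \<open>\<And>f. f \<in> V \<Longrightarrow> irreducible f \<Longrightarrow> thesis\<close> by blast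
  obtain f g where fg: "f \<in> V" "g \<in> V" "f \<noteq> 0" "g \<notin> poly3.span {f}"
    using V_pencilE .
  define h where "h t = g + poly_scale t f" for t
  have h: "h t \<in> V" "h t \<noteq> 0" for t
    using pencil_in_V fg pencil_nonzero by (auto simp: h_def)
  have "\<exists>l q. h t = l * q \<and> homogeneous 1 l \<and> homogeneous 2 q \<and> l \<noteq> 0 \<and> q \<noteq> 0" for t
  proof -
    have hom: "homogeneous 3 (h t)"
      using h(1)[of t] by (simp add: V_def)
    show ?thesis
      using reducible_cubicE[OF hom h(2) red[OF h(1)]] by metis
  qed
  then obtain l q where lq: "h t = l t * q t" "homogeneous 1 (l t)" "homogeneous 2 (q t)" "l t \<noteq> 0" "q t \<noteq> 0" for t
    by metis
  have "inj (\<lambda>t. (N (l t), N (q t)))"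
  proof (rule injI)
    fix t t' assume eq: "(N (l t), N (q t)) = (N (l t'), N (q t'))"
    have N: "2 \<le> card (N (l t'))" "5 \<le> card (N (q t'))"
    proof -
      have "l t' * q t' \<in> V"
        using h(1)[of t'] lq(1)[of t'] by simp
      then show "2 \<le> card (N (l t'))" "5 \<le> card (N (q t'))"
        using reducible_cubic_N lq(2-5) by blast+
    qed
    have cN: "2 \<le> card (N (l t') \<inter> N (l t))" "5 \<le> card (N (q t') \<inter> N (q t))"
      using eq N by simp_all
    obtain a where a: "l t = poly_scale a (l t')"
      by (rule linear_unique[OF lq(2,4,2) cN(1)])
    obtain b where b: "q t = poly_scale b (q t')"
      by (rule quadratic_unique[OF lq(3,5,3) cN(2)])
    have "l t * q t = poly_scale (a * b) (l t' * q t')"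
      unfolding a b by (simp only: poly_scale_eq Const_mult mult.assoc mult.left_commute[of "l t'" "Const b"])
    then have "h t = poly_scale (a * b) (h t')"
      unfolding lq(1) .
    then show "t = t'"
      unfolding h_def by (rule pencil_inj[OF fg(3,4)])
  qed
  moreover have "finite (range (\<lambda>t. (N (l t), N (q t))))"
    by (rule finite)
  ultimately show False
    using finite_imageD infinite_UNIV_char_0 by blast
qed

lemma dim_V: "poly3.dim V = 2"
proof (rule ccontr)
  assume "poly3.dim V \<noteq> 2"
  then have dim: "3 \<le> poly3.dim V"
    using dim_V_ge by simp
  show False
  proof (cases "\<exists>l. homogeneous 1 l \<and> l \<noteq> 0 \<and> card (N l) = 3")
    case True
    then obtain l where l: "homogeneous 1 l" "l \<noteq> 0" "card (N l) = 3"
      by blast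
    obtain r where r: "r \<notin> range p" "vanishes_at l r"
      using extra_point_on_line[OF l(1), of "range p"] by auto
    let ?W = "{f \<in> forms 3. \<forall>q\<in>insert r (range p). vanishes_at f q}"
    have W: "2 \<le> poly3.dim ?W"
      using forms_vanishing_insert_dim[of 3 "range p" r] dim by (simp add: V_eq)
    obtain F G where FG: "F \<in> ?W" "G \<in> ?W" "F \<noteq> 0" "G \<notin> poly3.span {F}"
      by (rule poly3.dim_ge_2E[OF W subspace_forms_vanishing fin_dim_subset_forms]) auto
    have *: "\<exists>q. H = l * q \<and> homogeneous 2 q \<and> - N l \<subseteq> N q" if HW: "H \<in> ?W" and H0: "H \<noteq> 0" for H
    proof -
      have H: "homogeneous 3 H"
        using HW by simp
      have "l dvd H"
      proof (rule bezout_dvd[OF irreducible_linear[OF l(1,2)] l(1) H, of "insert r (p ` N l)"])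
        show "vanishes_at l q \<and> vanishes_at H q" if "q \<in> insert r (p ` N l)" for q
          using that HW r by (auto simp: N_def)
        have "r \<notin> p ` N l"
          using r by blast
        then show "infinite (insert r (p ` N l)) \<or> 1 * 3 < card (insert r (p ` N l))"
          using l(3) card_image_p[of "N l"] by simp
      qed
      then obtain q where q: "H = l * q" "homogeneous 2 q"
        using homogeneous_dvd_cases[OF l(1) H H0] by auto
      have "N l \<union> N q = UNIV"
        using HW N_mult[OF l(1) q(2)] q(1) by (auto simp: N_def)
      then show ?thesis
        using q by auto
    qed
    obtain q where q: "F = l * q" "homogeneous 2 q" "- N l \<subseteq> N q"
      using *[OF FG(1,3)] by blast
    have "G \<noteq> 0"
      using FG(4) poly3.span_zero by metis
    then obtain q' where q': "G = l * q'" "homogeneous 2 q'" "- N l \<subseteq> N q'"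
      using *[OF FG(2)] by blast
    have "card (- N l) \<le> card (N q \<inter> N q')"
      using q q' by (intro card_mono) auto
    then have "5 \<le> card (N q \<inter> N q')"
      using l(3) by (simp add: Compl_eq_Diff_UNIV card_Diff_subset)
    moreover have "q \<noteq> 0"
      using q FG(3) by auto
    ultimately obtain c where "q' = poly_scale c q"
      using quadratic_unique[OF q(2) _ q'(2)] by blast
    then have "G = poly_scale c F"
      using q q' by (simp add: poly_scale_eq mult.left_commute)
    then show False
      using FG(4) unfolding poly3_span_singleton by blast
  next
    case False
    have two: "card (N l) \<le> 2" if "homogeneous 1 l" "l \<noteq> 0" for l
    proof -
      have "card (N l) \<noteq> 3"
        using False that by blast
      then show ?thesis
        using card_N_linear[OF that] by linarith
    qed
    have *: "\<exists>q. homogeneous 2 q \<and> q \<noteq> 0 \<and> - {i, j} \<subseteq> N q" if "i \<noteq> j" for i j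
    proof -
      obtain l where l: "homogeneous 1 l" "l \<noteq> 0" "vanishes_at l (p i)" "vanishes_at l (p j)"
        using line_through .
      have Nl: "N l = {i, j}"
        using card_seteq[of "N l" "{i, j}"] two[OF l(1,2)] l(3,4) that by (simp add: N_def)
      obtain r where r: "r \<notin> range p" "vanishes_at l r"
        using extra_point_on_line[OF l(1), of "range p"] by auto
      obtain s where s: "s \<notin> insert r (range p)" "vanishes_at l s"
        using extra_point_on_line[OF l(1), of "insert r (range p)"] by auto
      let ?W = "{f \<in> forms 3. \<forall>q\<in>insert s (insert r (range p)). vanishes_at f q}"
      have "0 < poly3.dim ?W"
        using forms_vanishing_insert_dim[of 3 "range p" r] forms_vanishing_insert_dim[of 3 "insert r (range p)" s] dim
        by (simp add: V_eq)
      then obtain H where H: "H \<in> ?W" "H \<noteq> 0"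
        by (rule ex_nonzero_of_dim_pos)
      have H3: "homogeneous 3 H"
        using H by simp
      have "l dvd H"
      proof (rule bezout_dvd[OF irreducible_linear[OF l(1,2)] l(1) H3, of "{s, r, p i, p j}"])
        show "vanishes_at l q \<and> vanishes_at H q" if "q \<in> {s, r, p i, p j}" for q
          using that H r s l by auto
        have "p i \<noteq> p j"
          using inj that by (metis injD)
        then show "infinite {s, r, p i, p j} \<or> 1 * 3 < card {s, r, p i, p j}"
          using r s by (auto simp: card_insert_if)
      qed
      then obtain q where q: "H = l * q" "homogeneous 2 q"
        using homogeneous_dvd_cases[OF l(1) H3 H(2)] by auto
      have "N l \<union> N q = UNIV"
        using H N_mult[OF l(1) q(2)] q(1) by (auto simp: N_def)
      then show ?thesis
        using q H(2) Nl by (intro exI[of _ q]) auto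
    qed
    have ne: "(0 :: 8) \<noteq> 1" "(0 :: 8) \<noteq> 2" "(1 :: 8) \<noteq> 2"
      by simp_all
    obtain q where q: "homogeneous 2 q" "q \<noteq> 0" "- {0, 1} \<subseteq> N q"
      using *[OF ne(1)] by blast
    obtain q' where q': "homogeneous 2 q'" "q' \<noteq> 0" "- {0, 2} \<subseteq> N q'"
      using *[OF ne(2)] by blast
    have "card (- {0, 1, 2 :: 8}) \<le> card (N q \<inter> N q')"
      by (rule card_mono) (use q q' in auto)
    moreover have "card (- {0, 1, 2 :: 8}) = 5"
      using ne by (simp add: Compl_eq_Diff_UNIV card_Diff_subset)
    ultimately have "5 \<le> card (N q \<inter> N q')"
      by simp
    then obtain c where c: "q' = poly_scale c q"
      using quadratic_unique[OF q(1,2) q'(1)] by blast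
    have "c \<noteq> 0"
      using c q'(2) by auto
    then have "N q' = N q"
      unfolding c by (simp add: N_def vanishes_at_def)
    then have "- {0} \<subseteq> N q"
      using q(3) q'(3) ne by auto
    then have "card (- {0 :: 8}) \<le> card (N q)"
      by (intro card_mono) auto
    then show False
      using card_N_quadratic[OF q(1,2)] by (simp add: Compl_eq_Diff_UNIV card_Diff_subset)
  qed
qed

end

subsection \<open>The base locus\<close>

lemma Union_cubics_through: "\<Union> (cubics_through p) = V"
proof (intro equalityI subsetI)
  fix f assume "f \<in> \<Union> (cubics_through p)"
  then obtain g where "g \<in> V" "f \<in> poly3.span {g}"
    by (auto simp: cubics_through_def projectivization_def V_def)
  then show "f \<in> V"
    using subspace_V poly3.span_minimal[of "{g}" V] by auto
next
  fix f assume f: "f \<in> V"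
  obtain g where g: "g \<in> V" "g \<noteq> 0"
    using V_pencilE by metis
  have mem: "poly3.span {h} \<in> cubics_through p" if "h \<in> V" "h \<noteq> 0" for h
    using that unfolding cubics_through_def projectivization_def V_def by blast
  show "f \<in> \<Union> (cubics_through p)"
  proof (cases "f = 0")
    case True
    then show ?thesis
      using mem[OF g] poly3.span_zero by blast
  next
    case False
    then show ?thesis
      using mem[OF f] poly3.span_base by blast
  qed
qed

lemma residue_point_unique:
  assumes q: "residue p = reduced_point q" and r: "r \<notin> range p" "\<And>f. f \<in> V \<Longrightarrow> vanishes_at f r"
  shows "r = q"
proof (rule ccontr)
  assume "r \<noteq> q"
  then obtain F where F: "homogeneous 1 F" "vanishes_at F q" "\<not> vanishes_at F r"
    using separating_linear by blast
  obtain G where G: "homogeneous 8 G" "\<not> vanishes_at G r" "\<And>s. s \<in> range p \<Longrightarrow> vanishes_at G s"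
    using separating_form[of "range p" r 8] r(1) card_image_p[of UNIV] by auto
  obtain i where i: "rep r $ i \<noteq> 0"
    using rep(1)[of r] by (auto simp: vec_eq_iff)
  define v where "v = inverse (rep r $ i) *s rep r"
  have v: "v $ i = 1" "v \<in> Rep_proj_plane r"
    using i by (auto simp: v_def rep(2) vec_span_singleton)
  have "F \<in> vanishing_ideal {q}"
    unfolding vanishing_ideal_def ideal_generated_def by (rule mult.span_base) (use F in auto)
  then have "dehomogenize i F \<in> residue p i"
    unfolding q reduced_point_def subscheme_def by blast
  then obtain F' where F': "dehomogenize i F = dehomogenize i F'"
    "F' \<in> ideal_quotient (ideal_generated V) (vanishing_ideal (range p))"
    unfolding residue_def subscheme_def Union_cubics_through by blast
  have "G \<in> vanishing_ideal (range p)"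
    unfolding vanishing_ideal_def ideal_generated_def by (rule mult.span_base) (use G in auto)
  then have "F' * G \<in> mult.span V"
    using F'(2) by (auto simp: ideal_quotient_def ideal_generated_def)
  moreover have "mult.span V \<subseteq> {h. poly_eval h v = 0}"
    by (rule mult.span_minimal) (use r(2) v(2) in \<open>auto simp: mult.subspace_def vanishes_at_def\<close>)
  ultimately have "poly_eval F' v * poly_eval G v = 0"
    by auto
  moreover have "poly_eval G v \<noteq> 0"
    using G(2) i by (simp add: v_def poly_eval_homogeneous[OF G(1)] vanishes_at_rep[OF G(1)])
  ultimately have "poly_eval F' v = 0"
    by simp
  then have "poly_eval F v = 0"
    using poly_eval_dehomogenize[OF v(1)] F'(1) by metis
  then show False
    using F(3) i by (simp add: v_def poly_eval_homogeneous[OF F(1)] vanishes_at_rep[OF F(1)])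
qed

lemma general_position_of_residue:
  assumes q: "residue p = reduced_point q"
  shows general_position
proof (rule ccontr)
  assume "\<not> general_position"
  then obtain C d where C: "homogeneous d C" "0 < d" "\<And>f. f \<in> V \<Longrightarrow> C dvd f"
    by (rule common_component) blast
  have "infinite ({r. vanishes_at C r} - insert q (range p))"
    using infinite_zeros[OF C(1,2)] by (simp add: Diff_infinite_finite)
  then have "{r. vanishes_at C r} - insert q (range p) \<noteq> {}"
    by (rule infinite_imp_nonempty)
  then obtain r where r: "vanishes_at C r" "r \<noteq> q" "r \<notin> range p"
    by blast
  have "vanishes_at f r" if "f \<in> V" for f
    using C(3)[OF that] r(1) vanishes_at_mult_left by (metis dvdE mult.commute)
  then show False
    using residue_point_unique[OF q r(3)] r(2) by blast
qed

end

subsection \<open>A nonzerodivisor modulo the ideal of the pencil\<close>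

interpretation substitution: const_hom Const
  by unfold_locales (simp_all add: Const_add Const_mult)

lemma poly_eval_subst: "poly_eval (ring_eval Const x f) v = poly_eval f (\<chi> i. poly_eval (x i) v)"
  by (induction f rule: poly3_induct) (simp_all add: substitution.ring_eval_simps)

lemma dvd_diff_subst:
  assumes "\<And>i. l dvd Var i - x i"
  shows "l dvd f - ring_eval Const x f"
proof (induction f rule: poly3_induct)
  case (add f g)
  have "(f + g) - ring_eval Const x (f + g) = (f - ring_eval Const x f) + (g - ring_eval Const x g)"
    by (simp add: substitution.ring_eval_add)
  then show ?case
    using add by (simp only: dvd_add)
next
  case (mult f g)
  have "f * g - ring_eval Const x (f * g) =
      (f - ring_eval Const x f) * g + ring_eval Const x f * (g - ring_eval Const x g)"
    by (simp add: substitution.ring_eval_mult algebra_simps)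
  then show ?case
    using mult by (simp only: dvd_add dvd_mult dvd_mult2)
qed (simp_all add: assms)

definition moment_line :: "complex \<Rightarrow> poly3"
  where "moment_line s = Var 1 + (Const s * Var 2 + Const (s\<^sup>2) * Var 3)"

abbreviation (input) moment_a :: "complex \<Rightarrow> complex ^ 3"
  where "moment_a s \<equiv> vector [- s, 1, 0]"

abbreviation (input) moment_b :: "complex \<Rightarrow> complex ^ 3"
  where "moment_b s \<equiv> vector [- s\<^sup>2, 0, 1]"

lemma homogeneous_moment_line: "homogeneous 1 (moment_line s)"
  unfolding moment_line_def by (intro homogeneous_add homogeneous_Const_mult homogeneous_Var)

lemma poly_eval_moment_line: "poly_eval (moment_line s) v = v $ 1 + s * v $ 2 + s\<^sup>2 * v $ 3"
  by (simp add: moment_line_def)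

lemma moment_line_nonzero: "moment_line s \<noteq> 0"
proof
  assume "moment_line s = 0"
  then have "poly_eval (moment_line s) (axis 1 1) = 0"
    by simp
  then show False
    by (simp add: poly_eval_moment_line axis_def)
qed

lemma ex_moment_line_avoiding:
  assumes "finite Z"
  obtains s where "\<And>q. q \<in> Z \<Longrightarrow> \<not> vanishes_at (moment_line s) q"
proof -
  have "finite {s. vanishes_at (moment_line s) q}" for q
  proof -
    have "[:rep q $ 1, rep q $ 2, rep q $ 3:] \<noteq> 0"
      using rep(1)[of q] by (auto simp: vec_eq_iff forall_3)
    moreover have "{s. vanishes_at (moment_line s) q} = {s. poly [:rep q $ 1, rep q $ 2, rep q $ 3:] s = 0}"
      by (auto simp: vanishes_at_rep[OF homogeneous_moment_line] poly_eval_moment_line power2_eq_square algebra_simps)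
    ultimately show ?thesis
      using poly_roots_finite by metis
  qed
  then have "finite (\<Union>q\<in>Z. {s. vanishes_at (moment_line s) q})"
    using assms by blast
  then obtain s where "s \<notin> (\<Union>q\<in>Z. {s. vanishes_at (moment_line s) q})"
    using ex_new_if_finite[OF infinite_UNIV_char_0] by blast
  then show thesis
    using that by blast
qed

lemma moment_line_dvd:
  assumes f: "homogeneous d f" and zero: "line_poly (moment_a s) (moment_b s) f = 0"
  shows "moment_line s dvd f"
proof -
  define x where "x i = (if i = 1 then - (Const s * Var 2 + Const (s\<^sup>2) * Var 3) else Var i)" for i
  have "moment_line s dvd Var i - x i" for i
  proof -
    have "Var i - x i = (if i = 1 then moment_line s else 0)"
      by (simp add: x_def moment_line_def algebra_simps)
    then show ?thesis
      by simp
  qed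
  then have dvd: "moment_line s dvd f - ring_eval Const x f"
    by (rule dvd_diff_subst)
  have fb: "poly_eval f (moment_b s) = 0"
    using line_poly_homogeneous(2)[OF f, of "moment_a s" "moment_b s"] zero by simp
  have "poly_eval (ring_eval Const x f) v = 0" for v
  proof -
    have e: "(\<chi> i. poly_eval (x i) v) = v $ 2 *s moment_a s + v $ 3 *s moment_b s"
      by (simp add: vec_eq_iff forall_3 x_def)
    show ?thesis
    proof (cases "v $ 2 = 0")
      case True
      then show ?thesis
        unfolding poly_eval_subst e using fb by (simp add: poly_eval_homogeneous[OF f])
    next
      case False
      have "v $ 2 *s moment_a s + v $ 3 *s moment_b s = v $ 2 *s (moment_a s + (v $ 3 / v $ 2) *s moment_b s)"
        using False by (simp add: vec_eq_iff forall_3)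
      moreover have "poly_eval f (moment_a s + (v $ 3 / v $ 2) *s moment_b s) = 0"
        using poly_line_poly[of "moment_a s" "moment_b s" f] zero by (metis poly_0)
      ultimately show ?thesis
        unfolding poly_eval_subst e by (simp only: poly_eval_homogeneous[OF f] mult_zero_right)
    qed
  qed
  then have "ring_eval Const x f = 0"
    by (rule poly_eval_eq_0_imp_eq_0)
  then show ?thesis
    using dvd by simp
qed

lemma coprime_polyI_roots:
  fixes p q :: "complex poly"
  assumes "\<And>z. \<not> (poly p z = 0 \<and> poly q z = 0)"
  shows "coprime p q"
proof (rule ccontr)
  assume "\<not> coprime p q"
  then have g: "\<not> is_unit (gcd p q)"
    using is_unit_gcd by blast
  have "gcd p q \<noteq> 0"
    using assms by auto
  then have "degree (gcd p q) \<noteq> 0"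
    using g is_unit_iff_degree by blast
  then have "\<exists>z. poly (gcd p q) z = 0"
    by (intro fundamental_theorem_of_algebra) (simp add: constant_degree)
  then obtain z where "poly (gcd p q) z = 0"
    by blast
  then have "poly p z = 0" "poly q z = 0"
    using gcd_dvd1[of p q] gcd_dvd2[of p q] by (metis dvdE mult_zero_left poly_mult)+
  then show False
    using assms by blast
qed

lemma lift_binary_form:
  assumes "degree w \<le> n"
  obtains W where "homogeneous n W" "line_poly (moment_a s) (moment_b s) W = w"
proof -
  let ?W = "\<Sum>i\<le>n. Const (coeff w i) * (Var 2 ^ (n - i) * Var 3 ^ i)"
  have "homogeneous n ?W"
  proof (intro homogeneous_sum homogeneous_Const_mult)
    fix i assume "i \<in> {..n}"
    then show "homogeneous n (Var 2 ^ (n - i) * Var 3 ^ i)"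
      using homogeneous_mult[OF homogeneous_power[OF homogeneous_Var(1), of "n - i" 2] homogeneous_power[OF homogeneous_Var(1), of i 3]]
      by simp
  qed
  moreover have "line_poly (moment_a s) (moment_b s) ?W = (\<Sum>i\<le>n. monom (coeff w i) i)"
    by (simp add: monom_altdef flip: one_pCons)
  then have "line_poly (moment_a s) (moment_b s) ?W = w"
    using poly_as_sum_of_monoms'[OF assms] by simp
  ultimately show thesis
    by (rule that)
qed

lemma moment_line_cancel_aux:
  assumes f: "homogeneous 3 f" and g: "homogeneous 3 g"
    and no_zero: "\<And>q. vanishes_at f q \<Longrightarrow> vanishes_at g q \<Longrightarrow> \<not> vanishes_at (moment_line s) q"
    and fb: "poly_eval f (moment_b s) \<noteq> 0"
    and uv: "homogeneous k u" "homogeneous k v" "moment_line s * a = u * f + v * g"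
  shows "\<exists>u' v'. a = u' * f + v' * g"
proof -
  let ?l = "moment_line s" and ?r = "line_poly (moment_a s) (moment_b s)"
  have rl: "?r ?l = 0"
    by (simp add: moment_line_def)
  have "?r u * ?r f + ?r v * ?r g = 0"
    using arg_cong[OF uv(3), of ?r] rl by simp
  then have syz: "?r v * ?r g = - (?r u * ?r f)"
    by (simp add: add_eq_0_iff)
  have "coprime (?r f) (?r g)"
  proof (rule coprime_polyI_roots, rule notI, elim conjE)
    fix z assume z: "poly (?r f) z = 0" "poly (?r g) z = 0"
    let ?v = "moment_a s + z *s moment_b s"
    have nz: "?v \<noteq> 0"
      by (auto simp: vec_eq_iff forall_3)
    have "vanishes_at f (pt ?v)" "vanishes_at g (pt ?v)"
      using z by (simp_all add: vanishes_at_pt[OF f nz] vanishes_at_pt[OF g nz] poly_line_poly)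
    then have "\<not> vanishes_at ?l (pt ?v)"
      by (rule no_zero)
    then show False
      by (simp add: vanishes_at_pt[OF homogeneous_moment_line nz] poly_eval_moment_line algebra_simps)
  qed
  moreover have "?r f dvd ?r v * ?r g"
    unfolding syz by simp
  ultimately have "?r f dvd ?r v"
    using coprime_dvd_mult_left_iff by blast
  then obtain w where w: "?r v = ?r f * w"
    by blast
  have "coeff (?r f) 3 \<noteq> 0"
    using line_poly_homogeneous(2)[OF f] fb by simp
  then have rf: "?r f \<noteq> 0" "degree (?r f) = 3"
    using line_poly_homogeneous(1)[OF f, of "moment_a s" "moment_b s"] le_degree[of "?r f" 3] by auto
  obtain W where W: "homogeneous k (W * f)" "homogeneous k (W * g)" "?r W = w"
  proof (cases "w = 0")
    case True
    then show thesis
      using that[of 0] by simp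
  next
    case False
    then have "degree (?r v) = 3 + degree w"
      using w rf by (simp add: degree_mult_eq)
    then have k: "3 + degree w \<le> k"
      using line_poly_homogeneous(1)[OF uv(2), of "moment_a s" "moment_b s"] by simp
    then have "degree w \<le> k - 3"
      by linarith
    then obtain W where "homogeneous (k - 3) W" "?r W = w"
      by (rule lift_binary_form)
    then show thesis
      using that[of W] homogeneous_mult[OF _ f, of "k - 3" W] homogeneous_mult[OF _ g, of "k - 3" W] k by simp
  qed
  have "?r (v - W * f) = 0"
    using w W(3) by (simp only: line_poly_simps mult.commute diff_self)
  then have "?l dvd v - W * f"
    by (rule moment_line_dvd[OF homogeneous_diff[OF uv(2) W(1)]])
  then obtain v' where v': "v - W * f = ?l * v'"
    by (rule dvdE)
  have "?r (u + W * g) * ?r f = ?r u * ?r f + ?r v * ?r g"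
    by (simp add: w W(3) algebra_simps)
  then have "?r (u + W * g) = 0"
    using syz rf(1) by simp
  then have "?l dvd u + W * g"
    by (rule moment_line_dvd[OF homogeneous_add[OF uv(1) W(2)]])
  then obtain u' where u': "u + W * g = ?l * u'"
    by (rule dvdE)
  have "?l * a = (u + W * g) * f + (v - W * f) * g"
    using uv(3) by algebra
  also have "\<dots> = ?l * (u' * f + v' * g)"
    unfolding u' v' by algebra
  finally have "a = u' * f + v' * g"
    using moment_line_nonzero by simp
  then show ?thesis
    by blast
qed

subsection \<open>Homogeneous ideals\<close>

lemma hcomp_mult_vanishes:
  assumes "\<And>d. vanishes_at (hcomp d f) q"
  shows "vanishes_at (hcomp d (f * g)) q"
  using assms unfolding hcomp_mult vanishes_at_def by (auto intro!: sum.neutral)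

lemma mem_vanishing_ideal_iff: "f \<in> vanishing_ideal Y \<longleftrightarrow> (\<forall>d. \<forall>q\<in>Y. vanishes_at (hcomp d f) q)"
proof
  let ?S = "{f. \<forall>d. \<forall>q\<in>Y. vanishes_at (hcomp d f) q}"
  have "mult.subspace ?S"
    unfolding mult.subspace_def
  proof (intro conjI allI ballI)
    fix c x assume "x \<in> ?S"
    then have "vanishes_at (hcomp d (x * c)) q" if "q \<in> Y" for d q
      using that by (intro hcomp_mult_vanishes) blast
    then show "c * x \<in> ?S"
      unfolding mult.commute[of c] by blast
  qed (auto simp: hcomp_add vanishes_at_add)
  moreover have "{f. (\<exists>d. homogeneous d f) \<and> (\<forall>q\<in>Y. vanishes_at f q)} \<subseteq> ?S"
    by (auto simp: hcomp_homogeneous)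
  ultimately have "vanishing_ideal Y \<subseteq> ?S"
    unfolding vanishing_ideal_def ideal_generated_def by (intro mult.span_minimal)
  then show "\<forall>d. \<forall>q\<in>Y. vanishes_at (hcomp d f) q" if "f \<in> vanishing_ideal Y"
    using that by blast
  assume v: "\<forall>d. \<forall>q\<in>Y. vanishes_at (hcomp d f) q"
  have "(\<Sum>d\<in>mdeg ` keys f. hcomp d f) \<in> vanishing_ideal Y"
    unfolding vanishing_ideal_def ideal_generated_def
  proof (intro mult.span_sum mult.span_base CollectI conjI)
    show "\<exists>e. homogeneous e (hcomp d f)" for d
      using homogeneous_hcomp by blast
    show "\<forall>q\<in>Y. vanishes_at (hcomp d f) q" for d
      using v by blast
  qed
  then show "f \<in> vanishing_ideal Y"
    by (simp only: sum_hcomp)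
qed

lemma (in eight_points) pencil_ideal:
  assumes "general_position"
  obtains f g where "f \<in> V" "g \<in> V" "irreducible f" "\<not> f dvd g" "V = poly3.span {f, g}"
    "ideal_generated V = {u * f + v * g |u v. True}"
proof -
  obtain f where f: "f \<in> V" "irreducible f"
    using ex_irreducible_cubic[OF assms] .
  have "\<not> V \<subseteq> poly3.span {f}"
    using poly3.dim_le_card[of V "{f}"] dim_V[OF assms] by auto
  then obtain g where g: "g \<in> V" "g \<notin> poly3.span {f}"
    by blast
  have hom: "homogeneous 3 f" "homogeneous 3 g"
    using f g by (auto simp: V_def)
  let ?I = "{u * f + v * g |u v. True}"
  have "\<not> f dvd g"
    using homogeneous_dvd_same_degree[OF hom] g(2) unfolding poly3_span_singleton by blast
  moreover have "f \<noteq> 0"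
    using f(2) by auto
  then have V: "V = poly3.span {f, g}"
    using poly3.span_pair_eqI_dim[OF subspace_V fin_dim_V _ f(1) g(1) _ g(2)] dim_V[OF assms] by simp
  moreover have "ideal_generated V = ?I"
  proof (intro equalityI)
    have "mult.subspace ?I"
      unfolding mult.subspace_def
    proof (intro conjI allI ballI)
      show "0 \<in> ?I"
        by (intro CollectI exI[of _ 0]) simp
    next
      fix x y assume "x \<in> ?I" "y \<in> ?I"
      then obtain u v u' v' where "x = u * f + v * g" "y = u' * f + v' * g"
        by blast
      then have "x + y = (u + u') * f + (v + v') * g"
        by algebra
      then show "x + y \<in> ?I"
        by blast
    next
      fix c x assume "x \<in> ?I"
      then obtain u v where "x = u * f + v * g"
        by blast
      then have "c * x = (c * u) * f + (c * v) * g"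
        by algebra
      then show "c * x \<in> ?I"
        by blast
    qed
    moreover have "V \<subseteq> ?I"
    proof
      fix x assume "x \<in> V"
      then obtain a b where "x - poly_scale a f = poly_scale b g"
        unfolding V by (auto simp: poly3.span_insert)
      then have "x = Const a * f + Const b * g"
        by (simp add: poly_scale_eq diff_eq_eq add.commute)
      then show "x \<in> ?I"
        by blast
    qed
    ultimately show "ideal_generated V \<subseteq> ?I"
      unfolding ideal_generated_def by (intro mult.span_minimal)
    have "u * f + v * g \<in> mult.span V" for u v
      using f g by (intro mult.span_add mult.span_scale mult.span_base)
    then show "?I \<subseteq> ideal_generated V"
      unfolding ideal_generated_def by blast
  qed
  ultimately show thesis
    using that f g by blast
qed

subsection \<open>The residue of eight points in general position\<close>

lemma ideal_forms_eq:
  assumes f: "homogeneous n f" and g: "homogeneous n g" and d: "n \<le> d"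
  shows "{u * f + v * g |u v. True} \<inter> forms d =
    {u * f + v * g |u v. homogeneous (d - n) u \<and> homogeneous (d - n) v}" (is "?L = ?R")
proof (intro equalityI subsetI)
  fix x assume "x \<in> ?L"
  then obtain u v where x: "x = u * f + v * g" "homogeneous d x"
    by blast
  have "x = hcomp d (u * f + v * g)"
    using hcomp_homogeneous[OF x(2), of d] x(1) by simp
  also have "\<dots> = hcomp (d - n) u * f + hcomp (d - n) v * g"
    using d by (simp add: hcomp_add hcomp_mult_homogeneous[OF f] hcomp_mult_homogeneous[OF g])
  finally show "x \<in> ?R"
    using homogeneous_hcomp by blast
next
  fix x assume "x \<in> ?R"
  then obtain u v where x: "x = u * f + v * g" "homogeneous (d - n) u" "homogeneous (d - n) v"
    by blast
  have "homogeneous d x"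
    using homogeneous_add[OF homogeneous_mult[OF x(2) f] homogeneous_mult[OF x(3) g]] x(1) d by simp
  then show "x \<in> ?L"
    using x(1) by blast
qed

text \<open>In degree \<open>7 + d\<close>, the quotient of the ideal of the points by that of the pencil is spanned by
  \<open>l\<^sup>d h\<close>, where \<open>l\<close> is a linear form without zeros in the base locus. Comparing \<open>f h\<close> with \<open>l\<^sup>d h\<close> for forms \<open>f\<close> of degree \<open>d\<close> yields a ring homomorphism, that is, a
  point.\<close>

context eight_points
begin

lemma residue_of_general_position:
  assumes gp: general_position
  obtains q where "residue p = reduced_point q"
proof -
  obtain f g where fg: "f \<in> V" "g \<in> V" "irreducible f" "\<not> f dvd g"
    and "V = poly3.span {f, g}" and I_eq: "ideal_generated V = {u * f + v * g |u v. True}"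
    by (rule pencil_ideal[OF gp])
  define I where "I = ideal_generated V"
  define J where "J = vanishing_ideal (range p)"
  note I = I_eq[folded I_def]
  have hom: "homogeneous 3 f" "homogeneous 3 g"
    using fg by (auto simp: V_def)
  have I_sub: "mult.subspace I"
    unfolding I_def ideal_generated_def by (rule mult.subspace_span)
  have I_add: "x + y \<in> I" if "x \<in> I" "y \<in> I" for x y
    using mult.subspace_add[OF I_sub that] .
  have I_diff: "x - y \<in> I" if "x \<in> I" "y \<in> I" for x y
    using mult.subspace_diff[OF I_sub that] .
  have I_mult: "x * y \<in> I" if "y \<in> I" for x y
    using mult.subspace_scale[OF I_sub that] .
  have I_sum: "(\<And>a. a \<in> A \<Longrightarrow> F a \<in> I) \<Longrightarrow> sum F A \<in> I" for F :: "'b \<Rightarrow> poly3" and A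
    using mult.subspace_sum[OF I_sub, of A F] by blast
  have I_hcomp: "hcomp d x \<in> I" if "x \<in> I" for d x
  proof -
    obtain u v where "x = u * f + v * g"
      using \<open>x \<in> I\<close> unfolding I by blast
    then have "hcomp d x = (if 3 \<le> d then hcomp (d - 3) u else 0) * f + (if 3 \<le> d then hcomp (d - 3) v else 0) * g"
      by (simp add: hcomp_add hcomp_mult_homogeneous[OF hom(1)] hcomp_mult_homogeneous[OF hom(2)])
    then show ?thesis
      unfolding I by blast
  qed
  have dim_I: "poly3.dim (I \<inter> forms d) + 9 = poly3.dim (forms d)" "poly3.subspace (I \<inter> forms d)" if "6 \<le> d" for d
    using dim_ideal_two_forms[OF fg(3) hom(1,2) fg(4), of d] ideal_forms_eq[OF hom, of d] that unfolding I by simp_all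
  let ?J = "\<lambda>d. {F \<in> forms d. \<forall>q\<in>range p. vanishes_at F q}"
  have dim_J: "poly3.dim (?J d) + 8 = poly3.dim (forms d)" if "7 \<le> d" for d
    using dim_forms_vanishing[of "range p" d] that card_image_p[of UNIV] by simp
  have J_mult: "x * y \<in> ?J (a + b)" if "homogeneous a x" "y \<in> ?J b" for a b x y
    using that by (auto intro: homogeneous_mult vanishes_at_mult_left)
  have I_J: "I \<inter> forms d \<subseteq> ?J d" for d
  proof
    fix x assume x: "x \<in> I \<inter> forms d"
    then obtain u v where "x = u * f + v * g"
      unfolding I by blast
    then show "x \<in> ?J d"
      using x fg(1,2) by (auto simp: V_def intro!: vanishes_at_add vanishes_at_mult_left)
  qed
  have fin: "finite {q. vanishes_at f q \<and> vanishes_at g q}"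
  proof (rule ccontr)
    assume "infinite {q. vanishes_at f q \<and> vanishes_at g q}"
    then show False
      using bezout_dvd[OF fg(3) hom, of "{q. vanishes_at f q \<and> vanishes_at g q}"] fg(4) by blast
  qed
  have "\<exists>s. \<forall>q. vanishes_at f q \<and> vanishes_at g q \<longrightarrow> \<not> vanishes_at (moment_line s) q"
    by (rule ex_moment_line_avoiding[OF fin]) blast
  then obtain s where s: "\<And>q. vanishes_at f q \<Longrightarrow> vanishes_at g q \<Longrightarrow> \<not> vanishes_at (moment_line s) q"
    by blast
  define l where "l = moment_line s"
  have l: "homogeneous 1 l"
    unfolding l_def by (rule homogeneous_moment_line)
  have l_pow: "homogeneous n (l ^ n)" for n
    using homogeneous_power[OF l, of n] by simp
  have fg_b: "poly_eval f (moment_b s) \<noteq> 0 \<or> poly_eval g (moment_b s) \<noteq> 0"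
  proof (rule ccontr)
    assume "\<not> ?thesis"
    moreover have nz: "moment_b s \<noteq> 0"
      by (auto simp: vec_eq_iff forall_3)
    ultimately have "vanishes_at f (pt (moment_b s))" "vanishes_at g (pt (moment_b s))"
      by (simp_all add: vanishes_at_pt[OF hom(1) nz] vanishes_at_pt[OF hom(2) nz])
    then have "\<not> vanishes_at (moment_line s) (pt (moment_b s))"
      by (rule s)
    then show False
      by (simp add: vanishes_at_pt[OF homogeneous_moment_line nz] poly_eval_moment_line)
  qed
  have cancel: "x \<in> I" if x: "homogeneous d x" "l * x \<in> I" for d x
  proof -
    have lx: "homogeneous (d + 1) (l * x)"
      using homogeneous_mult[OF l x(1)] by simp
    obtain u v where lx_eq: "l * x = u * f + v * g"
      using x(2) unfolding I by blast
    define k where "k = d + 1 - 3"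
    define u' where "u' = (if 3 \<le> d + 1 then hcomp k u else 0)"
    define v' where "v' = (if 3 \<le> d + 1 then hcomp k v else 0)"
    have "l * x = hcomp (d + 1) (l * x)"
      using hcomp_homogeneous[OF lx, of "d + 1"] by simp
    also have "\<dots> = u' * f + v' * g"
      unfolding lx_eq hcomp_add hcomp_mult_homogeneous[OF hom(1)] hcomp_mult_homogeneous[OF hom(2)] u'_def v'_def k_def
      by simp
    finally have uv: "homogeneous k u'" "homogeneous k v'" "moment_line s * x = u' * f + v' * g"
      by (simp_all add: u'_def v'_def l_def)
    from fg_b show ?thesis
    proof
      assume "poly_eval f (moment_b s) \<noteq> 0"
      then have "\<exists>u v. x = u * f + v * g"
        using moment_line_cancel_aux[OF hom _ _ uv] s by blast
      then show ?thesis
        unfolding I by blast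
    next
      assume b: "poly_eval g (moment_b s) \<noteq> 0"
      have "moment_line s * x = v' * g + u' * f"
        using uv(3) by (simp only: add.commute)
      then have "\<exists>v u. x = v * g + u * f"
        using moment_line_cancel_aux[OF hom(2,1) _ b uv(2,1)] s by blast
      then obtain u v where "x = u * f + v * g"
        by (metis add.commute)
      then show ?thesis
        unfolding I by blast
    qed
  qed
  have cancel_pow: "x \<in> I" if "homogeneous d x" "l ^ n * x \<in> I" for d n x
    using that
  proof (induction n)
    case (Suc n)
    have "homogeneous (n + d) (l ^ n * x)"
      by (rule homogeneous_mult[OF l_pow Suc.prems(1)])
    moreover have "l * (l ^ n * x) \<in> I"
      using Suc.prems(2) by (simp only: power_Suc mult.assoc)
    ultimately have "l ^ n * x \<in> I"
      by (rule cancel)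
    then show ?case
      using Suc.IH Suc.prems(1) by blast
  qed simp
  obtain h where h: "h \<in> ?J 7" "h \<notin> I"
  proof -
    have "poly3.dim (?J 7) = poly3.dim (I \<inter> forms 7) + 1"
      using dim_I(1)[of 7] dim_J[of 7] by simp
    then have "I \<inter> forms 7 \<noteq> ?J 7"
      by force
    then obtain x where "x \<in> ?J 7" "x \<notin> I \<inter> forms 7"
      using I_J[of 7] by blast
    then show thesis
      using that by blast
  qed
  have h7: "homogeneous 7 h"
    using h(1) by blast
  have lh: "l ^ n * h \<notin> I" for n
    using cancel_pow[OF h7] h(2) by blast
  have gen: "\<exists>c. x - Const c * (l ^ n * h) \<in> I" if x: "x \<in> ?J (n + 7)" for x n
  proof -
    have S: "poly3.subspace (I \<inter> forms (n + 7))"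
      by (rule dim_I(2)) simp
    have fin: "poly3.fin_dim (?J (n + 7))"
      by (rule fin_dim_subset_forms) blast
    have dim: "poly3.dim (?J (n + 7)) \<le> poly3.dim (I \<inter> forms (n + 7)) + 1"
      using dim_I(1)[of "n + 7"] dim_J[of "n + 7"] by simp
    have g: "l ^ n * h \<in> ?J (n + 7)" "l ^ n * h \<notin> I \<inter> forms (n + 7)"
      using J_mult[OF l_pow h(1)] lh by blast+
    obtain c where "x - poly_scale c (l ^ n * h) \<in> I \<inter> forms (n + 7)"
      by (rule poly3.codim_one_coset[OF S subspace_forms_vanishing fin I_J dim g x])
    then show ?thesis
      unfolding poly_scale_eq by blast
  qed
  have "\<exists>c. Var i * h - Const c * (l ^ 1 * h) \<in> I" for i
    using gen[of "Var i * h" 1] J_mult[OF homogeneous_Var(1) h(1)] by simp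
  then obtain w where w: "Var i * h - Const (w i) * (l ^ 1 * h) \<in> I" for i
    by metis
  define W :: "complex ^ 3" where "W = (\<chi> i. w i)"
  define K where "K e F \<longleftrightarrow> F * h - Const (poly_eval F W) * (l ^ e * h) \<in> I" for e F
  have K_mult: "K (a + b) (F * G)" if "K a F" "K b G" for a b F G
  proof -
    have "(F * G) * h - Const (poly_eval (F * G) W) * (l ^ (a + b) * h) =
        F * (G * h - Const (poly_eval G W) * (l ^ b * h)) +
        (Const (poly_eval G W) * l ^ b) * (F * h - Const (poly_eval F W) * (l ^ a * h))"
      unfolding poly_eval_simps Const_mult power_add by algebra
    then show ?thesis
      using that I_add I_mult unfolding K_def by metis
  qed
  have K_Const: "K 0 (Const c)" for c
    unfolding K_def using mult.subspace_0[OF I_sub] by simp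
  have K_Var: "K 1 (Var i)" for i
    unfolding K_def using w[of i] by (simp add: W_def)
  have K_pow: "K n (Var i ^ n)" for i n
  proof (induction n)
    case 0
    show ?case using K_Const[of 1] by simp
  next
    case (Suc n)
    then show ?case using K_mult[OF K_Var Suc, of i] by simp
  qed
  have K_sum: "K e (sum F A)" if "\<And>a. a \<in> A \<Longrightarrow> K e (F a)" for e A and F :: "(3 \<Rightarrow>\<^sub>0 nat) \<Rightarrow> poly3"
  proof -
    have Const_sum: "Const (sum b A) = (\<Sum>a\<in>A. Const (b a))" for b
      by (induction A rule: infinite_finite_induct) (simp_all add: Const_add)
    have "sum F A * h - Const (poly_eval (sum F A) W) * (l ^ e * h) =
        (\<Sum>a\<in>A. F a * h - Const (poly_eval (F a) W) * (l ^ e * h))"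
      by (simp only: poly_eval_simps Const_sum sum_distrib_right sum_subtractf)
    then show ?thesis
      unfolding K_def using that I_sum[of A "\<lambda>a. F a * h - Const (poly_eval (F a) W) * (l ^ e * h)"]
      unfolding K_def by simp
  qed
  have K: "K e F" if "homogeneous e F" for e F
  proof (subst poly_mapping_eq_sum_single[of F], rule K_sum)
    fix m assume "m \<in> keys F"
    then have "mdeg m = e"
      using that unfolding homogeneous_def by blast
    then have e: "e = 0 + (lookup m 1 + lookup m 2 + lookup m 3)"
      by (simp add: sum_3)
    show "K e (single m (lookup F m))"
      unfolding e by (subst single_eq_Const_mult_Var, subst prod_UNIV_3) (intro K_mult K_Const K_pow)
  qed
  have W0: "W \<noteq> 0"
  proof
    assume "W = 0"
    then have "poly_eval l W = 0"
      by (simp add: l_def poly_eval_moment_line)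
    then have "l ^ 1 * h \<in> I"
      using K[OF l] unfolding K_def by simp
    then show False
      using lh by blast
  qed
  have kill: "F * h \<in> I \<longleftrightarrow> vanishes_at F (pt W)" if F: "homogeneous e F" for e F
  proof
    assume "vanishes_at F (pt W)"
    then show "F * h \<in> I"
      using K[OF F] unfolding K_def by (simp add: vanishes_at_pt[OF F W0])
  next
    assume "F * h \<in> I"
    then have c: "Const (poly_eval F W) * (l ^ e * h) \<in> I"
      using K[OF F] I_diff[of "F * h" "F * h - Const (poly_eval F W) * (l ^ e * h)"] unfolding K_def by simp
    have "poly_eval F W = 0"
    proof (rule ccontr)
      assume nz: "poly_eval F W \<noteq> 0"
      have "Const (inverse (poly_eval F W)) * (Const (poly_eval F W) * (l ^ e * h)) \<in> I"
        using I_mult[OF c] .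
      then have "l ^ e * h \<in> I"
        using nz by (simp flip: mult.assoc Const_mult)
      then show False
        using lh by blast
    qed
    then show "vanishes_at F (pt W)"
      by (simp add: vanishes_at_pt[OF F W0])
  qed
  have prod: "F * G \<in> I" if F: "homogeneous e F" "vanishes_at F (pt W)" and G: "G \<in> ?J d" for e d F G
  proof -
    have Fh: "F * h \<in> I"
      using kill[OF F(1)] F(2) by blast
    have "l ^ 7 * G \<in> ?J (d + 7)"
      using J_mult[OF l_pow G, of 7] by (simp only: add.commute)
    then obtain c where c: "l ^ 7 * G - Const c * (l ^ d * h) \<in> I"
      using gen by blast
    have "l ^ 7 * (F * G) = F * (l ^ 7 * G - Const c * (l ^ d * h)) + (Const c * l ^ d) * (F * h)"
      by algebra
    then have "l ^ 7 * (F * G) \<in> I"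
      using I_add[OF I_mult[OF c] I_mult[OF Fh]] by metis
    moreover have "homogeneous (e + d) (F * G)"
      using homogeneous_mult F(1) G by blast
    ultimately show ?thesis
      using cancel_pow by blast
  qed
  have "ideal_quotient I J = vanishing_ideal {pt W}"
  proof (intro equalityI subsetI)
    fix F assume F: "F \<in> ideal_quotient I J"
    have "h \<in> J"
      unfolding J_def mem_vanishing_ideal_iff using h(1) by (auto simp: hcomp_homogeneous[OF h7])
    then have Fh: "F * h \<in> I"
      using F unfolding ideal_quotient_def by blast
    have "vanishes_at (hcomp e F) (pt W)" for e
    proof -
      have "hcomp (e + 7) (F * h) = hcomp e F * h"
        by (simp add: hcomp_mult_homogeneous[OF h7])
      then have "hcomp e F * h \<in> I"
        using I_hcomp[OF Fh] by metis
      then show ?thesis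
        using kill[OF homogeneous_hcomp] by blast
    qed
    then show "F \<in> vanishing_ideal {pt W}"
      unfolding mem_vanishing_ideal_iff by blast
  next
    fix F assume F: "F \<in> vanishing_ideal {pt W}"
    have "F * G \<in> I" if G: "G \<in> J" for G
    proof -
      have "hcomp e F * hcomp d G \<in> I" for e d
      proof (rule prod[OF homogeneous_hcomp])
        show "vanishes_at (hcomp e F) (pt W)"
          using F unfolding mem_vanishing_ideal_iff by blast
        show "hcomp d G \<in> ?J d"
          using G unfolding J_def mem_vanishing_ideal_iff by simp
      qed
      then have "(\<Sum>e\<in>mdeg ` keys F. \<Sum>d\<in>mdeg ` keys G. hcomp e F * hcomp d G) \<in> I"
        by (intro I_sum)
      then show ?thesis
        by (simp only: sum_hcomp flip: sum_product)
    qed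
    then show "F \<in> ideal_quotient I J"
      unfolding ideal_quotient_def by blast
  qed
  then have "residue p = reduced_point (pt W)"
    unfolding residue_def reduced_point_def Union_cubics_through I_def J_def by simp
  then show thesis
    by (rule that)
qed

end

subsection \<open>Discriminants of pencils of quadratics\<close>

lemma poly_eqI_infinite:
  fixes p q :: "complex poly"
  assumes "infinite S" "\<And>x. x \<in> S \<Longrightarrow> poly p x = poly q x"
  shows "p = q"
proof (rule ccontr)
  assume "p \<noteq> q"
  then have "finite {x. poly (p - q) x = 0}"
    by (intro poly_roots_finite) simp
  moreover have "S \<subseteq> {x. poly (p - q) x = 0}"
    using assms(2) by auto
  ultimately show False
    using assms(1) finite_subset by blast
qed

lemma wronskian_zero_degree:
  fixes p q :: "complex poly"
  assumes "p \<noteq> 0" "q \<noteq> 0" "p * pderiv q = pderiv p * q"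
  shows "degree p = degree q"
proof -
  have *: "coeff (a * pderiv b) (degree a + degree b - 1) = lead_coeff a * (of_nat (degree b) * lead_coeff b)"
    if "0 < degree a + degree b" for a b :: "complex poly"
  proof (cases "degree b")
    case 0
    then show ?thesis
      using pderiv_eq_0_iff[of b] by simp
  next
    case (Suc n)
    have "degree (pderiv b) \<le> n"
      by (simp add: degree_pderiv Suc)
    then have "coeff (a * pderiv b) (degree a + n) = lead_coeff a * coeff (pderiv b) n"
      by (intro coeff_mult_upper) auto
    then show ?thesis
      by (simp add: Suc coeff_pderiv)
  qed
  show ?thesis
  proof (cases "degree p + degree q = 0")
    case False
    then have "lead_coeff p * (of_nat (degree q) * lead_coeff q) = lead_coeff q * (of_nat (degree p) * lead_coeff p)"
      using *[of p q] *[of q p] assms(3) by (simp add: mult.commute[of q] add.commute)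
    then show ?thesis
      using assms(1,2) by simp
  qed simp
qed

lemma wronskian_zero:
  fixes p q :: "complex poly"
  assumes "p \<noteq> 0" "p * pderiv q = pderiv p * q"
  obtains c where "q = smult c p"
proof -
  define c where "c = coeff q (degree p) / lead_coeff p"
  define r where "r = q - smult c p"
  have "p * pderiv r = pderiv p * r"
    unfolding r_def pderiv_diff pderiv_smult right_diff_distrib assms(2) by (simp add: mult.commute)
  moreover have "coeff r (degree p) = 0"
    using assms(1) by (simp add: r_def c_def)
  ultimately have "r = 0"
    using wronskian_zero_degree[of p r] assms(1) by force
  then show thesis
    using that[of c] by (simp add: r_def)
qed

lemma double_root_dvd:
  fixes p :: "complex poly"
  assumes "poly p s = 0" "poly (pderiv p) s = 0"
  shows "[:- s, 1:]\<^sup>2 dvd p"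
proof -
  obtain q where q: "p = [:- s, 1:] * q"
    using assms(1) by (auto simp: poly_eq_0_iff_dvd)
  have "pderiv p = [:- s, 1:] * pderiv q + q"
    unfolding q pderiv_mult by (simp add: pderiv_pCons)
  then have "poly q s = 0"
    using assms(2) by simp
  then obtain r where r: "q = [:- s, 1:] * r"
    by (auto simp: poly_eq_0_iff_dvd)
  have "p = [:- s, 1:]\<^sup>2 * r"
    unfolding q r power2_eq_square by (simp only: mult.assoc)
  then show ?thesis
    by (metis dvd_triv_left)
qed

lemma finite_quadratic_roots:
  fixes a b c :: complex
  assumes "a \<noteq> 0 \<or> b \<noteq> 0 \<or> c \<noteq> 0"
  shows "finite {t. a * t\<^sup>2 + b * t + c = 0}"
proof -
  have "finite {t. poly [:c, b, a:] t = 0}"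
    by (rule poly_roots_finite) (use assms in auto)
  then show ?thesis
    by (simp add: power2_eq_square algebra_simps)
qed

lemma infinite_nonroot_parameters:
  fixes p :: "complex poly" and \<sigma> :: "complex \<Rightarrow> complex"
  assumes "p \<noteq> 0" "infinite (\<sigma> ` T)"
  shows "infinite {t \<in> T. poly p (\<sigma> t) \<noteq> 0}"
proof
  assume "finite {t \<in> T. poly p (\<sigma> t) \<noteq> 0}"
  moreover have "\<sigma> ` T \<subseteq> \<sigma> ` {t \<in> T. poly p (\<sigma> t) \<noteq> 0} \<union> {s. poly p s = 0}"
    by auto
  ultimately show False
    using assms(2) poly_roots_finite[OF assms(1)] finite_subset by blast
qed

text \<open>The algebraic form of Sard's theorem for the discriminant curve \<open>a t\<^sup>2 + b t + c = 0\<close>: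
  a branch of the curve on which the derivative in the direction of the base vanishes is horizontal.\<close>

lemma finite_critical_points:
  fixes a b c :: "complex poly" and \<sigma> :: "complex \<Rightarrow> complex"
  assumes E: "b\<^sup>2 - 4 * a * c \<noteq> 0"
    and zero: "\<And>t. t \<in> T \<Longrightarrow> poly a (\<sigma> t) * t\<^sup>2 + poly b (\<sigma> t) * t + poly c (\<sigma> t) = 0"
    and crit: "\<And>t. t \<in> T \<Longrightarrow> poly (pderiv a) (\<sigma> t) * t\<^sup>2 + poly (pderiv b) (\<sigma> t) * t + poly (pderiv c) (\<sigma> t) = 0"
  shows "finite (\<sigma> ` T)"
proof (rule ccontr)
  assume inf: "infinite (\<sigma> ` T)"
  define e where "e = b\<^sup>2 - 4 * a * c"
  define u where "u = a * pderiv b - pderiv a * b"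
  define w where "w = a * pderiv e - 2 * pderiv a * e"
  have e': "pderiv e = 2 * b * pderiv b - 4 * (pderiv a * c + a * pderiv c)"
    by (simp add: e_def power2_eq_square pderiv_diff pderiv_mult pderiv_smult pderiv_pCons numeral_poly smult_add_right algebra_simps)
  define \<tau> where "\<tau> t = 2 * poly a (\<sigma> t) * t + poly b (\<sigma> t)" for t
  have \<tau>_sq: "(\<tau> t)\<^sup>2 = poly e (\<sigma> t)" if "t \<in> T" for t
    using zero[OF that] unfolding \<tau>_def e_def by (simp add: numeral_poly) algebra
  have \<tau>_u: "2 * \<tau> t * poly u (\<sigma> t) = poly w (\<sigma> t)" if "t \<in> T" for t
  proof -
    have pe: "poly e s = (poly b s)\<^sup>2 - 4 * (poly a s * poly c s)" for s
      by (simp add: e_def numeral_poly)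
    have pe': "poly (pderiv e) s = 2 * poly b s * poly (pderiv b) s
        - 4 * (poly (pderiv a) s * poly c s + poly a s * poly (pderiv c) s)" for s
      by (simp add: e' numeral_poly)
    have "poly w (\<sigma> t) = poly a (\<sigma> t) * poly (pderiv e) (\<sigma> t) - 2 * poly (pderiv a) (\<sigma> t) * poly e (\<sigma> t)"
      by (simp add: w_def numeral_poly)
    moreover have "poly u (\<sigma> t) = poly a (\<sigma> t) * poly (pderiv b) (\<sigma> t) - poly (pderiv a) (\<sigma> t) * poly b (\<sigma> t)"
      by (simp add: u_def)
    ultimately show ?thesis
      using zero[OF that] crit[OF that] unfolding \<tau>_def pe pe' by algebra
  qed
  have "4 * e * u\<^sup>2 = w\<^sup>2"
  proof (rule poly_eqI_infinite[OF inf])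
    fix s assume "s \<in> \<sigma> ` T"
    then obtain t where t: "t \<in> T" "s = \<sigma> t"
      by blast
    have "poly (4 * e * u\<^sup>2) s = 4 * poly e s * (poly u s)\<^sup>2"
      by (simp add: numeral_poly)
    also have "\<dots> = (2 * \<tau> t * poly u s)\<^sup>2"
      using \<tau>_sq[OF t(1)] t(2) by (simp add: power_mult_distrib)
    also have "\<dots> = poly (w\<^sup>2) s"
      using \<tau>_u[OF t(1)] t(2) by simp
    finally show "poly (4 * e * u\<^sup>2) s = poly (w\<^sup>2) s" .
  qed
  note euw = this
  show False
  proof (cases "a = 0")
    case True
    have "b \<noteq> 0"
      using E True by auto
    have "b * pderiv c = pderiv b * c"
    proof (rule poly_eqI_infinite[OF inf])
      fix s assume "s \<in> \<sigma> ` T"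
      then obtain t where t: "t \<in> T" "s = \<sigma> t"
        by blast
      have "poly b s * t + poly c s = 0" "poly (pderiv b) s * t + poly (pderiv c) s = 0"
        using zero[OF t(1)] crit[OF t(1)] True t(2) by simp_all
      then show "poly (b * pderiv c) s = poly (pderiv b * c) s"
        unfolding poly_mult by algebra
    qed
    then obtain k where k: "c = smult k b"
      using wronskian_zero[OF \<open>b \<noteq> 0\<close>] by blast
    have "{t \<in> T. poly b (\<sigma> t) \<noteq> 0} \<subseteq> {- k}"
    proof
      fix t assume t: "t \<in> {t \<in> T. poly b (\<sigma> t) \<noteq> 0}"
      then have "poly b (\<sigma> t) * (t + k) = 0"
        using zero[of t] True k by (simp add: algebra_simps)
      then show "t \<in> {- k}"
        using t by (simp add: eq_neg_iff_add_eq_0)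
    qed
    then show False
      using infinite_nonroot_parameters[OF \<open>b \<noteq> 0\<close> inf] finite_subset by blast
  next
    case a: False
    show False
    proof (cases "u = 0")
      case True
      then obtain k where k: "b = smult k a"
        using wronskian_zero[OF a, of b] by (auto simp: u_def)
      have "w = 0"
        using euw True by simp
      then have "a\<^sup>2 * pderiv e = pderiv (a\<^sup>2) * e"
        by (simp add: w_def power2_eq_square pderiv_mult algebra_simps)
      then obtain j where j: "e = smult j (a\<^sup>2)"
        using wronskian_zero[of "a\<^sup>2" e] a by auto
      have "{t \<in> T. poly a (\<sigma> t) \<noteq> 0} \<subseteq> {t. 4 * t\<^sup>2 + (4 * k) * t + (k\<^sup>2 - j) = 0}"
      proof
        fix t assume t: "t \<in> {t \<in> T. poly a (\<sigma> t) \<noteq> 0}"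
        have "(\<tau> t)\<^sup>2 = poly e (\<sigma> t)"
          using t \<tau>_sq by blast
        then have "(2 * poly a (\<sigma> t) * t + k * poly a (\<sigma> t))\<^sup>2 = j * (poly a (\<sigma> t))\<^sup>2"
          unfolding \<tau>_def by (simp add: k j)
        then have "(poly a (\<sigma> t))\<^sup>2 * (4 * t\<^sup>2 + (4 * k) * t + (k\<^sup>2 - j)) = 0"
          by algebra
        then show "t \<in> {t. 4 * t\<^sup>2 + (4 * k) * t + (k\<^sup>2 - j) = 0}"
          using t by simp
      qed
      moreover have "finite {t. 4 * t\<^sup>2 + (4 * k) * t + (k\<^sup>2 - j) = 0}"
        by (rule finite_quadratic_roots) simp
      ultimately show False
        using infinite_nonroot_parameters[OF a inf] finite_subset by blast
    next
      case u: False
      have "u\<^sup>2 dvd w\<^sup>2"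
        using euw by (metis dvd_triv_right)
      then have "u dvd w"
        by (simp add: pow_divides_pow_iff)
      then obtain v where v: "w = u * v"
        by blast
      have "u\<^sup>2 * (4 * e) = u\<^sup>2 * v\<^sup>2"
        using euw by (simp add: v power_mult_distrib mult.commute)
      then have ev: "4 * e = v\<^sup>2"
        using u by simp
      have T: "\<sigma> ` T = \<sigma> ` {t \<in> T. 2 * \<tau> t = poly v (\<sigma> t)} \<union> \<sigma> ` {t \<in> T. 2 * \<tau> t = - poly v (\<sigma> t)}"
      proof -
        have "2 * \<tau> t = poly v (\<sigma> t) \<or> 2 * \<tau> t = - poly v (\<sigma> t)" if "t \<in> T" for t
        proof -
          have "(2 * \<tau> t)\<^sup>2 = (poly v (\<sigma> t))\<^sup>2"
            using \<tau>_sq[OF that] arg_cong[OF ev, of "\<lambda>p. poly p (\<sigma> t)"] by (simp add: power_mult_distrib numeral_poly)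
          then show ?thesis
            by (simp only: power2_eq_iff)
        qed
        then show ?thesis
          by blast
      qed
      have main: False if vv: "4 * e = v\<^sup>2" and inf: "infinite (\<sigma> ` {t \<in> T. 2 * \<tau> t = poly v (\<sigma> t)})" for v
      proof -
        have "v \<noteq> 0"
          using vv E by (auto simp: e_def)
        have "u * v = w"
        proof (rule poly_eqI_infinite[OF inf])
          fix s assume "s \<in> \<sigma> ` {t \<in> T. 2 * \<tau> t = poly v (\<sigma> t)}"
          then obtain t where t: "t \<in> T" "s = \<sigma> t" "2 * \<tau> t = poly v (\<sigma> t)"
            by blast
          then show "poly (u * v) s = poly w s"
            using \<tau>_u[OF t(1)] by (simp add: mult.commute)
        qed
        moreover have "4 * pderiv e = 2 * v * pderiv v"
        proof -
          have "4 * pderiv e = pderiv (4 * e)"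
            by (simp add: numeral_poly pderiv_smult)
          also have "\<dots> = v * pderiv v + pderiv v * v"
            unfolding vv power2_eq_square pderiv_mult by (simp only: mult.commute add.commute)
          finally show ?thesis
            by algebra
        qed
        ultimately have "2 * v * (2 * u - (a * pderiv v - pderiv a * v)) = 0"
          using vv unfolding w_def by algebra
        then have uv: "2 * u = a * pderiv v - pderiv a * v"
          using \<open>v \<noteq> 0\<close> by simp
        have "pderiv (2 * b - v) = 2 * pderiv b - pderiv v"
          by (simp add: pderiv_diff numeral_poly pderiv_smult)
        then have "a * pderiv (2 * b - v) = pderiv a * (2 * b - v)"
          using uv unfolding u_def by algebra
        then obtain k where k: "2 * b - v = smult k a"
          using wronskian_zero[OF a] by blast
        have "{t \<in> {t \<in> T. 2 * \<tau> t = poly v (\<sigma> t)}. poly a (\<sigma> t) \<noteq> 0} \<subseteq> {- k / 4}"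
        proof
          fix t assume t: "t \<in> {t \<in> {t \<in> T. 2 * \<tau> t = poly v (\<sigma> t)}. poly a (\<sigma> t) \<noteq> 0}"
          have "2 * poly b (\<sigma> t) - poly v (\<sigma> t) = k * poly a (\<sigma> t)"
            using arg_cong[OF k, of "\<lambda>p. poly p (\<sigma> t)"] by (simp add: numeral_poly)
          moreover have "2 * (2 * poly a (\<sigma> t) * t + poly b (\<sigma> t)) = poly v (\<sigma> t)"
            using t unfolding \<tau>_def by blast
          ultimately have "poly a (\<sigma> t) * (4 * t + k) = 0"
            by algebra
          then have "4 * t + k = 0"
            using t by simp
          then have "t * 4 = - k"
            by (simp add: add_eq_0_iff2 mult.commute)
          then have "t = - k / 4"
            by (rule eq_divide_imp[rotated]) simp
          then show "t \<in> {- k / 4}"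
            by simp
        qed
        then show False
          using infinite_nonroot_parameters[OF a inf] finite_subset by blast
      qed
      show False
        using inf T main[OF ev] main[of "- v"] ev by (auto simp: T)
    qed
  qed
qed

lemma infinite_critical_parameters:
  fixes a b c :: "complex poly" and \<sigma> :: "complex \<Rightarrow> complex"
  assumes E: "b\<^sup>2 - 4 * a * c \<noteq> 0" and T: "infinite T"
    and zero: "\<And>t. t \<in> T \<Longrightarrow> poly a (\<sigma> t) * t\<^sup>2 + poly b (\<sigma> t) * t + poly c (\<sigma> t) = 0"
    and crit: "\<And>t. t \<in> T \<Longrightarrow> poly (pderiv a) (\<sigma> t) * t\<^sup>2 + poly (pderiv b) (\<sigma> t) * t + poly (pderiv c) (\<sigma> t) = 0"
  obtains s where "[:- s, 1:] ^ 4 dvd b\<^sup>2 - 4 * a * c"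
proof -
  have "finite (\<sigma> ` T)"
    by (rule finite_critical_points[OF E zero crit])
  then obtain t0 where t0: "t0 \<in> T" "infinite {t \<in> T. \<sigma> t = \<sigma> t0}"
    using pigeonhole_infinite[OF T] by blast
  let ?s = "\<sigma> t0" and ?F = "{t \<in> T. \<sigma> t = \<sigma> t0}"
  have vanish: "x = 0 \<and> y = 0 \<and> z = 0" if "\<And>t. t \<in> ?F \<Longrightarrow> x * t\<^sup>2 + y * t + z = 0" for x y z
  proof (rule ccontr)
    assume "\<not> (x = 0 \<and> y = 0 \<and> z = 0)"
    then have "finite {t. x * t\<^sup>2 + y * t + z = 0}"
      by (intro finite_quadratic_roots) blast
    moreover have "?F \<subseteq> {t. x * t\<^sup>2 + y * t + z = 0}"
      using that by blast
    ultimately show False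
      using t0(2) finite_subset by blast
  qed
  have v: "poly a ?s = 0 \<and> poly b ?s = 0 \<and> poly c ?s = 0"
    by (rule vanish) (use zero in force)
  have d: "poly (pderiv a) ?s = 0 \<and> poly (pderiv b) ?s = 0 \<and> poly (pderiv c) ?s = 0"
    by (rule vanish) (use crit in force)
  have dvd: "[:- ?s, 1:]\<^sup>2 dvd a" "[:- ?s, 1:]\<^sup>2 dvd b" "[:- ?s, 1:]\<^sup>2 dvd c"
    using v d by (auto intro: double_root_dvd)
  have "[:- ?s, 1:] ^ 4 = [:- ?s, 1:]\<^sup>2 * [:- ?s, 1:]\<^sup>2"
    by (simp flip: power_add)
  then have "[:- ?s, 1:] ^ 4 dvd b\<^sup>2 - 4 * a * c"
    using mult_dvd_mono[OF dvd(2,2)] mult_dvd_mono[OF dvd(1,3)]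
    by (metis dvd_diff dvd_mult mult.assoc power2_eq_square)
  then show thesis
    by (rule that)
qed

text \<open>The bracket on the right is the resultant of \<open>l0 z\<^sup>2 + q0 z + c0\<close> and \<open>l1 z\<^sup>2 + q1 z + c1\<close>.\<close>

lemma discriminant_discriminant:
  fixes l0 q0 c0 l1 q1 c1 :: "'a::comm_ring_1"
  shows "(2 * q0 * q1 - 4 * (l0 * c1 + l1 * c0))\<^sup>2 - 4 * (q1\<^sup>2 - 4 * l1 * c1) * (q0\<^sup>2 - 4 * l0 * c0) =
    16 * ((l0 * c1 - l1 * c0)\<^sup>2 - (l0 * q1 - l1 * q0) * (q0 * c1 - q1 * c0))"
  by (simp add: power2_eq_square algebra_simps)

lemma common_root_of_resultant_aux:
  fixes l0 q0 c0 l1 q1 c1 :: complex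
  assumes "(l0 * c1 - l1 * c0)\<^sup>2 = (l0 * q1 - l1 * q0) * (q0 * c1 - q1 * c0)" "l0 \<noteq> 0"
  shows "\<exists>z. l0 * z\<^sup>2 + q0 * z + c0 = 0 \<and> l1 * z\<^sup>2 + q1 * z + c1 = 0"
proof (cases "l0 * q1 - l1 * q0 = 0")
  case True
  then have *: "l0 * c1 - l1 * c0 = 0"
    using assms(1) by simp
  have "\<exists>z. poly [:c0, q0, l0:] z = 0"
    by (intro fundamental_theorem_of_algebra) (simp add: constant_degree assms(2))
  then obtain z where z: "l0 * z\<^sup>2 + q0 * z + c0 = 0"
    by (auto simp: power2_eq_square algebra_simps)
  then have "l0 * (l1 * z\<^sup>2 + q1 * z + c1) = 0"
    using True * by algebra
  then show ?thesis
    using z assms(2) by auto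
next
  case False
  define z where "z = - (l0 * c1 - l1 * c0) / (l0 * q1 - l1 * q0)"
  have z: "(l0 * q1 - l1 * q0) * z = - (l0 * c1 - l1 * c0)"
    using False by (simp add: z_def)
  have "(l0 * q1 - l1 * q0)\<^sup>2 * (l0 * z\<^sup>2 + q0 * z + c0) = 0"
    using z assms(1) by algebra
  then have z0: "l0 * z\<^sup>2 + q0 * z + c0 = 0"
    using False by simp
  then have "l0 * (l1 * z\<^sup>2 + q1 * z + c1) = 0"
    using z by algebra
  then show ?thesis
    using z0 assms(2) by auto
qed

lemma poly_orders_le_degree:
  fixes p :: "complex poly"
  assumes "finite S" "p \<noteq> 0" "\<And>s. s \<in> S \<Longrightarrow> [:- s, 1:] ^ k s dvd p"
  shows "(\<Sum>s\<in>S. k s) \<le> degree p"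
proof -
  have "(\<Sum>s\<in>S. k s) \<le> (\<Sum>s\<in>S. count (proots p) s)"
    using assms(2,3) by (intro sum_mono) (simp add: order_divides)
  also have "\<dots> = (\<Sum>s\<in>S \<inter> set_mset (proots p). count (proots p) s)"
    using assms(1) by (intro sum.mono_neutral_right) (auto simp: not_in_iff)
  also have "\<dots> \<le> size (proots p)"
    unfolding size_multiset_overloaded_eq by (intro sum_mono2) auto
  also have "\<dots> \<le> degree p"
    by (rule size_proots_le)
  finally show ?thesis .
qed

subsection \<open>Directional derivatives\<close>

definition ddir :: "complex ^ 3 \<Rightarrow> complex ^ 3 \<Rightarrow> poly3 \<Rightarrow> complex"
  where "ddir v w f = (\<Sum>i\<in>UNIV. w $ i * poly_eval (partial_deriv i f) v)"

lemma poly_pderiv_line_poly: "poly (pderiv (line_poly u w f)) t = ddir (u + t *s w) w f"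
  by (simp add: pderiv_line_poly poly_sum poly_line_poly ddir_def)

lemma ddir_eq_coeff: "ddir v w f = coeff (line_poly v w f) 1"
proof -
  have "ddir v w f = poly (pderiv (line_poly v w f)) 0"
    by (simp add: poly_pderiv_line_poly)
  then show ?thesis
    by (simp add: poly_0_coeff_0 coeff_pderiv)
qed

lemma ddir_add_left: "ddir v (u + w) f = ddir v u f + ddir v w f"
  by (simp add: ddir_def distrib_right sum.distrib)

lemma ddir_scale_left: "ddir v (c *s w) f = c * ddir v w f"
  by (simp add: ddir_def sum_distrib_left mult.assoc)

lemma line_poly_scale: "line_poly u w (poly_scale c f) = smult c (line_poly u w f)"
  by (simp add: poly_scale_eq)

lemma ddir_pencil: "ddir v w (g + poly_scale t f) = ddir v w g + t * ddir v w f"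
  by (simp add: ddir_eq_coeff line_poly_scale)

lemma coeff_line_poly_swap:
  assumes f: "homogeneous d f" and "k \<le> d"
  shows "coeff (line_poly u w f) k = coeff (line_poly w u f) (d - k)"
proof -
  let ?p = "line_poly u w f" and ?q = "line_poly w u f"
  define r where "r = (\<Sum>j\<le>d. monom (coeff ?q j) (d - j))"
  have inf: "infinite (- {0 :: complex})"
    using infinite_UNIV_char_0 by (simp add: Compl_eq_Diff_UNIV)
  have "?p = r"
  proof (rule poly_eqI_infinite[OF inf])
    fix t :: complex assume "t \<in> - {0}"
    then have t: "t \<noteq> 0"
      by simp
    have e: "u + t *s w = t *s (w + inverse t *s u)"
      using t by (simp add: vec_eq_iff algebra_simps)
    have "poly ?p t = t ^ d * poly ?q (inverse t)"
      unfolding poly_line_poly e poly_eval_homogeneous[OF f] ..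
    also have "poly ?q (inverse t) = (\<Sum>j\<le>d. coeff ?q j * inverse t ^ j)"
      unfolding poly_altdef using line_poly_homogeneous(1)[OF f, of w u]
      by (intro sum.mono_neutral_left) (auto simp: coeff_eq_0)
    also have "t ^ d * \<dots> = (\<Sum>j\<le>d. coeff ?q j * t ^ (d - j))"
      unfolding sum_distrib_left using t
      by (intro sum.cong) (auto simp: power_diff power_inverse field_simps)
    finally show "poly ?p t = poly r t"
      by (simp add: r_def poly_sum poly_monom)
  qed
  then have "coeff ?p k = (\<Sum>j\<le>d. if d - j = k then coeff ?q j else 0)"
    by (simp add: r_def coeff_sum)
  also have "\<dots> = (\<Sum>j\<le>d. if j = d - k then coeff ?q j else 0)"
    using assms(2) by (intro sum.cong) auto
  finally show ?thesis
    using assms(2) by simp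
qed

lemma ddir_Euler_zero:
  assumes "homogeneous d f" "poly_eval f v = 0"
  shows "ddir v v f = 0"
proof -
  have "poly (line_poly v v f) t = poly 0 t" for t
  proof -
    have e: "v + t *s v = (1 + t) *s v"
      by (simp add: vec_eq_iff algebra_simps)
    show ?thesis
      unfolding poly_line_poly e poly_eval_homogeneous[OF assms(1)] using assms(2) by simp
  qed
  then have "line_poly v v f = 0"
    using poly_eqI_infinite[OF infinite_UNIV_char_0] by blast
  then show ?thesis
    by (simp add: ddir_eq_coeff)
qed

subsection \<open>Projection of a cubic from one of its points\<close>

interpretation plane: const_hom "\<lambda>c. [:[:c:]:]"
  by unfold_locales (simp_all add: one_pCons)

definition plane_poly :: "complex ^ 3 \<Rightarrow> complex ^ 3 \<Rightarrow> complex ^ 3 \<Rightarrow> poly3 \<Rightarrow> complex poly poly"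
  where "plane_poly a b e = ring_eval (\<lambda>c. [:[:c:]:]) (\<lambda>i. [:[:a $ i, b $ i:], [:e $ i:]:])"

lemma plane_poly_simps:
  "plane_poly a b e (Const c) = [:[:c:]:]" "plane_poly a b e (Var i) = [:[:a $ i, b $ i:], [:e $ i:]:]"
  "plane_poly a b e (f + g) = plane_poly a b e f + plane_poly a b e g"
  "plane_poly a b e (f * g) = plane_poly a b e f * plane_poly a b e g"
  unfolding plane_poly_def
  by (rule plane.ring_eval_Const plane.ring_eval_Var plane.ring_eval_simps)+

lemma poly_coeff_plane_poly: "poly (coeff (plane_poly a b e f) k) s = coeff (line_poly (a + s *s b) e f) k"
proof (induction f arbitrary: k rule: poly3_induct)
  case (const c)
  show ?case
    by (cases k) (simp_all add: plane_poly_simps)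
next
  case (var i)
  show ?case
    by (cases k) (auto simp: plane_poly_simps coeff_pCons split: nat.split)
next
  case (add f g)
  then show ?case
    by (simp add: plane_poly_simps)
next
  case (mult f g)
  then show ?case
    by (simp add: plane_poly_simps coeff_mult poly_sum)
qed

definition bidegree_le :: "nat \<Rightarrow> complex poly poly \<Rightarrow> bool"
  where "bidegree_le d p \<longleftrightarrow> (\<forall>k. (d < k \<longrightarrow> coeff p k = 0) \<and> degree (coeff p k) \<le> d - k)"

lemma bidegree_le_add: "bidegree_le d p \<Longrightarrow> bidegree_le d q \<Longrightarrow> bidegree_le d (p + q)"
  unfolding bidegree_le_def by (auto intro: degree_add_le)

lemma bidegree_le_mult:
  assumes "bidegree_le m p" "bidegree_le n q"
  shows "bidegree_le (m + n) (p * q)"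
  unfolding bidegree_le_def
proof (intro allI conjI impI)
  fix k
  have z: "coeff p i = 0 \<or> coeff q (k - i) = 0" if "m < i \<or> n < k - i" for i
    using that assms unfolding bidegree_le_def by blast
  show "coeff (p * q) k = 0" if "m + n < k"
    unfolding coeff_mult
  proof (rule sum.neutral, rule ballI)
    fix i assume "i \<in> {..k}"
    have "m < i \<or> n < k - i"
      using that by linarith
    then show "coeff p i * coeff q (k - i) = 0"
      using z[of i] by auto
  qed
  show "degree (coeff (p * q) k) \<le> m + n - k"
    unfolding coeff_mult
  proof (rule degree_sum_le)
    fix i assume i: "i \<in> {..k}"
    show "degree (coeff p i * coeff q (k - i)) \<le> m + n - k"
    proof (cases "m < i \<or> n < k - i")
      case True
      then show ?thesis
        using z[of i] by auto
    next
      case False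
      have "degree (coeff p i) \<le> m - i" "degree (coeff q (k - i)) \<le> n - (k - i)"
        using assms unfolding bidegree_le_def by blast+
      then show ?thesis
        using degree_mult_le[of "coeff p i" "coeff q (k - i)"] False i by (simp only: atMost_iff) linarith
    qed
  qed simp
qed

lemma bidegree_le_const: "bidegree_le 0 [:[:c:]:]"
  by (auto simp: bidegree_le_def coeff_pCons split: nat.split)

lemma bidegree_le_power:
  assumes "bidegree_le 1 p"
  shows "bidegree_le n (p ^ n)"
proof (induction n)
  case 0
  show ?case
    using bidegree_le_const[of 1] by (simp add: one_pCons)
next
  case (Suc n)
  then show ?case
    using bidegree_le_mult[OF assms Suc] by simp
qed

lemma bidegree_le_plane_poly:
  assumes "homogeneous d f"
  shows "bidegree_le d (plane_poly a b e f)"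
proof -
  let ?x = "\<lambda>i. [:[:a $ i, b $ i:], [:e $ i:]:]"
  have x: "bidegree_le 1 (?x i)" for i
    by (auto simp: bidegree_le_def coeff_pCons split: nat.split)
  have *: "bidegree_le d (\<Sum>m\<in>M. [:[:lookup f m:]:] * (\<Prod>i\<in>UNIV. ?x i ^ lookup m i))"
    if "finite M" "\<And>m. m \<in> M \<Longrightarrow> mdeg m = d" for M
    using that
  proof (induction M)
    case empty
    show ?case by (simp add: bidegree_le_def)
  next
    case (insert m M)
    have IH: "bidegree_le d (\<Sum>m\<in>M. [:[:lookup f m:]:] * (\<Prod>i\<in>UNIV. ?x i ^ lookup m i))"
      by (rule insert.IH) (rule insert.prems, rule insertI2)
    have "bidegree_le (0 + (lookup m 1 + lookup m 2 + lookup m 3))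
        ([:[:lookup f m:]:] * (\<Prod>i\<in>UNIV. ?x i ^ lookup m i))"
      unfolding prod_UNIV_3 by (intro bidegree_le_mult bidegree_le_const bidegree_le_power x)
    then have "bidegree_le d ([:[:lookup f m:]:] * (\<Prod>i\<in>UNIV. ?x i ^ lookup m i))"
      using insert.prems[OF insertI1] unfolding sum_3 add_0 by (simp only:)
    then show ?case
      unfolding sum.insert[OF insert.hyps] using IH by (rule bidegree_le_add)
  qed
  show ?thesis
    unfolding plane_poly_def ring_eval_def
  proof (rule *)
    fix m assume "m \<in> keys f"
    then show "mdeg m = d"
      using assms unfolding homogeneous_def by (rule bspec[rotated])
  qed (rule finite_keys)
qed

lemma cubic_on_line:
  assumes "homogeneous 3 f" "poly_eval f e = 0"
  shows "line_poly u e f = [:coeff (line_poly u e f) 0, coeff (line_poly u e f) 1, coeff (line_poly u e f) 2:]"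
proof -
  have d: "degree (line_poly u e f) \<le> 3" "coeff (line_poly u e f) 3 = 0"
    using line_poly_homogeneous[OF assms(1)] assms(2) by auto
  have "coeff (line_poly u e f) k = 0" if "2 < k" for k
  proof (cases "k = 3")
    case False
    then show ?thesis
      using that d(1) by (intro coeff_eq_0) linarith
  qed (use d in simp)
  then show ?thesis
    by (intro poly_eqI) (auto simp: coeff_pCons numeral_2_eq_2 split: nat.split)
qed

lemma poly_eval_cubic_on_line:
  assumes "homogeneous 3 f" "poly_eval f e = 0"
  shows "poly_eval f (u + z *s e) = coeff (line_poly u e f) 2 * z\<^sup>2 + coeff (line_poly u e f) 1 * z + coeff (line_poly u e f) 0"
proof -
  have "poly_eval f (u + z *s e) = poly [:coeff (line_poly u e f) 0, coeff (line_poly u e f) 1, coeff (line_poly u e f) 2:] z"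
    using poly_line_poly[of u e f z] cubic_on_line[OF assms, of u] by simp
  then show ?thesis
    by (simp add: power2_eq_square algebra_simps)
qed

definition singular_vec :: "poly3 \<Rightarrow> complex ^ 3 \<Rightarrow> bool"
  where "singular_vec f v \<longleftrightarrow> poly_eval f v = 0 \<and> (\<forall>i. poly_eval (partial_deriv i f) v = 0)"

lemma singular_vec_ddir: "singular_vec f v \<Longrightarrow> ddir v w f = 0"
  by (simp add: singular_vec_def ddir_def)

lemma singular_vec_of_singular_at: "singular_at f r \<Longrightarrow> singular_vec f (c *s rep r)"
  by (auto simp: singular_at_def singular_vec_def vanishes_at_def rep(2) vec_span_singleton)

lemma singular_cubic_on_line:
  assumes "homogeneous 3 f" "poly_eval f e = 0" "singular_vec f (u + z *s e)"
  defines "l \<equiv> coeff (line_poly u e f) 2" and "q \<equiv> coeff (line_poly u e f) 1" and "c \<equiv> coeff (line_poly u e f) 0"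
  shows "l * z\<^sup>2 + q * z + c = 0" "2 * l * z + q = 0" "q\<^sup>2 - 4 * l * c = 0"
proof -
  show 1: "l * z\<^sup>2 + q * z + c = 0"
    using poly_eval_cubic_on_line[OF assms(1,2), of u z] assms(3) by (simp add: l_def q_def c_def singular_vec_def)
  have "poly (pderiv (line_poly u e f)) z = 0"
    using singular_vec_ddir[OF assms(3)] by (simp add: poly_pderiv_line_poly)
  moreover have "line_poly u e f = [:c, q, l:]"
    using cubic_on_line[OF assms(1,2), of u] by (simp add: l_def q_def c_def)
  ultimately show 2: "2 * l * z + q = 0"
    by (simp add: pderiv_pCons algebra_simps)
  show "q\<^sup>2 - 4 * l * c = 0"
    using 1 2 by algebra
qed

lemma finite_base_directions:
  assumes f: "irreducible f" "homogeneous 3 f" and g: "homogeneous 3 g" "\<not> f dvd g" and basis: "is_basis a b e"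
  shows "finite {s. \<exists>z. poly_eval f (a + s *s b + z *s e) = 0 \<and> poly_eval g (a + s *s b + z *s e) = 0}" (is "finite ?S")
proof (rule ccontr)
  assume inf: "infinite ?S"
  have "\<forall>s\<in>?S. \<exists>z. poly_eval f (a + s *s b + z *s e) = 0 \<and> poly_eval g (a + s *s b + z *s e) = 0"
    by blast
  from bchoice[OF this] obtain z where
    z: "\<forall>s\<in>?S. poly_eval f (a + s *s b + z s *s e) = 0 \<and> poly_eval g (a + s *s b + z s *s e) = 0" ..
  let ?r = "\<lambda>s. pt (a + s *s b + z s *s e)"
  note nz = is_basis_pencil_nonzero[OF basis]
  have "inj_on ?r ?S"
  proof (rule inj_onI)
    fix s t assume "?r s = ?r t"
    then obtain k where "a + s *s b + z s *s e = k *s (a + t *s b + z t *s e)"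
      using pt_eqD nz by metis
    then show "s = t"
      by (rule is_basis_pencil_inj(2)[OF basis])
  qed
  then have "infinite (?r ` ?S)"
    using inf finite_imageD by blast
  moreover have "vanishes_at f q \<and> vanishes_at g q" if "q \<in> ?r ` ?S" for q
  proof -
    obtain s where "s \<in> ?S" "q = ?r s"
      using \<open>q \<in> ?r ` ?S\<close> by blast
    then show ?thesis
      using bspec[OF z \<open>s \<in> ?S\<close>] by (simp add: vanishes_at_pt[OF f(2) nz] vanishes_at_pt[OF g(1) nz])
  qed
  ultimately have "f dvd g"
    using bezout_dvd[OF f g(1)] by blast
  then show False
    using g(2) by blast
qed

lemma (in eight_points) ex_nonsingular_point:
  assumes "f \<in> V" "irreducible f"
  obtains i w where "ddir (rep (p i)) w f \<noteq> 0"
proof (rule ccontr)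
  assume nt: "\<not> thesis"
  have d: "ddir (rep (p i)) w f = 0" for i w
    using nt that by blast
  have f: "homogeneous 3 f" "poly_eval f (rep (p i)) = 0" for i
    using assms(1) by (auto simp: V_def vanishes_at_imp_eval)
  let ?u = "rep (p 0)" and ?w = "rep (p 1)"
  have "p 0 \<noteq> p 1"
    using inj by (simp add: inj_eq)
  have uw: "?u \<noteq> c *s ?w" for c
    using rep_eq_smult_imp_eq \<open>p 0 \<noteq> p 1\<close> by blast
  have "coeff (line_poly ?u ?w f) 1 = 0" "coeff (line_poly ?w ?u f) 1 = 0"
    using d unfolding ddir_eq_coeff by blast+
  moreover have "coeff (line_poly ?u ?w f) 2 = coeff (line_poly ?w ?u f) 1"
    using coeff_line_poly_swap[OF f(1), of 2 ?u ?w] by simp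
  moreover have "coeff (line_poly ?u ?w f) 0 = 0"
    using poly_line_poly[of ?u ?w f 0] f(2)[of 0] by (simp add: poly_0_coeff_0)
  ultimately have "line_poly ?u ?w f = 0"
    using cubic_on_line[OF f(1,2), of ?u 1] by simp
  then have on_line: "poly_eval f (?u + t *s ?w) = 0" for t
    using poly_line_poly[of ?u ?w f t] by simp
  obtain l where l: "homogeneous 1 l" "l \<noteq> 0" "vanishes_at l (p 0)" "vanishes_at l (p 1)"
    by (rule line_through)
  have nz: "?u + t *s ?w \<noteq> 0" for t
  proof
    assume "?u + t *s ?w = 0"
    then have "?u = (- t) *s ?w"
      by (simp add: add_eq_0_iff2)
    then show False
      using uw by blast
  qed
  let ?r = "\<lambda>t. pt (?u + t *s ?w)"
  have "inj ?r"
  proof (rule injI)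
    fix s t assume "?r s = ?r t"
    then obtain k where k: "?u + s *s ?w = k *s (?u + t *s ?w)"
      using pt_eqD nz by metis
    then have e: "(1 - k) *s ?u = (k * t - s) *s ?w"
      by (simp add: vec_eq_iff algebra_simps)
    have "k = 1"
    proof (rule ccontr)
      assume "k \<noteq> 1"
      then have "inverse (1 - k) * (1 - k) = 1"
        by (intro left_inverse) simp
      then have "?u = (inverse (1 - k)) *s ((1 - k) *s ?u)"
        by (simp only: vector_smult_assoc vector_smult_lid)
      then have "?u = (inverse (1 - k) * (k * t - s)) *s ?w"
        by (simp only: e vector_smult_assoc)
      then show False
        using uw by blast
    qed
    then have "(t - s) *s ?w = 0"
      using e by simp
    then show "s = t"
      using rep(1)[of "p 1"] by (auto simp: vec_eq_iff)
  qed
  then have inf: "infinite (range ?r)"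
    using infinite_UNIV_char_0 finite_imageD by blast
  have "l dvd f"
  proof (rule bezout_dvd[OF irreducible_linear[OF l(1,2)] l(1) f(1)])
    fix q assume "q \<in> range ?r"
    then obtain t where "q = ?r t"
      by blast
    then show "vanishes_at l q \<and> vanishes_at f q"
      using on_line l(3,4)
      by (simp add: vanishes_at_pt[OF l(1) nz] vanishes_at_pt[OF f(1) nz] poly_eval_linear[OF l(1)] vanishes_at_imp_eval)
  qed (use inf in blast)
  then show False
    using irreducible_homogeneous_not_dvd[OF assms(2) f(1) l(1)] by simp
qed

subsection \<open>Singular members of the pencil\<close>

lemma pencil_common_zero:
  fixes u :: "complex ^ 3"
  assumes f: "homogeneous 3 f" "poly_eval f e = 0" and g: "homogeneous 3 g" "poly_eval g e = 0"
  defines "l0 \<equiv> coeff (line_poly u e g) 2" and "q0 \<equiv> coeff (line_poly u e g) 1" and "c0 \<equiv> coeff (line_poly u e g) 0"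
    and "l1 \<equiv> coeff (line_poly u e f) 2" and "q1 \<equiv> coeff (line_poly u e f) 1" and "c1 \<equiv> coeff (line_poly u e f) 0"
  assumes E: "(2 * q0 * q1 - 4 * (l0 * c1 + l1 * c0))\<^sup>2 - 4 * (q1\<^sup>2 - 4 * l1 * c1) * (q0\<^sup>2 - 4 * l0 * c0) = 0"
    and l1: "l1 \<noteq> 0"
  obtains z where "poly_eval f (u + z *s e) = 0" "poly_eval g (u + z *s e) = 0"
proof -
  have "(l1 * c0 - l0 * c1)\<^sup>2 = (l1 * q0 - l0 * q1) * (q1 * c0 - q0 * c1)"
  proof -
    have "16 * ((l0 * c1 - l1 * c0)\<^sup>2 - (l0 * q1 - l1 * q0) * (q0 * c1 - q1 * c0)) = 0"
      using E unfolding discriminant_discriminant .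
    then have "(l0 * c1 - l1 * c0)\<^sup>2 - (l0 * q1 - l1 * q0) * (q0 * c1 - q1 * c0) = 0"
      by simp
    then show ?thesis
      by algebra
  qed
  then obtain z where "l1 * z\<^sup>2 + q1 * z + c1 = 0" "l0 * z\<^sup>2 + q0 * z + c0 = 0"
    using common_root_of_resultant_aux[OF _ l1] by blast
  then show thesis
    using that[of z] poly_eval_cubic_on_line[OF f, of u z] poly_eval_cubic_on_line[OF g, of u z]
    by (simp add: l0_def q0_def c0_def l1_def q1_def c1_def)
qed

lemma pt_smult:
  assumes "c \<noteq> 0"
  shows "pt (c *s v) = pt v"
proof -
  have "range (\<lambda>a. a *s (c *s v)) = range (\<lambda>a. a *s v)"
  proof (intro equalityI image_subsetI)
    fix a
    show "a *s (c *s v) \<in> range (\<lambda>a. a *s v)"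
      by (rule range_eqI[of _ _ "a * c"]) (simp add: vector_smult_assoc)
    show "a *s v \<in> range (\<lambda>a. a *s (c *s v))"
      by (rule range_eqI[of _ _ "a / c"]) (simp add: vector_smult_assoc assms)
  qed
  then show ?thesis
    by (simp add: pt_def vec_span_singleton)
qed

lemma (in eight_points) card_points_on_line_through:
  assumes gp: general_position and u: "u \<noteq> 0" "pt u \<noteq> p i"
    and J: "\<And>j. j \<in> J \<Longrightarrow> j \<noteq> i \<and> (\<exists>z. u + z *s rep (p i) \<noteq> 0 \<and> p j = pt (u + z *s rep (p i)))"
  shows "card J \<le> 2"
proof -
  obtain l where l: "homogeneous 1 l" "l \<noteq> 0" "vanishes_at l (p i)" "vanishes_at l (pt u)"
    by (rule line_through)
  have "insert i J \<subseteq> N l"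
  proof
    fix j assume "j \<in> insert i J"
    show "j \<in> N l"
    proof (cases "j = i")
      case True
      then show ?thesis
        using l(3) by (simp add: N_def)
    next
      case False
      then obtain z where z: "u + z *s rep (p i) \<noteq> 0" "p j = pt (u + z *s rep (p i))"
        using J \<open>j \<in> insert i J\<close> by blast
      have "poly_eval l u = 0" "poly_eval l (rep (p i)) = 0"
        using l(3,4) by (simp_all add: vanishes_at_imp_eval vanishes_at_pt[OF l(1) u(1)])
      then have "vanishes_at l (pt (u + z *s rep (p i)))"
        by (simp add: vanishes_at_pt[OF l(1) z(1)] poly_eval_linear[OF l(1)])
      then show ?thesis
        unfolding N_def z(2)[symmetric] by simp
    qed
  qed
  then have "card (insert i J) \<le> card (N l)"
    by (intro card_mono) auto
  also have "\<dots> \<le> 3"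
    using card_N_linear[OF gp l(1,2)] .
  moreover have "i \<notin> J"
    using J by blast
  ultimately show ?thesis
    by simp
qed

text \<open>Projecting from a base point \<open>e\<close> that is not singular on \<open>f\<close>, the member \<open>g + t f\<close>
  restricts to a quadratic polynomial on each line through \<open>e\<close>; its discriminant is a polynomial
  \<open>A t\<^sup>2 + B t + C\<close> whose coefficients are quartics in the direction of the line. Singular members
  yield critical points of this polynomial, and the zeros of \<open>E = B\<^sup>2 - 4 A C\<close>, of degree at
  most 8, are the directions of the other base points. If infinitely many members were singular, then
  \<open>E\<close> would have a quadruple zero, leaving too few zeros for the seven remaining points.\<close>

lemma (in eight_points) finite_singular_members:
  assumes gp: general_position and f: "f \<in> V" "irreducible f" and g: "g \<in> V" "\<not> f dvd g"
  shows "finite {t. \<exists>r. singular_at (g + poly_scale t f) r}"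
proof (rule ccontr)
  assume inf: "infinite {t. \<exists>r. singular_at (g + poly_scale t f) r}"
  have hom: "homogeneous 3 f" "homogeneous 3 g"
    using f g by (auto simp: V_def)
  have on_p: "poly_eval f (rep (p j)) = 0" "poly_eval g (rep (p j)) = 0" for j
    using f g by (auto simp: V_def vanishes_at_imp_eval)
  obtain i w where iw: "ddir (rep (p i)) w f \<noteq> 0"
    using ex_nonsingular_point[OF f] .
  define e where "e = rep (p i)"
  have e: "e \<noteq> 0" "poly_eval f e = 0" "poly_eval g e = 0"
    using rep(1) on_p by (simp_all add: e_def)
  define F where "F t = g + poly_scale t f" for t
  have F: "homogeneous 3 (F t)" "poly_eval (F t) e = 0" for t
    using hom e by (auto simp: F_def intro: homogeneous_add homogeneous_scale)
  \<comment> \<open>a basis in which the line through \<open>e\<close> and \<open>b\<close> contains no further base point\<close>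
  obtain a0 b0 where ab0: "is_basis a0 b0 e"
    using basis_extendE[OF e(1)] .
  have "ddir e a0 f \<noteq> 0 \<or> ddir e b0 f \<noteq> 0"
  proof -
    obtain \<alpha> \<beta> \<gamma> where "w = \<alpha> *s a0 + \<beta> *s b0 + \<gamma> *s e"
      using is_basis_spanE[OF ab0] .
    then have "ddir e w f = \<alpha> * ddir e a0 f + \<beta> * ddir e b0 f"
      by (simp add: ddir_add_left ddir_scale_left ddir_Euler_zero[OF hom(1) e(2)])
    then show ?thesis
      using iw unfolding e_def by auto
  qed
  then have "[:ddir e a0 f, ddir e b0 f:] \<noteq> 0"
    by auto
  then have "finite {s. poly [:ddir e a0 f, ddir e b0 f:] s = 0}"
    by (rule poly_roots_finite)
  moreover have "finite {s. \<exists>z. poly_eval f (a0 + s *s b0 + z *s e) = 0 \<and> poly_eval g (a0 + s *s b0 + z *s e) = 0}"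
    by (rule finite_base_directions[OF f(2) hom(1,2) g(2) ab0])
  ultimately have "finite ({s. poly [:ddir e a0 f, ddir e b0 f:] s = 0} \<union>
      {s. \<exists>z. poly_eval f (a0 + s *s b0 + z *s e) = 0 \<and> poly_eval g (a0 + s *s b0 + z *s e) = 0})"
    by (rule finite_UnI)
  then obtain s1 where s1: "poly [:ddir e a0 f, ddir e b0 f:] s1 \<noteq> 0"
    "\<And>z. \<not> (poly_eval f (a0 + s1 *s b0 + z *s e) = 0 \<and> poly_eval g (a0 + s1 *s b0 + z *s e) = 0)"
    using ex_new_if_finite[OF infinite_UNIV_char_0] by blast
  define a where "a = b0"
  define b where "b = a0 + s1 *s b0"
  have ab: "is_basis a b e"
    unfolding is_basis_def
  proof (intro allI impI)
    fix \<alpha> \<beta> \<gamma> assume "\<alpha> *s a + \<beta> *s b + \<gamma> *s e = 0"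
    then have "\<beta> *s a0 + (\<alpha> + \<beta> * s1) *s b0 + \<gamma> *s e = 0"
      by (simp add: a_def b_def vec_eq_iff algebra_simps)
    then show "\<alpha> = 0 \<and> \<beta> = 0 \<and> \<gamma> = 0"
      using is_basisD[OF ab0] by fastforce
  qed
  have b: "ddir e b f \<noteq> 0"
    using s1(1) by (simp add: b_def ddir_add_left ddir_scale_left)
  have no_base: "\<not> (poly_eval f (b + z *s e) = 0 \<and> poly_eval g (b + z *s e) = 0)" for z
    using s1(2) by (simp add: b_def)
  define Lf where "Lf = coeff (plane_poly a b e f) 2"
  define Qf where "Qf = coeff (plane_poly a b e f) 1"
  define Cf where "Cf = coeff (plane_poly a b e f) 0"
  define Lg where "Lg = coeff (plane_poly a b e g) 2"
  define Qg where "Qg = coeff (plane_poly a b e g) 1"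
  define Cg where "Cg = coeff (plane_poly a b e g) 0"
  have Pf: "poly Lf s = coeff (line_poly (a + s *s b) e f) 2" "poly Qf s = coeff (line_poly (a + s *s b) e f) 1"
    "poly Cf s = coeff (line_poly (a + s *s b) e f) 0" for s
    by (simp_all only: Lf_def Qf_def Cf_def poly_coeff_plane_poly)
  have Pg: "poly Lg s = coeff (line_poly (a + s *s b) e g) 2" "poly Qg s = coeff (line_poly (a + s *s b) e g) 1"
    "poly Cg s = coeff (line_poly (a + s *s b) e g) 0" for s
    by (simp_all only: Lg_def Qg_def Cg_def poly_coeff_plane_poly)
  note f_eval = poly_eval_cubic_on_line[OF hom(1) e(2), of "a + s *s b" z for s z, folded Pf]
  note g_eval = poly_eval_cubic_on_line[OF hom(2) e(3), of "a + s *s b" z for s z, folded Pg]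
  define A where "A = Qf\<^sup>2 - 4 * Lf * Cf"
  define B where "B = 2 * Qg * Qf - 4 * (Lg * Cf + Lf * Cg)"
  define C where "C = Qg\<^sup>2 - 4 * Lg * Cg"
  define E where "E = B\<^sup>2 - 4 * A * C"
  define X where "X = Lg * Cf - Lf * Cg"
  define Y where "Y = Lg * Qf - Lf * Qg"
  define Z where "Z = Qg * Cf - Qf * Cg"
  have E_res: "E = 16 * (X\<^sup>2 - Y * Z)"
    unfolding E_def A_def B_def C_def X_def Y_def Z_def by (rule discriminant_discriminant)
  have deg_E: "degree E \<le> 8"
  proof -
    have bf: "bidegree_le 3 (plane_poly a b e f)" "bidegree_le 3 (plane_poly a b e g)"
      using bidegree_le_plane_poly hom by blast+
    have dl: "degree Lf \<le> 1" "degree Qf \<le> 2" "degree Cf \<le> 3" "degree Lg \<le> 1" "degree Qg \<le> 2" "degree Cg \<le> 3"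
      using bf unfolding bidegree_le_def Lf_def Qf_def Cf_def Lg_def Qg_def Cg_def
      by (metis diff_zero add_diff_cancel_left' numeral_3_eq_3 numeral_2_eq_2 diff_Suc_Suc One_nat_def)+
    have m: "degree (p * q) \<le> k" if "degree p \<le> k1" "degree q \<le> k2" "k1 + k2 \<le> k" for p q :: "complex poly" and k k1 k2
      using degree_mult_le[of p q] that by linarith
    have "degree X \<le> 4" "degree Y \<le> 3" "degree Z \<le> 5"
      unfolding X_def Y_def Z_def by (intro degree_diff_le m[OF dl(4,3)] m[OF dl(1,6)] m[OF dl(4,2)] m[OF dl(1,5)] m[OF dl(5,3)] m[OF dl(2,6)]; simp)+
    then have "degree (X\<^sup>2 - Y * Z) \<le> 8"
      unfolding power2_eq_square by (intro degree_diff_le m[of X 4 X 4] m[of Y 3 Z 5]) auto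
    then show ?thesis
      unfolding E_res by (simp add: numeral_poly)
  qed
  have Lf_dir: "poly Lf s = ddir e a f + s * ddir e b f" for s
    unfolding Pf ddir_eq_coeff[symmetric] using coeff_line_poly_swap[OF hom(1), of 2 "a + s *s b" e]
    by (simp add: ddir_eq_coeff[symmetric, unfolded One_nat_def] ddir_add_left ddir_scale_left)
  have E0: "E \<noteq> 0"
  proof
    assume "E = 0"
    have "[:ddir e a f, ddir e b f:] \<noteq> 0"
      using b by simp
    then have "finite {s. poly [:ddir e a f, ddir e b f:] s = 0}"
      by (rule poly_roots_finite)
    then have "finite ({s. poly [:ddir e a f, ddir e b f:] s = 0} \<union>
      {s. \<exists>z. poly_eval f (a + s *s b + z *s e) = 0 \<and> poly_eval g (a + s *s b + z *s e) = 0})"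
      using finite_base_directions[OF f(2) hom(1,2) g(2) ab] by (rule finite_UnI)
    then obtain s where s: "poly [:ddir e a f, ddir e b f:] s \<noteq> 0"
      "\<And>z. \<not> (poly_eval f (a + s *s b + z *s e) = 0 \<and> poly_eval g (a + s *s b + z *s e) = 0)"
      using ex_new_if_finite[OF infinite_UNIV_char_0] by blast
    have "poly E s = 0"
      using \<open>E = 0\<close> by simp
    then have "(2 * poly Qg s * poly Qf s - 4 * (poly Lg s * poly Cf s + poly Lf s * poly Cg s))\<^sup>2
        - 4 * ((poly Qf s)\<^sup>2 - 4 * poly Lf s * poly Cf s) * ((poly Qg s)\<^sup>2 - 4 * poly Lg s * poly Cg s) = 0"
      unfolding E_def A_def B_def C_def poly_diff poly_power poly_mult poly_add poly_numeral .
    moreover have "poly Lf s \<noteq> 0"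
      using s(1) by (simp add: Lf_dir)
    ultimately obtain z where "poly_eval f (a + s *s b + z *s e) = 0" "poly_eval g (a + s *s b + z *s e) = 0"
      unfolding Pf Pg by (rule pencil_common_zero[OF hom(1) e(2) hom(2) e(3)])
    then show False
      using s(2) by blast
  qed
  have T1: "finite {t. singular_vec (F t) e}"
  proof (rule finite_subset)
    show "{t. singular_vec (F t) e} \<subseteq> {t. poly [:ddir e b g, ddir e b f:] t = 0}"
      using singular_vec_ddir[of "F _" e b] by (auto simp: F_def ddir_pencil)
    show "finite {t. poly [:ddir e b g, ddir e b f:] t = 0}"
      by (rule poly_roots_finite) (use b in simp)
  qed
  have T2: "finite {t. \<exists>z. singular_vec (F t) (b + z *s e)}"
  proof -
    define l0 where "l0 = coeff (line_poly b e g) 2"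
    define q0 where "q0 = coeff (line_poly b e g) 1"
    define c0 where "c0 = coeff (line_poly b e g) 0"
    define l1 where "l1 = coeff (line_poly b e f) 2"
    define q1 where "q1 = coeff (line_poly b e f) 1"
    define c1 where "c1 = coeff (line_poly b e f) 0"
    have l1: "l1 \<noteq> 0"
      using b coeff_line_poly_swap[OF hom(1), of 2 b e] by (simp add: l1_def ddir_eq_coeff)
    let ?T = "{t. (q1\<^sup>2 - 4 * l1 * c1) * t\<^sup>2 + (2 * q0 * q1 - 4 * (l0 * c1 + l1 * c0)) * t + (q0\<^sup>2 - 4 * l0 * c0) = 0}"
    have "{t. \<exists>z. singular_vec (F t) (b + z *s e)} \<subseteq> ?T"
    proof
      fix t assume "t \<in> {t. \<exists>z. singular_vec (F t) (b + z *s e)}"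
      then obtain z where "singular_vec (F t) (b + z *s e)"
        by blast
      then have "(q0 + t * q1)\<^sup>2 - 4 * (l0 + t * l1) * (c0 + t * c1) = 0"
        using singular_cubic_on_line(3)[OF F, of t b z]
        by (simp add: F_def line_poly_scale l0_def q0_def c0_def l1_def q1_def c1_def)
      then have "(q1\<^sup>2 - 4 * l1 * c1) * t\<^sup>2 + (2 * q0 * q1 - 4 * (l0 * c1 + l1 * c0)) * t + (q0\<^sup>2 - 4 * l0 * c0) = 0"
        by algebra
      then show "t \<in> ?T"
        by blast
    qed
    moreover have "finite ?T"
    proof (rule finite_quadratic_roots, rule ccontr)
      assume n: "\<not> (q1\<^sup>2 - 4 * l1 * c1 \<noteq> 0 \<or> 2 * q0 * q1 - 4 * (l0 * c1 + l1 * c0) \<noteq> 0 \<or> q0\<^sup>2 - 4 * l0 * c0 \<noteq> 0)"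
      then have "(2 * q0 * q1 - 4 * (l0 * c1 + l1 * c0))\<^sup>2 - 4 * (q1\<^sup>2 - 4 * l1 * c1) * (q0\<^sup>2 - 4 * l0 * c0) = 0"
        by simp
      then obtain z where "poly_eval f (b + z *s e) = 0" "poly_eval g (b + z *s e) = 0"
        using l1 unfolding l0_def q0_def c0_def l1_def q1_def c1_def
        by (rule pencil_common_zero[OF hom(1) e(2) hom(2) e(3)])
      then show False
        using no_base by blast
    qed
    ultimately show ?thesis
      by (rule finite_subset)
  qed
  define T where "T = {t. \<exists>s z. singular_vec (F t) (a + s *s b + z *s e)}"
  have "{t. \<exists>r. singular_at (g + poly_scale t f) r} \<subseteq>
      {t. singular_vec (F t) e} \<union> {t. \<exists>z. singular_vec (F t) (b + z *s e)} \<union> T"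
  proof
    fix t assume "t \<in> {t. \<exists>r. singular_at (g + poly_scale t f) r}"
    then obtain r where r: "singular_at (F t) r"
      by (auto simp: F_def)
    obtain \<alpha> \<beta> \<gamma> where v: "rep r = \<alpha> *s a + \<beta> *s b + \<gamma> *s e"
      using is_basis_spanE[OF ab] .
    note sing = singular_vec_of_singular_at[OF r]
    consider "\<alpha> \<noteq> 0" | "\<alpha> = 0" "\<beta> \<noteq> 0" | "\<alpha> = 0" "\<beta> = 0"
      by blast
    then show "t \<in> {t. singular_vec (F t) e} \<union> {t. \<exists>z. singular_vec (F t) (b + z *s e)} \<union> T"
    proof cases
      case 1
      then have "inverse \<alpha> *s rep r = a + (\<beta> / \<alpha>) *s b + (\<gamma> / \<alpha>) *s e"
        unfolding v by (simp add: vec_eq_iff field_simps)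
      then show ?thesis
        using sing[of "inverse \<alpha>"] unfolding T_def by auto
    next
      case 2
      then have "inverse \<beta> *s rep r = b + (\<gamma> / \<beta>) *s e"
        unfolding v by (simp add: vec_eq_iff field_simps)
      then show ?thesis
        using sing[of "inverse \<beta>"] by auto
    next
      case 3
      then have "\<gamma> \<noteq> 0"
        using v rep(1)[of r] by auto
      then have "inverse \<gamma> *s rep r = e"
        unfolding v using 3 by (simp add: vec_eq_iff)
      then show ?thesis
        using sing[of "inverse \<gamma>"] by auto
    qed
  qed
  then have "infinite T"
    using inf T1 T2 finite_subset by blast
  have "\<forall>t. \<exists>s. t \<in> T \<longrightarrow> (\<exists>z. singular_vec (F t) (a + s *s b + z *s e))"
    unfolding T_def by blast
  then obtain \<sigma> where "\<forall>t. t \<in> T \<longrightarrow> (\<exists>z. singular_vec (F t) (a + \<sigma> t *s b + z *s e))"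
    by (rule choice[THEN exE])
  then have sing: "\<exists>z. singular_vec (F t) (a + \<sigma> t *s b + z *s e)" if "t \<in> T" for t
    using that by blast
  have crit: "poly A (\<sigma> t) * t\<^sup>2 + poly B (\<sigma> t) * t + poly C (\<sigma> t) = 0 \<and>
      poly (pderiv A) (\<sigma> t) * t\<^sup>2 + poly (pderiv B) (\<sigma> t) * t + poly (pderiv C) (\<sigma> t) = 0" if t: "t \<in> T" for t
  proof -
    let ?s = "\<sigma> t"
    obtain z where z: "singular_vec (F t) (a + ?s *s b + z *s e)"
      using sing[OF t] by blast
    define L where "L = Lg + smult t Lf"
    define Q where "Q = Qg + smult t Qf"
    define D where "D = Cg + smult t Cf"
    have P: "coeff (line_poly (a + s *s b) e (F t)) 2 = poly L s" "coeff (line_poly (a + s *s b) e (F t)) 1 = poly Q s"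
      "coeff (line_poly (a + s *s b) e (F t)) 0 = poly D s" for s
      by (simp_all add: F_def line_poly_scale L_def Q_def D_def Pf Pg)
    have root: "poly L ?s * z\<^sup>2 + poly Q ?s * z + poly D ?s = 0" "2 * poly L ?s * z + poly Q ?s = 0"
      using singular_cubic_on_line(1,2)[OF F z] unfolding P by blast+
    have "line_poly (a + z *s e) b (F t) = smult (z\<^sup>2) L + smult z Q + D"
    proof (rule poly_eqI_infinite[OF infinite_UNIV_char_0])
      fix x
      have swap: "a + z *s e + x *s b = a + x *s b + z *s e"
        by (simp add: algebra_simps)
      show "poly (line_poly (a + z *s e) b (F t)) x = poly (smult (z\<^sup>2) L + smult z Q + D) x"
        unfolding poly_line_poly swap poly_eval_cubic_on_line[OF F] P by (simp add: mult.commute)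
    qed
    moreover have "poly (pderiv (line_poly (a + z *s e) b (F t))) ?s = 0"
    proof -
      have swap: "a + z *s e + ?s *s b = a + ?s *s b + z *s e"
        by (simp add: algebra_simps)
      show ?thesis
        unfolding poly_pderiv_line_poly swap by (rule singular_vec_ddir[OF z])
    qed
    ultimately have der: "z\<^sup>2 * poly (pderiv L) ?s + z * poly (pderiv Q) ?s + poly (pderiv D) ?s = 0"
      by (simp add: pderiv_add pderiv_smult)
    have AL: "poly A s * t\<^sup>2 + poly B s * t + poly C s = (poly Q s)\<^sup>2 - 4 * poly L s * poly D s" for s
      unfolding A_def B_def C_def Q_def L_def D_def by (simp add: numeral_poly) algebra
    have AL': "poly (pderiv A) s * t\<^sup>2 + poly (pderiv B) s * t + poly (pderiv C) s =
        2 * poly Q s * poly (pderiv Q) s - 4 * (poly (pderiv L) s * poly D s + poly L s * poly (pderiv D) s)" for s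
    proof -
      have "poly (pderiv A) s = 2 * poly Qf s * poly (pderiv Qf) s - 4 * (poly (pderiv Lf) s * poly Cf s + poly Lf s * poly (pderiv Cf) s)"
        unfolding A_def by (simp add: power2_eq_square pderiv_diff pderiv_mult pderiv_smult numeral_poly algebra_simps)
      moreover have "poly (pderiv C) s = 2 * poly Qg s * poly (pderiv Qg) s - 4 * (poly (pderiv Lg) s * poly Cg s + poly Lg s * poly (pderiv Cg) s)"
        unfolding C_def by (simp add: power2_eq_square pderiv_diff pderiv_mult pderiv_smult numeral_poly algebra_simps)
      moreover have "poly (pderiv B) s = 2 * (poly (pderiv Qg) s * poly Qf s + poly Qg s * poly (pderiv Qf) s)
          - 4 * (poly (pderiv Lg) s * poly Cf s + poly Lg s * poly (pderiv Cf) s + poly (pderiv Lf) s * poly Cg s + poly Lf s * poly (pderiv Cg) s)"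
        unfolding B_def by (simp add: pderiv_diff pderiv_add pderiv_mult pderiv_smult numeral_poly algebra_simps)
      moreover have "poly Q s = poly Qg s + t * poly Qf s" "poly L s = poly Lg s + t * poly Lf s" "poly D s = poly Cg s + t * poly Cf s"
        "poly (pderiv Q) s = poly (pderiv Qg) s + t * poly (pderiv Qf) s" "poly (pderiv L) s = poly (pderiv Lg) s + t * poly (pderiv Lf) s"
        "poly (pderiv D) s = poly (pderiv Cg) s + t * poly (pderiv Cf) s"
        by (simp_all add: Q_def L_def D_def pderiv_add pderiv_smult)
      ultimately show ?thesis
        by algebra
    qed
    show ?thesis
      unfolding AL AL' using root der by algebra
  qed
  obtain s0 where s0: "[:- s0, 1:] ^ 4 dvd E"
    using infinite_critical_parameters[OF E0[unfolded E_def] \<open>infinite T\<close>] crit unfolding E_def by blast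
  have "\<exists>s z. p j = pt (a + s *s b + z *s e)" if "j \<noteq> i" for j
  proof -
    obtain \<alpha> \<beta> \<gamma> where v: "rep (p j) = \<alpha> *s a + \<beta> *s b + \<gamma> *s e"
      using is_basis_spanE[OF ab] .
    have "\<alpha> \<noteq> 0"
    proof
      assume \<alpha>: "\<alpha> = 0"
      show False
      proof (cases "\<beta> = 0")
        case True
        then have "rep (p j) = \<gamma> *s rep (p i)"
          using v \<alpha> by (simp add: e_def)
        then show False
          using rep_eq_smult_imp_eq inj \<open>j \<noteq> i\<close> by (metis injD)
      next
        case False
        then have eq: "rep (p j) = \<beta> *s (b + (\<gamma> / \<beta>) *s e)"
          unfolding v using \<alpha> by (simp add: vec_eq_iff field_simps)
        have "poly_eval f (b + (\<gamma> / \<beta>) *s e) = 0" "poly_eval g (b + (\<gamma> / \<beta>) *s e) = 0"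
          using on_p[of j] False unfolding eq poly_eval_homogeneous[OF hom(1)] poly_eval_homogeneous[OF hom(2)] by auto
        then show False
          using no_base by blast
      qed
    qed
    then have eq: "rep (p j) = \<alpha> *s (a + (\<beta> / \<alpha>) *s b + (\<gamma> / \<alpha>) *s e)"
      unfolding v by (simp add: vec_eq_iff field_simps)
    then have "p j = pt (a + (\<beta> / \<alpha>) *s b + (\<gamma> / \<alpha>) *s e)"
      using pt_smult[OF \<open>\<alpha> \<noteq> 0\<close>] by (metis pt_rep)
    then show ?thesis
      by blast
  qed
  then have "\<forall>j. \<exists>sz. j \<noteq> i \<longrightarrow> p j = pt (a + fst sz *s b + snd sz *s e)"
    by (metis fst_conv snd_conv)
  then obtain sz where sz: "\<forall>j. j \<noteq> i \<longrightarrow> p j = pt (a + fst (sz j) *s b + snd (sz j) *s e)"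
    by (rule choice[THEN exE])
  define \<rho> where "\<rho> j = fst (sz j)" for j
  define \<zeta> where "\<zeta> j = snd (sz j)" for j
  have pj: "p j = pt (a + \<rho> j *s b + \<zeta> j *s e)" if "j \<noteq> i" for j
    using sz that unfolding \<rho>_def \<zeta>_def by blast
  have zeros: "poly Lf (\<rho> j) * (\<zeta> j)\<^sup>2 + poly Qf (\<rho> j) * \<zeta> j + poly Cf (\<rho> j) = 0"
    "poly Lg (\<rho> j) * (\<zeta> j)\<^sup>2 + poly Qg (\<rho> j) * \<zeta> j + poly Cg (\<rho> j) = 0" if "j \<noteq> i" for j
  proof -
    have "vanishes_at f (p j)" "vanishes_at g (p j)"
      using f(1) g(1) by (auto simp: V_def)
    then show "poly Lf (\<rho> j) * (\<zeta> j)\<^sup>2 + poly Qf (\<rho> j) * \<zeta> j + poly Cf (\<rho> j) = 0"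
      "poly Lg (\<rho> j) * (\<zeta> j)\<^sup>2 + poly Qg (\<rho> j) * \<zeta> j + poly Cg (\<rho> j) = 0"
      unfolding pj[OF that] vanishes_at_pt[OF hom(1) is_basis_pencil_nonzero[OF ab]]
        vanishes_at_pt[OF hom(2) is_basis_pencil_nonzero[OF ab]] f_eval g_eval by blast+
  qed
  define K where "K s = {j. j \<noteq> i \<and> \<rho> j = s}" for s
  have card_K: "card (K s) \<le> 2" for s
  proof (rule card_points_on_line_through[OF gp, of "a + s *s b" i])
    show nz: "a + s *s b \<noteq> 0"
      using is_basis_pencil_nonzero[OF ab, of s 0] by simp
    show "pt (a + s *s b) \<noteq> p i"
    proof
      assume "pt (a + s *s b) = p i"
      then have "pt (a + s *s b) = pt e"
        by (simp add: e_def)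
      then obtain c where "a + s *s b = c *s e"
        using pt_eqD nz e(1) by metis
      then have "1 *s a + s *s b + (- c) *s e = 0"
        by simp
      then show False
        using is_basisD[OF ab] by fastforce
    qed
    show "j \<noteq> i \<and> (\<exists>z. a + s *s b + z *s rep (p i) \<noteq> 0 \<and> p j = pt (a + s *s b + z *s rep (p i)))" if "j \<in> K s" for j
      using that pj[of j] is_basis_pencil_nonzero[OF ab] unfolding K_def e_def by auto
  qed
  have dvd_K: "[:- s, 1:] ^ card (K s) dvd E" for s
  proof -
    consider "card (K s) = 0" | "card (K s) = 1" | "card (K s) = 2"
      using card_K[of s] by linarith
    then show ?thesis
    proof cases
      case 1
      then show ?thesis by simp
    next
      case 2
      then obtain j where j: "j \<noteq> i" "\<rho> j = s"
        by (auto simp: K_def card_1_singleton_iff)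
      have "(poly X s)\<^sup>2 - poly Y s * poly Z s = 0"
        using zeros[OF j(1)] unfolding j(2) X_def Y_def Z_def poly_diff poly_mult by algebra
      then have "poly E s = 0"
        unfolding E_res by (simp add: numeral_poly)
      then show ?thesis
        using 2 by (simp add: poly_eq_0_iff_dvd)
    next
      case 3
      then obtain j k where jk: "j \<noteq> k" "j \<noteq> i" "\<rho> j = s" "k \<noteq> i" "\<rho> k = s"
        by (auto simp: K_def card_2_iff)
      have z: "\<zeta> j - \<zeta> k \<noteq> 0"
      proof
        assume "\<zeta> j - \<zeta> k = 0"
        then have "p j = p k"
          using pj[OF jk(2)] pj[OF jk(4)] jk(3,5) by simp
        then show False
          using jk(1) inj by (metis injD)
      qed
      have qf: "poly Qf s = - poly Lf s * (\<zeta> j + \<zeta> k)" and qg: "poly Qg s = - poly Lg s * (\<zeta> j + \<zeta> k)"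
      proof -
        have "(\<zeta> j - \<zeta> k) * (poly Qf s + poly Lf s * (\<zeta> j + \<zeta> k)) = 0" "(\<zeta> j - \<zeta> k) * (poly Qg s + poly Lg s * (\<zeta> j + \<zeta> k)) = 0"
          using zeros[OF jk(2)] zeros[OF jk(4)] unfolding jk(3,5) by algebra+
        then have "poly Qf s + poly Lf s * (\<zeta> j + \<zeta> k) = 0" "poly Qg s + poly Lg s * (\<zeta> j + \<zeta> k) = 0"
          using z by simp_all
        then show "poly Qf s = - poly Lf s * (\<zeta> j + \<zeta> k)" "poly Qg s = - poly Lg s * (\<zeta> j + \<zeta> k)"
          by algebra+
      qed
      have "poly X s = 0" "poly Y s = 0" "poly Z s = 0"
        using zeros[OF jk(2)] qf qg unfolding jk(3) X_def Y_def Z_def poly_diff poly_mult by algebra+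
      then have XYZ: "[:- s, 1:] dvd X" "[:- s, 1:] dvd Y" "[:- s, 1:] dvd Z"
        by (simp_all add: poly_eq_0_iff_dvd)
      have "[:- s, 1:]\<^sup>2 dvd X\<^sup>2" "[:- s, 1:]\<^sup>2 dvd Y * Z"
        unfolding power2_eq_square by (rule mult_dvd_mono[OF XYZ(1,1)], rule mult_dvd_mono[OF XYZ(2,3)])
      then have "[:- s, 1:]\<^sup>2 dvd E"
        unfolding E_res by (rule dvd_mult[OF dvd_diff])
      then show ?thesis
        using 3 by simp
    qed
  qed
  define S where "S = \<rho> ` (- {i})"
  define m where "m s = (if s = s0 then 4 else card (K s))" for s
  have "(\<Sum>s\<in>insert s0 S. m s) \<le> degree E"
    by (rule poly_orders_le_degree) (use s0 dvd_K E0 in \<open>auto simp: S_def m_def\<close>)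
  moreover have "(\<Sum>s\<in>insert s0 S. card (K s)) = 7"
  proof -
    have "(\<Sum>s\<in>insert s0 S. card (K s)) = (\<Sum>s\<in>S. card (K s))"
      by (rule sum.mono_neutral_right) (auto simp: S_def K_def)
    also have "\<dots> = (\<Sum>s\<in>\<rho> ` (- {i}). \<Sum>j\<in>{j \<in> - {i}. \<rho> j = s}. 1)"
      by (simp add: S_def K_def)
    also have "\<dots> = (\<Sum>j\<in>- {i}. 1)"
      by (rule sum.image_gen[symmetric]) simp
    also have "\<dots> = 7"
      by (simp add: Compl_eq_Diff_UNIV card_Diff_subset)
    finally show ?thesis .
  qed
  moreover have "(\<Sum>s\<in>insert s0 S. card (K s)) + 2 \<le> (\<Sum>s\<in>insert s0 S. m s)"
  proof -
    have fin: "finite (insert s0 S)"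
      by (simp add: S_def)
    have "(\<Sum>s\<in>insert s0 S. m s) = m s0 + (\<Sum>s\<in>insert s0 S - {s0}. m s)"
      by (rule sum.remove[OF fin]) simp
    moreover have "(\<Sum>s\<in>insert s0 S. card (K s)) = card (K s0) + (\<Sum>s\<in>insert s0 S - {s0}. card (K s))"
      by (rule sum.remove[OF fin]) simp
    moreover have "(\<Sum>s\<in>insert s0 S - {s0}. m s) = (\<Sum>s\<in>insert s0 S - {s0}. card (K s))"
      by (rule sum.cong) (auto simp: m_def)
    ultimately show ?thesis
      using card_K[of s0] by (simp add: m_def)
  qed
  ultimately show False
    using deg_E by linarith
qed

lemma (in eight_points) finite_discriminant:
  assumes gp: general_position
  shows "finite (cubics_through p \<inter> discriminant)"
proof -
  obtain f g where fg: "f \<in> V" "g \<in> V" "irreducible f" "\<not> f dvd g" and V: "V = poly3.span {f, g}"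
    and "ideal_generated V = {u * f + v * g |u v. True}"
    by (rule pencil_ideal[OF gp])
  let ?T = "{t. \<exists>r. singular_at (g + poly_scale t f) r}"
  have span_scale: "poly3.span {poly_scale c h} = poly3.span {h}" if "c \<noteq> 0" for c h
    by (rule poly3.span_image_scale[of "{h}" "\<lambda>_. c", simplified]) (use that in auto)
  have "cubics_through p \<inter> discriminant \<subseteq> insert (poly3.span {f}) ((\<lambda>t. poly3.span {g + poly_scale t f}) ` ?T)"
  proof
    fix c assume c: "c \<in> cubics_through p \<inter> discriminant"
    obtain v where v: "c = poly3.span {v}" "v \<in> V" "v \<noteq> 0"
      using c unfolding cubics_through_def projectivization_def V_def by blast
    obtain h r where h: "h \<in> c" "h \<noteq> 0" "singular_at h r"
      using c unfolding discriminant_def by blast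
    obtain k where k: "h = poly_scale k v"
      using h(1) unfolding v(1) poly3_span_singleton by blast
    have ch: "c = poly3.span {h}"
      using span_scale[of k v] h(2) unfolding v(1) k by force
    have "h \<in> V"
      unfolding k using subspace_V v(2) poly3.subspace_scale by blast
    then obtain y where "h - poly_scale y g \<in> poly3.span {f}"
      unfolding V by (auto simp: poly3.span_insert insert_commute[of f g])
    then obtain x where "h - poly_scale y g = poly_scale x f"
      unfolding poly3_span_singleton by blast
    then have hxy: "h = poly_scale y g + poly_scale x f"
      by (simp add: diff_eq_eq add.commute)
    show "c \<in> insert (poly3.span {f}) ((\<lambda>t. poly3.span {g + poly_scale t f}) ` ?T)"
    proof (cases "y = 0")
      case True
      then have "x \<noteq> 0" "h = poly_scale x f"
        using hxy h(2) by auto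
      then show ?thesis
        unfolding ch using span_scale by blast
    next
      case False
      then have eq: "g + poly_scale (x / y) f = poly_scale (inverse y) h"
        unfolding hxy by (simp add: poly3.scale_right_distrib divide_inverse mult.commute)
      have "singular_at (poly_scale (inverse y) h) r"
        using h(3) unfolding singular_at_def vanishes_at_def
        by (simp add: poly_eval_partial_deriv line_poly_scale pderiv_smult)
      then have "x / y \<in> ?T"
        unfolding eq[symmetric] by blast
      moreover have "c = poly3.span {g + poly_scale (x / y) f}"
        unfolding ch eq using span_scale False by simp
      ultimately show ?thesis
        by blast
    qed
  qed
  moreover have "finite ?T"
    by (rule finite_singular_members[OF gp fg(1,3,2,4)])
  ultimately show ?thesis
    by (meson finite.insertI finite_imageI finite_subset)
qed

theorem proposition2p1:
  fixes p :: "8 \<Rightarrow> proj_plane"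
  assumes "inj p"
  shows "(finite (cubics_through p \<inter> discriminant)
          \<longleftrightarrow> (\<exists>f. homogeneous 3 f \<and> irreducible f \<and> (\<forall>i. vanishes_at f (p i))))
       \<and> ((\<exists>f. homogeneous 3 f \<and> irreducible f \<and> (\<forall>i. vanishes_at f (p i)))
          \<longleftrightarrow> \<not> (\<exists>S l. card S = 4 \<and> is_line l \<and> (\<forall>i\<in>S. vanishes_at l (p i)))
            \<and> \<not> (\<exists>S q. card S = 7 \<and> is_conic q \<and> (\<forall>i\<in>S. vanishes_at q (p i))))
       \<and> ((\<not> (\<exists>S l. card S = 4 \<and> is_line l \<and> (\<forall>i\<in>S. vanishes_at l (p i)))
            \<and> \<not> (\<exists>S q. card S = 7 \<and> is_conic q \<and> (\<forall>i\<in>S. vanishes_at q (p i))))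
          \<longleftrightarrow> (\<exists>q. residue p = reduced_point q))"
proof -
  interpret eight_points p
    by unfold_locales fact
  have ex: "(\<exists>f. homogeneous 3 f \<and> irreducible f \<and> (\<forall>i. vanishes_at f (p i))) \<longleftrightarrow> (\<exists>f\<in>V. irreducible f)"
    by (auto simp: V_def)
  have 1: "finite (cubics_through p \<inter> discriminant) \<Longrightarrow> \<exists>f\<in>V. irreducible f"
    using finite_discriminant_imp_irreducible by blast
  have 2: "\<exists>f\<in>V. irreducible f \<Longrightarrow> general_position"
    using general_position_of_irreducible by blast
  have 3: "general_position \<Longrightarrow> \<exists>f\<in>V. irreducible f"
    using ex_irreducible_cubic by blast
  have 4: "general_position \<Longrightarrow> \<exists>q. residue p = reduced_point q"
    using residue_of_general_position by blast
  have 5: "\<exists>q. residue p = reduced_point q \<Longrightarrow> general_position"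
    using general_position_of_residue by blast
  show ?thesis
    unfolding ex general_position_iff[symmetric]
    using 1 2 3 4 5 finite_discriminant by blast
qed

end
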